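(* Let $\Sigma$ be a smooth fan with $n$ rays, let $\mathfrak v:A\to\mathcal O_\Sigma$ be a valuation corresponding to a toric flat sheaf of algebras on $Y(\Sigma)$, with finite Khovanskii basis $\mathcal B=\{b_1,\dots,b_d\}\subset A$ and diagram $D$ with rows $w_1,\dots,w_n$. Let $\mathcal I_{\mathcal B}\subset\mathbf k[X_1,\dots,X_n,Y_1,\dots,Y_d]$ be the kernel of the map to $A\otimes_{\mathbf k}\mathbf k[t_1^{\pm1},\dots,t_n^{\pm1}]$ with $X_i\mapsto t_i^{-1}$ and $Y_j\mapsto b_j\prod_{i}t_i^{\mathfrak v(b_j)(\rho_i)}$, and let $\tilde w_i\in\operatorname{Trop}(\mathcal I_{\mathcal B})$ be the lift of $w_i$, i.e. the weight assigning $(w_i)_j=\mathfrak v(b_j)(\rho_i)$ to $Y_j$ and $0$ to every $X_k$. Then $\mathcal B$ is a strong Khovanskii basis if and only if each $\tilde w_i$, $1\le i\le n$, is a prime point, that is, the initial ideal $\operatorname{in}_{\tilde w_i}(\mathcal I_{\mathcal B})$ is prime.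
   Context: $\mathbf k$ is algebraically closed, $\Sigma$ a smooth fan in $N_{\mathbb Q}$ ($N$ a lattice, $M=\operatorname{Hom}(N,\mathbb Z)$) with primitive ray generators $\rho_1,\dots,\rho_n$. $\mathcal O_\Sigma$ is the semifield of integral piecewise linear functions on $|\Sigma|$ under $\min,+$ (with $\infty$ adjoined). $A$ is a finitely generated positively graded $\mathbf k$-domain. A valuation satisfies $\mathfrak v(fg)=\mathfrak v(f)+\mathfrak v(g)$, $\mathfrak v(f+g)\ge\min\{\mathfrak v(f),\mathfrak v(g)\}$, $\mathfrak v(c)=0$ for $0\ne c\in\mathbf k$, $\mathfrak v(0)=\infty$. That it corresponds to a toric flat sheaf of algebras on $Y(\Sigma)$ means that it is homogeneous ($\mathfrak v(\sum f_m)=\min\mathfrak v(f_m)$ for $f_m$ in distinct graded pieces) and for each $\sigma\in\Sigma$ there is a vector space basis $\mathbb B_\sigma$ of $A$ with $\mathfrak v(\sum C_bb)|_\sigma=\min\{\mathfrak v(b)|_\sigma:C_b\ne0\}$ and each $\mathfrak v(b)|_\sigma$ the restriction of an element of $M$. $\mathcal B$ is a Khovanskii basis if for each $\rho\in|\Sigma|$ its classes generate the associated graded algebra of $\mathfrak v_\rho:f\mapsto\mathfrak v(f)(\rho)$. The diagram $D$ is the $n\times d$ matrix with entries $\mathfrak v(b_j)(\rho_i)$. Total section ring: for $\mathbf r\in\mathbb Z^n$ let $F_{\mathbf r}=\{f\in A:\mathfrak v(f)(\rho_i)\ge r_i,\ 1\le i\le n\}$ and $\mathcal R(A,\hat{\mathfrak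 v})=\bigoplus_{\mathbf r\in\mathbb Z^n}F_{\mathbf r}\,t^{\mathbf r}\subset A\otimes_{\mathbf k}\mathbf k[t_1^{\pm1},\dots,t_n^{\pm1}]$, an algebra over the Cox ring $\mathbf k[X_1,\dots,X_n]$ of $Y(\Sigma)$ via $X_i\mapsto t_i^{-1}$. $\mathcal B$ is a strong Khovanskii basis if it is the image, under $t_i\mapsto1$, of a ($\mathbb Z^n$-homogeneous) generating set of $\mathcal R(A,\hat{\mathfrak v})$ over $\mathbf k[X_1,\dots,X_n]$; equivalently, $\mathcal R(A,\hat{\mathfrak v})$ is generated as a $\mathbf k$-algebra by the $t_i^{-1}$ and the $b_j\prod_it_i^{\mathfrak v(b_j)(\rho_i)}$. Initial forms: $\operatorname{in}_w(f)$ is the sum of the terms of $f$ of minimal $w$-weight; $\operatorname{Trop}$ is the tropical variety with the $\min$ convention and trivial valuation on $\mathbf k$. *)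

theory Defs
  imports
    "HOL-Library.Extended"
    "HOL-Library.Poly_Mapping"
    "HOL-Computational_Algebra.Polynomial"
    "HOL-Algebra.QuotRing"
    "HOL-Algebra.Generated_Rings"
    "HOL-Algebra.Algebraic_Closure_Type"
begin

section \<open>Lattices and smooth fans\<close>

text \<open>
  The rational space \<open>N\<^sub>\<rat>\<close> is the whole type \<open>'v\<close>, with scalar multiplication \<open>scl\<close>; the lattice
  \<open>N\<close> is the integral span of a finite basis.  The basis may be empty, so rank 0 is included.
\<close>

definition lattice_basis ::
    "(rat \<Rightarrow> 'v::ab_group_add \<Rightarrow> 'v) \<Rightarrow> 'v set \<Rightarrow> 'v set \<Rightarrow> bool" where
  "lattice_basis scl N E \<longleftrightarrow>
     finite E \<and> \<not> Modules.module.dependent scl E \<and> Modules.module.span scl E = UNIV \<and>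
     N = {\<Sum>e\<in>E. scl (of_int (c e)) e | c :: 'v \<Rightarrow> int. True}"

locale rational_lattice = Vector_Spaces.vector_space scl
  for scl :: "rat \<Rightarrow> 'v::ab_group_add \<Rightarrow> 'v" +
  fixes N :: "'v set"
  assumes has_lattice_basis: "\<exists>E. lattice_basis scl N E"
begin

definition dual_lattice :: "('v \<Rightarrow> rat) set" where
  "dual_lattice = {m. Vector_Spaces.linear scl (*) m \<and> (\<forall>x\<in>N. m x \<in> \<int>)}"

definition cone_gen :: "'v set \<Rightarrow> 'v set" where
  "cone_gen G = {\<Sum>g\<in>G. scl (a g) g | a. \<forall>g\<in>G. 0 \<le> a g}"

definition rational_cone :: "'v set \<Rightarrow> bool" where
  "rational_cone \<sigma> \<longleftrightarrow>
     (\<exists>G. finite G \<and> G \<subseteq> N \<and> \<sigma> = cone_gen G) \<and> (\<forall>x\<in>\<sigma>. - x \<in> \<sigma> \<longrightarrow> x = 0)"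

definition cone_face :: "'v set \<Rightarrow> 'v set \<Rightarrow> bool" where
  "cone_face \<tau> \<sigma> \<longleftrightarrow>
     (\<exists>m. Vector_Spaces.linear scl (*) m \<and> (\<forall>x\<in>\<sigma>. 0 \<le> m x) \<and> \<tau> = {x\<in>\<sigma>. m x = 0})"

definition fan :: "'v set set \<Rightarrow> bool" where
  "fan \<Sigma> \<longleftrightarrow> finite \<Sigma> \<and> \<Sigma> \<noteq> {} \<and>
     (\<forall>\<sigma>\<in>\<Sigma>. rational_cone \<sigma>) \<and>
     (\<forall>\<sigma>\<in>\<Sigma>. \<forall>\<tau>. cone_face \<tau> \<sigma> \<longrightarrow> \<tau> \<in> \<Sigma>) \<and>
     (\<forall>\<sigma>\<in>\<Sigma>. \<forall>\<tau>\<in>\<Sigma>. cone_face (\<sigma> \<inter> \<tau>) \<sigma> \<and> cone_face (\<sigma> \<inter> \<tau>) \<tau>)"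

definition smooth_fan :: "'v set set \<Rightarrow> bool" where
  "smooth_fan \<Sigma> \<longleftrightarrow> fan \<Sigma> \<and>
     (\<forall>\<sigma>\<in>\<Sigma>. \<exists>E G. lattice_basis scl N E \<and> G \<subseteq> E \<and> \<sigma> = cone_gen G)"

definition ray_generators :: "'v set set \<Rightarrow> 'v set" where
  "ray_generators \<Sigma> =
     {u\<in>N. u \<noteq> 0 \<and> cone_gen {u} \<in> \<Sigma> \<and>
        (\<forall>x \<in> N \<inter> cone_gen {u}. \<exists>k::nat. x = scl (of_nat k) u)}"

text \<open>
  Integral piecewise linear functions on \<open>|\<Sigma>|\<close>: linear with slopes in \<open>M\<close> on the cones of some
  fan refining \<open>\<Sigma>\<close>.  The refinement depends on the function; functions linear on the cones of
  \<open>\<Sigma>\<close> itself would not be closed under minima.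
\<close>

definition integral_PL :: "'v set set \<Rightarrow> ('v \<Rightarrow> rat) \<Rightarrow> bool" where
  "integral_PL \<Sigma> \<phi> \<longleftrightarrow>
     (\<exists>\<Sigma>'. fan \<Sigma>' \<and> \<Union>\<Sigma>' = \<Union>\<Sigma> \<and> (\<forall>\<tau>\<in>\<Sigma>'. \<exists>\<sigma>\<in>\<Sigma>. \<tau> \<subseteq> \<sigma>) \<and>
        (\<forall>\<tau>\<in>\<Sigma>'. \<exists>m\<in>dual_lattice. \<forall>x\<in>\<tau>. \<phi> x = m x))"

text \<open>
  Only the values on \<open>|\<Sigma>|\<close> are meaningful, and all conditions below are restricted to \<open>|\<Sigma>|\<close>.
  The adjoined element is the function with constant value \<open>\<infinity>\<close>.
\<close>

definition PL_semifield :: "'v set set \<Rightarrow> ('v \<Rightarrow> rat extended) set" where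
  "PL_semifield \<Sigma> =
     {\<phi>. (\<forall>x\<in>\<Union>\<Sigma>. \<phi> x = \<infinity>) \<or> (\<exists>\<psi>. integral_PL \<Sigma> \<psi> \<and> (\<forall>x\<in>\<Union>\<Sigma>. \<phi> x = Fin (\<psi> x)))}"

end


section \<open>Graded algebras\<close>

definition subset_ring :: "'r::comm_ring_1 set \<Rightarrow> 'r ring" where
  "subset_ring S = ring_of_type_algebra\<lparr>carrier := S\<rparr>"

locale k_algebra = Vector_Spaces.vector_space scale
  for scale :: "'k::field \<Rightarrow> 'a::comm_ring_1 \<Rightarrow> 'a" +
  assumes scale_mult: "scale c (f * g) = scale c f * g"
begin

definition constants :: "'a set" where
  "constants = {scale c 1 | c. True}"

definition finitely_generated :: bool where
  "finitely_generated \<longleftrightarrow>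
     (\<exists>G. finite G \<and> generate_ring (subset_ring (UNIV :: 'a set)) (constants \<union> G) = UNIV)"

text \<open>Positively graded means graded by the natural numbers with degree 0 part equal to \<open>k\<close>.\<close>

definition positive_grading :: "(nat \<Rightarrow> 'a set) \<Rightarrow> bool" where
  "positive_grading A \<longleftrightarrow>
     (\<forall>m. subspace (A m)) \<and>
     (\<forall>f. \<exists>!g :: nat \<Rightarrow>\<^sub>0 'a. (\<forall>m. Poly_Mapping.lookup g m \<in> A m) \<and>
            f = (\<Sum>m\<in>Poly_Mapping.keys g. Poly_Mapping.lookup g m)) \<and>
     (\<forall>l m. \<forall>f\<in>A l. \<forall>g\<in>A m. f * g \<in> A (l + m)) \<and>
     A 0 = constants"

end


section \<open>Valuations\<close>

locale valued_algebra = lat: rational_lattice scl N + alg: k_algebra scale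
  for scl :: "rat \<Rightarrow> 'v::ab_group_add \<Rightarrow> 'v" and N
    and scale :: "'k::field \<Rightarrow> 'a::comm_ring_1 \<Rightarrow> 'a" +
  fixes \<Sigma> :: "'v set set" and v :: "'a \<Rightarrow> 'v \<Rightarrow> rat extended"
begin

definition PL_valuation :: bool where
  "PL_valuation \<longleftrightarrow>
     (\<forall>f. v f \<in> lat.PL_semifield \<Sigma>) \<and>
     (\<forall>x\<in>\<Union>\<Sigma>.
        (\<forall>f g. v (f * g) x = v f x + v g x) \<and>
        (\<forall>f g. min (v f x) (v g x) \<le> v (f + g) x) \<and>
        (\<forall>c. c \<noteq> 0 \<longrightarrow> v (scale c 1) x = 0) \<and>
        v 0 x = \<infinity>)"

definition homogeneous_valuation :: "(nat \<Rightarrow> 'a set) \<Rightarrow> bool" where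
  "homogeneous_valuation A \<longleftrightarrow>
     (\<forall>S f. finite S \<and> S \<noteq> {} \<and> (\<forall>m\<in>S. f m \<in> A m) \<longrightarrow>
        (\<forall>x\<in>\<Union>\<Sigma>. v (\<Sum>m\<in>S. f m) x = (MIN m\<in>S. v (f m) x)))"

definition adapted_basis :: "'v set \<Rightarrow> 'a set \<Rightarrow> bool" where
  "adapted_basis \<sigma> \<BB> \<longleftrightarrow>
     alg.independent \<BB> \<and> alg.span \<BB> = UNIV \<and>
     (\<forall>S C. finite S \<and> S \<noteq> {} \<and> S \<subseteq> \<BB> \<and> (\<forall>b\<in>S. C b \<noteq> 0) \<longrightarrow>
        (\<forall>x\<in>\<sigma>. v (\<Sum>b\<in>S. scale (C b) b) x = (MIN b\<in>S. v b x))) \<and>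
     (\<forall>b\<in>\<BB>. \<exists>m\<in>lat.dual_lattice. \<forall>x\<in>\<sigma>. v b x = Fin (m x))"

definition toric_flat :: "(nat \<Rightarrow> 'a set) \<Rightarrow> bool" where
  "toric_flat A \<longleftrightarrow>
     PL_valuation \<and> homogeneous_valuation A \<and> (\<forall>\<sigma>\<in>\<Sigma>. \<exists>\<BB>. adapted_basis \<sigma> \<BB>)"


subsection \<open>Associated graded algebras and Khovanskii bases\<close>

text \<open>
  For the filtration \<open>F\<^sub>q = {f. v f x \<ge> q}\<close>, \<open>F\<^sub>>\<^sub>q = {f. v f x > q}\<close> the associated graded algebra
  \<open>\<Oplus>\<^sub>q F\<^sub>q / F\<^sub>>\<^sub>q\<close> is formed as the quotient of \<open>\<Oplus>\<^sub>q F\<^sub>q s\<^sup>q\<close> by the ideal \<open>\<Oplus>\<^sub>q F\<^sub>>\<^sub>q s\<^sup>q\<close>,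
  inside the ring \<open>rat \<Rightarrow>\<^sub>0 'a\<close> of finite sums \<open>\<Sum>\<^sub>q f\<^sub>q s\<^sup>q\<close>.
\<close>

definition rees :: "'v \<Rightarrow> (rat \<Rightarrow>\<^sub>0 'a) ring" where
  "rees x = subset_ring {F. \<forall>q. Fin q \<le> v (Poly_Mapping.lookup F q) x}"

definition rees_ideal :: "'v \<Rightarrow> (rat \<Rightarrow>\<^sub>0 'a) set" where
  "rees_ideal x = {F. \<forall>q. Fin q < v (Poly_Mapping.lookup F q) x}"

definition assoc_graded :: "'v \<Rightarrow> (rat \<Rightarrow>\<^sub>0 'a) set ring" where
  "assoc_graded x = rees x Quot rees_ideal x"

definition graded_class :: "'v \<Rightarrow> rat \<Rightarrow> 'a \<Rightarrow> (rat \<Rightarrow>\<^sub>0 'a) set" where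
  "graded_class x q f = rees_ideal x +>\<^bsub>rees x\<^esub> Poly_Mapping.single q f"

definition khovanskii_basis :: "'a set \<Rightarrow> bool" where
  "khovanskii_basis B \<longleftrightarrow>
     (\<forall>x\<in>\<Union>\<Sigma>.
        generate_ring (assoc_graded x)
          (graded_class x 0 ` alg.constants \<union>
           {graded_class x q b | b q. b \<in> B \<and> v b x = Fin q})
        = carrier (assoc_graded x))"


subsection \<open>The total section ring and strong Khovanskii bases\<close>

text \<open>
  The ring \<open>A \<otimes> k[t\<^sub>1\<^sup>\<plusminus>\<^sup>1, ..., t\<^sub>n\<^sup>\<plusminus>\<^sup>1]\<close> is realised as the elements of \<open>(nat \<Rightarrow>\<^sub>0 int) \<Rightarrow>\<^sub>0 'a\<close> whose
  exponents are supported on \<open>{..<n}\<close>: \<open>single r f\<close> is \<open>f t\<^sup>r\<close>.  All indices start at 0.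
\<close>

definition total_section_ring ::
    "nat \<Rightarrow> (nat \<Rightarrow> 'v) \<Rightarrow> ((nat \<Rightarrow>\<^sub>0 int) \<Rightarrow>\<^sub>0 'a) set" where
  "total_section_ring n \<rho> =
     {F. \<forall>r\<in>Poly_Mapping.keys F. Poly_Mapping.keys r \<subseteq> {..<n} \<and>
        (\<forall>i<n. Fin (of_int (Poly_Mapping.lookup r i)) \<le> v (Poly_Mapping.lookup F r) (\<rho> i))}"

definition t_inv :: "nat \<Rightarrow> (nat \<Rightarrow>\<^sub>0 int) \<Rightarrow>\<^sub>0 'a" where
  "t_inv i = Poly_Mapping.single (Poly_Mapping.single i (-1)) 1"

definition set_t_to_1 :: "((nat \<Rightarrow>\<^sub>0 int) \<Rightarrow>\<^sub>0 'a) \<Rightarrow> 'a" where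
  "set_t_to_1 F = (\<Sum>r\<in>Poly_Mapping.keys F. Poly_Mapping.lookup F r)"

text \<open>Generation over \<open>k[X\<^sub>1, ..., X\<^sub>n]\<close> via \<open>X\<^sub>i \<mapsto> t\<^sub>i\<^sup>-\<^sup>1\<close>.\<close>

definition generates_over_cox ::
    "nat \<Rightarrow> (nat \<Rightarrow> 'v) \<Rightarrow> ((nat \<Rightarrow>\<^sub>0 int) \<Rightarrow>\<^sub>0 'a) set \<Rightarrow> bool" where
  "generates_over_cox n \<rho> G \<longleftrightarrow>
     generate_ring (subset_ring (total_section_ring n \<rho>))
       (Poly_Mapping.single 0 ` alg.constants \<union> t_inv ` {..<n} \<union> G)
     = total_section_ring n \<rho>"

definition strong_khovanskii_basis :: "nat \<Rightarrow> (nat \<Rightarrow> 'v) \<Rightarrow> 'a set \<Rightarrow> bool" where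
  "strong_khovanskii_basis n \<rho> B \<longleftrightarrow>
     (\<exists>G \<subseteq> total_section_ring n \<rho>.
        (\<forall>g\<in>G. \<exists>r f. g = Poly_Mapping.single r f) \<and>
        generates_over_cox n \<rho> G \<and> B = set_t_to_1 ` G)"

definition is_diagram ::
    "nat \<Rightarrow> (nat \<Rightarrow> 'v) \<Rightarrow> nat \<Rightarrow> (nat \<Rightarrow> 'a) \<Rightarrow> (nat \<Rightarrow> nat \<Rightarrow> int) \<Rightarrow> bool" where
  "is_diagram n \<rho> d b D \<longleftrightarrow> (\<forall>i<n. \<forall>j<d. v (b j) (\<rho> i) = Fin (of_int (D i j)))"

end


section \<open>Polynomials, initial ideals and tropical varieties\<close>

type_synonym ('x, 'k) mpoly = "('x \<Rightarrow>\<^sub>0 nat) \<Rightarrow>\<^sub>0 'k"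

definition mpoly_ring :: "'x set \<Rightarrow> ('x, 'k::comm_ring_1) mpoly ring" where
  "mpoly_ring V = subset_ring {p. \<forall>m\<in>Poly_Mapping.keys p. Poly_Mapping.keys m \<subseteq> V}"

definition weight :: "('x \<Rightarrow> rat) \<Rightarrow> ('x \<Rightarrow>\<^sub>0 nat) \<Rightarrow> rat" where
  "weight w m = (\<Sum>x\<in>Poly_Mapping.keys m. w x * of_nat (Poly_Mapping.lookup m x))"

definition initial_form :: "('x \<Rightarrow> rat) \<Rightarrow> ('x, 'k::comm_ring_1) mpoly \<Rightarrow> ('x, 'k) mpoly" where
  "initial_form w p =
     (\<Sum>m | m \<in> Poly_Mapping.keys p \<and> (\<forall>m'\<in>Poly_Mapping.keys p. weight w m \<le> weight w m').
        Poly_Mapping.single m (Poly_Mapping.lookup p m))"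

definition initial_ideal ::
    "'x set \<Rightarrow> ('x \<Rightarrow> rat) \<Rightarrow> ('x, 'k::comm_ring_1) mpoly set \<Rightarrow> ('x, 'k) mpoly set" where
  "initial_ideal V w I = Idl\<^bsub>mpoly_ring V\<^esub> (initial_form w ` I)"

text \<open>
  A weight is a function on the variables; its values outside \<open>V\<close> are irrelevant.  The initial form
  is taken with respect to minimal weight, and the coefficient field is trivially valued.
\<close>

definition Trop :: "'x set \<Rightarrow> ('x, 'k::comm_ring_1) mpoly set \<Rightarrow> ('x \<Rightarrow> rat) set" where
  "Trop V I = {w. \<forall>m. Poly_Mapping.single m 1 \<notin> initial_ideal V w I}"

text \<open>The variable \<open>X\<^sub>i\<close> is \<open>Inl i\<close> and \<open>Y\<^sub>j\<close> is \<open>Inr j\<close>.\<close>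

definition XY_vars :: "nat \<Rightarrow> nat \<Rightarrow> (nat + nat) set" where
  "XY_vars n d = {..<n} <+> {..<d}"

definition lifted_row :: "(nat \<Rightarrow> nat \<Rightarrow> int) \<Rightarrow> nat \<Rightarrow> nat + nat \<Rightarrow> rat" where
  "lifted_row D i = case_sum (\<lambda>k. 0) (\<lambda>j. of_int (D i j))"

context k_algebra
begin

definition XY_image ::
    "nat \<Rightarrow> (nat \<Rightarrow> 'a) \<Rightarrow> (nat \<Rightarrow> nat \<Rightarrow> int) \<Rightarrow> nat + nat \<Rightarrow> (nat \<Rightarrow>\<^sub>0 int) \<Rightarrow>\<^sub>0 'a" where
  "XY_image n b D =
     case_sum (\<lambda>i. Poly_Mapping.single (Poly_Mapping.single i (-1)) 1)
              (\<lambda>j. Poly_Mapping.single (\<Sum>i<n. Poly_Mapping.single i (D i j)) (b j))"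

definition XY_eval ::
    "nat \<Rightarrow> (nat \<Rightarrow> 'a) \<Rightarrow> (nat \<Rightarrow> nat \<Rightarrow> int) \<Rightarrow> (nat + nat, 'k) mpoly \<Rightarrow> (nat \<Rightarrow>\<^sub>0 int) \<Rightarrow>\<^sub>0 'a" where
  "XY_eval n b D p =
     (\<Sum>m\<in>Poly_Mapping.keys p.
        Poly_Mapping.single 0 (scale (Poly_Mapping.lookup p m) 1) *
        (\<Prod>x\<in>Poly_Mapping.keys m. XY_image n b D x ^ Poly_Mapping.lookup m x))"

definition relation_ideal ::
    "nat \<Rightarrow> nat \<Rightarrow> (nat \<Rightarrow> 'a) \<Rightarrow> (nat \<Rightarrow> nat \<Rightarrow> int) \<Rightarrow> (nat + nat, 'k) mpoly set" where
  "relation_ideal n d b D = {p \<in> carrier (mpoly_ring (XY_vars n d)). XY_eval n b D p = 0}"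

end

end

theory Submission
  imports Defs
begin

text \<open>
  Write \<open>v\<^sub>i(f) = v f (\<rho> i)\<close>, let \<open>b\<^sup>\<alpha>\<close> range over the monomials in the generators, and compare, for an integer vector \<open>r\<close>,
  the space \<open>F\<^sub>r = {f. v\<^sub>i(f) \<ge> r\<^sub>i for all i}\<close> with the span \<open>F'\<^sub>r\<close> of the monomials \<open>b\<^sup>\<alpha>\<close> that visibly lie in it,
  that is, with \<open>\<Sum>\<^sub>j D\<^sub>i\<^sub>j \<alpha>\<^sub>j \<ge> r\<^sub>i\<close> for all \<open>i\<close> (\<open>gen_sections\<close> below).  The sum of the \<open>F\<^sub>r t\<^sup>r\<close> is the total section ring
  \<open>R\<close>, the sum of the \<open>F'\<^sub>r t\<^sup>r\<close> is the subalgebra \<open>R'\<close> generated by the \<open>t\<^sub>i\<^bsup>-1\<^esup>\<close> and the \<open>b\<^sub>j t\<^bsup>v(b\<^sub>j)\<^esup>\<close>, and the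
  generators form a strong Khovanskii basis exactly if \<open>F' = F\<close> (\<open>strong_imp_saturated\<close>, \<open>saturated_imp_strong\<close>).

  The relation ideal is homogeneous for the \<open>t\<close>-degree, and on a homogeneous polynomial of \<open>t\<close>-degree \<open>r\<close> the lifted weight of
  a monomial is \<open>r\<^sub>i\<close> plus its exponent of \<open>X\<^sub>i\<close>.  Taking initial forms therefore keeps the terms with the lowest power of
  \<open>X\<^sub>i\<close>, and the initial ideal consists of the polynomials each of whose bihomogeneous pieces, evaluated in \<open>A\<close>, lies one
  step deeper in the \<open>i\<close>-th direction of \<open>F'\<close> than its degree forces (\<open>initial_ideal_eq\<close>).  A monomial cannot do so since
  \<open>v\<^sub>i\<close> is additive on products, so the lifted row is a tropical point.  The initial ideal is prime if and only if the
  ideal \<open>t\<^sub>i\<^bsup>-1\<^esup> R'\<close> is, a condition on the spaces \<open>F'\<^sub>r\<close> called \<open>prime_section\<close>.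

  If \<open>F' = F\<close>, that condition holds because \<open>v\<^sub>i\<close> is a valuation.  For the converse the one-dimensional case is decisive.
  Fix \<open>i\<close> and let \<open>F'\<^sub>q\<close> be spanned by the monomials of weight at least \<open>q\<close> and \<open>F\<^sub>q = {f. v\<^sub>i(f) \<ge> q}\<close>.  By the Khovanskii
  property the graded ring of \<open>F'\<close> maps onto the graded ring of \<open>F\<close>, and the former is a domain by hypothesis.  Both rings ought to
  have the dimension of \<open>A\<close>, which makes the map injective, and injectivity says \<open>F'\<^sub>q \<inter> F\<^sub>q\<^sub>+\<^sub>1 \<subseteq> F'\<^sub>q\<^sub>+\<^sub>1\<close>.  Dimension theory
  is replaced by counting.  A nonzero \<open>f\<close> in the kernel can be multiplied into a family that is independent in the graded ring
  of \<open>F\<close>: the powers of \<open>f\<close> times the members of the family remain independent in the domain (\<open>realizable_multiply\<close>), so the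
  length-\<open>C m\<close> part of the graded ring of \<open>F'\<close> has at least \<open>m\<close> times the dimension of the length-\<open>m\<close> part of the graded ring of
  \<open>F\<close>.  Conversely the graded ring of \<open>F\<close> is as large as that of \<open>F'\<close> up to a linear change of the length
  (\<open>realizable_transfer\<close>); here the positive grading and the homogeneity of the valuation enter, as they allow one to rewrite
  elements of bounded degree by monomials of bounded length.  Iterating the two comparisons gives growth faster than any
  polynomial, whereas there are at most \<open>(m + 1)\<^sup>d\<close> monomials of length \<open>m\<close> (\<open>weight_filtration_saturated\<close>).

  The several directions are combined by climbing: every \<open>f \<in> F\<^sub>r\<close> lies in some \<open>F'\<^sub>s\<close> with \<open>s \<le> r\<close> since the generators
  generate \<open>A\<close> (the Khovanskii property at the origin), and as long as \<open>s\<^sub>i < r\<^sub>i\<close> the one-dimensional result and the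
  primality of \<open>t\<^sub>i\<^bsup>-1\<^esup> R'\<close> allow one to increase \<open>s\<^sub>i\<close> by one (\<open>gen_sections_raise\<close>, \<open>saturation\<close>).
\<close>

abbreviation "lk \<equiv> Poly_Mapping.lookup"
abbreviation "supp \<equiv> Poly_Mapping.keys"
abbreviation "sgl \<equiv> Poly_Mapping.single"

section \<open>Families independent in an associated graded space\<close>

context k_algebra begin

lemma scale_mult_right: "scale c (f * g) = f * scale c g"
  using scale_mult[of c g f] by (simp add: mult.commute)

lemma scale_eq_mult: "scale c f = scale c 1 * f"
  using scale_mult[of c 1 f] by simp

lemma mult_mem_of_span:
  assumes f: "f \<in> span B" and g: "g \<in> span Y" and V: "subspace V"
    and BY: "\<And>x y. x \<in> B \<Longrightarrow> y \<in> Y \<Longrightarrow> x * y \<in> V"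
  shows "f * g \<in> V"
proof -
  have step: "x * g \<in> V" if x: "x \<in> B" for x
    using g
  proof (induction rule: span_induct_alt)
    case base then show ?case using subspace_0[OF V] by simp
  next
    case (step c y z)
    have "x * (scale c y + z) = scale c (x * y) + x * z"
      by (simp add: distrib_left scale_mult_right)
    then show ?case using step BY[OF x] subspace_add[OF V] subspace_scale[OF V] by metis
  qed
  show ?thesis
    using f
  proof (induction rule: span_induct_alt)
    case base then show ?case using subspace_0[OF V] by simp
  next
    case (step c y z)
    have "(scale c y + z) * g = scale c (y * g) + z * g"
      by (simp add: distrib_right scale_mult)
    then show ?case using step step subspace_add[OF V] subspace_scale[OF V] \<open>\<And>x. x \<in> B \<Longrightarrow> x * g \<in> V\<close> by metis
  qed
qed

lemma independent_family:
  assumes fin: "finite I"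
    and ind: "\<And>c. (\<Sum>i\<in>I. scale (c i) (a i)) = 0 \<Longrightarrow> \<forall>i\<in>I. c i = 0"
  shows "inj_on a I \<and> independent (a ` I)"
proof
  show inj: "inj_on a I"
  proof (rule inj_onI, rule ccontr)
    fix i j assume ij: "i \<in> I" "j \<in> I" "a i = a j" "i \<noteq> j"
    define c :: "_ \<Rightarrow> 'k" where "c = (\<lambda>k. if k = i then 1 else if k = j then - 1 else 0)"
    have "(\<Sum>k\<in>I. scale (c k) (a k)) = (\<Sum>k\<in>{i,j}. scale (c k) (a k))"
      by (rule sum.mono_neutral_right) (use fin ij in \<open>auto simp: c_def\<close>)
    also have "\<dots> = 0" using ij by (simp add: c_def)
    finally have "c i = 0" using ind ij by blast
    then show False by (simp add: c_def)
  qed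
  show "independent (a ` I)"
  proof (rule independent_if_scalars_zero)
    show "finite (a ` I)" using fin by simp
    fix f x assume s: "(\<Sum>x\<in>a ` I. scale (f x) x) = 0" and x: "x \<in> a ` I"
    have "(\<Sum>i\<in>I. scale (f (a i)) (a i)) = 0" using s by (simp add: sum.reindex[OF inj])
    then show "f x = 0" using ind[of "\<lambda>i. f (a i)"] x by auto
  qed
qed

text \<open>
  This is linear independence of the classes of the \<open>a i\<close>, placed in degree \<open>q i\<close>, in the graded space \<open>\<Oplus>\<^sub>p \<Phi>\<^sub>p / \<Phi>\<^sub>p\<^sub>+\<^sub>1\<close>.
  Speaking of representatives and weights avoids forming that space.
\<close>

definition graded_independent ::
    "(int \<Rightarrow> 'a set) \<Rightarrow> 'i set \<Rightarrow> ('i \<Rightarrow> 'a) \<Rightarrow> ('i \<Rightarrow> int) \<Rightarrow> bool" where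
  "graded_independent \<Phi> I a q \<longleftrightarrow> finite I \<and>
     (\<forall>p c. (\<Sum>i | i \<in> I \<and> q i = p. scale (c i) (a i)) \<in> \<Phi> (p + 1) \<longrightarrow>
        (\<forall>i\<in>I. q i = p \<longrightarrow> c i = 0))"

lemma graded_independentD:
  assumes "graded_independent \<Phi> I a q" "(\<Sum>i | i \<in> I \<and> q i = p. scale (c i) (a i)) \<in> \<Phi> (p + 1)"
    "i \<in> I" "q i = p"
  shows "c i = 0"
  using assms unfolding graded_independent_def by blast

lemma graded_independent_reindex:
  assumes "graded_independent \<Phi> I a q" "bij_betw h J I"
  shows "graded_independent \<Phi> J (a \<circ> h) (q \<circ> h)"
  unfolding graded_independent_def
proof (intro conjI allI impI ballI)
  show "finite J" using assms bij_betw_finite unfolding graded_independent_def by blast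
  fix p c j
  assume s: "(\<Sum>i | i \<in> J \<and> (q \<circ> h) i = p. scale (c i) ((a \<circ> h) i)) \<in> \<Phi> (p + 1)"
    and j: "j \<in> J" "(q \<circ> h) j = p"
  define g where "g = the_inv_into J h"
  have hg: "g (h i) = i" if "i \<in> J" for i
    using that assms(2) by (simp add: g_def the_inv_into_f_f bij_betw_def)
  have bij: "bij_betw h {i. i \<in> J \<and> (q \<circ> h) i = p} {i. i \<in> I \<and> q i = p}"
    using assms(2) unfolding bij_betw_def by (auto intro: inj_on_subset)
  have "(\<Sum>i | i \<in> J \<and> (q \<circ> h) i = p. scale (c i) ((a \<circ> h) i)) =
    (\<Sum>i | i \<in> J \<and> (q \<circ> h) i = p. scale (c (g (h i))) (a (h i)))"
    by (rule sum.cong) (auto simp: hg)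
  also have "\<dots> = (\<Sum>i | i \<in> I \<and> q i = p. scale (c (g i)) (a i))"
    by (rule sum.reindex_bij_betw[OF bij])
  finally have "c (g (h j)) = 0"
    using graded_independentD[OF assms(1), of "\<lambda>i. c (g i)" p "h j"] s j assms(2)
    by (auto simp: bij_betw_def)
  then show "c j = 0" using hg j by simp
qed

text \<open>
  In a vanishing linear combination the part of lowest weight lies one step deeper in the filtration, so its coefficients
  vanish.
\<close>

lemma graded_independent_imp_independent:
  assumes gi: "graded_independent \<Phi> I a q"
    and sub: "\<And>p. subspace (\<Phi> p)" and anti: "\<And>p. \<Phi> (p + 1) \<subseteq> \<Phi> p"
    and mem: "\<And>i. i \<in> I \<Longrightarrow> a i \<in> \<Phi> (q i)"
  shows "inj_on a I \<and> independent (a ` I)"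
proof (rule independent_family)
  show fin: "finite I" using gi by (simp add: graded_independent_def)
  have anti': "\<Phi> p' \<subseteq> \<Phi> p" if "p \<le> p'" for p p'
    using that by (induction p' rule: int_ge_induct) (use anti in auto)
  fix c assume s: "(\<Sum>i\<in>I. scale (c i) (a i)) = 0"
  show "\<forall>i\<in>I. c i = 0"
  proof (rule ccontr)
    assume "\<not> (\<forall>i\<in>I. c i = 0)"
    define J where "J = {i\<in>I. c i \<noteq> 0}"
    have J: "finite J" "J \<noteq> {}" using fin \<open>\<not> _\<close> by (auto simp: J_def)
    define p where "p = Min (q ` J)"
    have "p \<in> q ` J" using J by (simp add: p_def)
    then obtain j where j: "j \<in> J" "q j = p" by auto
    have min: "p \<le> q i" if "i \<in> J" for i using that J by (simp add: p_def)
    have "(\<Sum>i\<in>I. scale (c i) (a i)) = (\<Sum>i | i \<in> I \<and> q i = p. scale (c i) (a i)) +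
       (\<Sum>i | i \<in> I \<and> q i \<noteq> p. scale (c i) (a i))"
      by (subst sum.union_disjoint[symmetric]) (use fin in \<open>auto intro!: sum.cong\<close>)
    then have "(\<Sum>i | i \<in> I \<and> q i = p. scale (c i) (a i)) =
        - (\<Sum>i | i \<in> I \<and> q i \<noteq> p. scale (c i) (a i))"
      using s by (simp add: eq_neg_iff_add_eq_0)
    also have "\<dots> \<in> \<Phi> (p + 1)"
    proof (intro subspace_neg[OF sub] subspace_sum[OF sub])
      fix i assume i: "i \<in> {i \<in> I. q i \<noteq> p}"
      show "scale (c i) (a i) \<in> \<Phi> (p + 1)"
      proof (cases "c i = 0")
        case True then show ?thesis using subspace_0[OF sub] by simp
      next
        case False
        then have "p + 1 \<le> q i" using i min[of i] by (auto simp: J_def)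
        then show ?thesis using anti' mem i subspace_scale[OF sub] by blast
      qed
    qed
    finally have "c j = 0" using graded_independentD[OF gi] j by (auto simp: J_def)
    then show False using j by (simp add: J_def)
  qed
qed

end

section \<open>Weighted monomials in finitely many generators\<close>

locale generated_algebra = k_algebra scale
  for scale :: "'k::field \<Rightarrow> 'a::comm_ring_1 \<Rightarrow> 'a" +
  fixes d :: nat and b :: "nat \<Rightarrow> 'a"
begin

definition monomial :: "(nat \<Rightarrow> nat) \<Rightarrow> 'a" where
  "monomial \<alpha> = (\<Prod>j<d. b j ^ \<alpha> j)"

text \<open>
  Exponent vectors are total functions; two of them that agree below \<open>d\<close> describe the same monomial.
\<close>

definition wt :: "(nat \<Rightarrow> int) \<Rightarrow> (nat \<Rightarrow> nat) \<Rightarrow> int" where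
  "wt w \<alpha> = (\<Sum>j<d. w j * int (\<alpha> j))"

definition exponent_sum :: "(nat \<Rightarrow> nat) \<Rightarrow> nat" where
  "exponent_sum \<alpha> = (\<Sum>j<d. \<alpha> j)"

lemma monomial_add: "monomial (\<lambda>j. \<alpha> j + \<beta> j) = monomial \<alpha> * monomial \<beta>"
  by (simp add: monomial_def power_add prod.distrib)

lemma wt_add: "wt w (\<lambda>j. \<alpha> j + \<beta> j) = wt w \<alpha> + wt w \<beta>"
  by (simp add: wt_def algebra_simps sum.distrib)

lemma exponent_sum_add: "exponent_sum (\<lambda>j. \<alpha> j + \<beta> j) = exponent_sum \<alpha> + exponent_sum \<beta>"
  by (simp add: exponent_sum_def sum.distrib)

lemma monomial_zero: "monomial (\<lambda>_. 0) = 1" and wt_zero: "wt w (\<lambda>_. 0) = 0"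
  and exponent_sum_zero: "exponent_sum (\<lambda>_. 0) = 0"
  by (simp_all add: monomial_def wt_def exponent_sum_def)

lemma monomial_unit: "j < d \<Longrightarrow> monomial (\<lambda>i. if i = j then 1 else 0) = b j"
proof -
  assume "j < d"
  have "monomial (\<lambda>i. if i = j then 1 else 0) = (\<Prod>i<d. if i = j then b i else 1)"
    unfolding monomial_def by (rule prod.cong) auto
  then show ?thesis using \<open>j < d\<close> by simp
qed

lemma wt_unit: "j < d \<Longrightarrow> wt w (\<lambda>i. if i = j then 1 else 0) = w j"
proof -
  assume "j < d"
  have "wt w (\<lambda>i. if i = j then 1 else 0) = (\<Sum>i<d. if i = j then w i else 0)"
    unfolding wt_def by (rule sum.cong) auto
  then show ?thesis using \<open>j < d\<close> by simp
qed

lemma closed_under_monomials: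
  assumes one: "P (0::int) 1"
    and mult: "\<And>p q f g. P p f \<Longrightarrow> P q g \<Longrightarrow> P (p + q) (f * g)"
    and b: "\<And>j. j < d \<Longrightarrow> P (w j) (b j)"
  shows "P (wt w \<alpha>) (monomial \<alpha>)"
proof -
  have pow: "P (int k * p) (f ^ k)" if "P p f" for f k p
  proof (induction k)
    case 0 then show ?case using one by simp
  next
    case (Suc k)
    have "int (Suc k) * p = p + int k * p" by (simp add: algebra_simps)
    then show ?case using mult[OF that Suc] by simp
  qed
  have "P (\<Sum>j\<in>S. w j * int (\<alpha> j)) (\<Prod>j\<in>S. b j ^ \<alpha> j)" if "finite S" "S \<subseteq> {..<d}" for S
    using that
  proof (induction S rule: finite_induct)
    case empty then show ?case using one by simp
  next
    case (insert j S)
    then show ?case using pow[OF b, of j "\<alpha> j"] by (auto simp: mult.commute intro!: mult)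
  qed
  then show ?thesis by (simp add: monomial_def wt_def)
qed

lemma monomial_restrict: "monomial (restrict \<alpha> {..<d}) = monomial \<alpha>"
  and wt_restrict: "wt w (restrict \<alpha> {..<d}) = wt w \<alpha>"
  and exponent_sum_restrict: "exponent_sum (restrict \<alpha> {..<d}) = exponent_sum \<alpha>"
  by (simp_all add: monomial_def wt_def exponent_sum_def)

definition mspan :: "(nat \<Rightarrow> nat) set \<Rightarrow> 'a set" where
  "mspan M = span (monomial ` M)"

lemma subspace_mspan [simp]: "subspace (mspan M)" by (simp add: mspan_def)

lemma mspan_base: "\<alpha> \<in> M \<Longrightarrow> monomial \<alpha> \<in> mspan M"
  by (auto simp: mspan_def intro: span_base)

lemma mspan_mono: "M \<subseteq> M' \<Longrightarrow> mspan M \<subseteq> mspan M'"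
  unfolding mspan_def by (intro span_mono image_mono)

lemma mspan_minimal: "(\<And>\<alpha>. \<alpha> \<in> M \<Longrightarrow> monomial \<alpha> \<in> V) \<Longrightarrow> subspace V \<Longrightarrow> mspan M \<subseteq> V"
  unfolding mspan_def by (intro span_minimal) auto

lemma mspan_mult:
  assumes "f \<in> mspan M" "g \<in> mspan M'"
    and "\<And>\<alpha> \<beta>. \<alpha> \<in> M \<Longrightarrow> \<beta> \<in> M' \<Longrightarrow> (\<lambda>j. \<alpha> j + \<beta> j) \<in> M''"
  shows "f * g \<in> mspan M''"
  using assms(1,2) unfolding mspan_def
  by (rule mult_mem_of_span)
    (use assms(3) in \<open>auto simp: monomial_add[symmetric] intro!: span_base\<close>)

lemma mspan_Un: "mspan (M \<union> M') \<subseteq> {f + g | f g. f \<in> mspan M \<and> g \<in> mspan M'}"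
  unfolding mspan_def image_Un span_Un by auto

text \<open>
  The filtration generated by giving \<open>b j\<close> the weight \<open>w j\<close>.  A piece consists of combinations of monomials of one exact
  weight; the bound on the length makes it finite-dimensional and permits counting.
\<close>

definition weight_filtration :: "(nat \<Rightarrow> int) \<Rightarrow> int \<Rightarrow> 'a set" where
  "weight_filtration w q = mspan {\<alpha>. q \<le> wt w \<alpha>}"

definition weight_piece :: "(nat \<Rightarrow> int) \<Rightarrow> int \<Rightarrow> nat \<Rightarrow> 'a set" where
  "weight_piece w q m = mspan {\<alpha>. wt w \<alpha> = q \<and> exponent_sum \<alpha> \<le> m}"

text \<open>
  Restriction to \<open>{..<d}\<close> picks one exponent vector for each monomial, which makes the set finite.
\<close>

definition bounded_exponents :: "nat \<Rightarrow> (nat \<Rightarrow> nat) set" where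
  "bounded_exponents m = {\<alpha> \<in> PiE {..<d} (\<lambda>_. {..m}). exponent_sum \<alpha> \<le> m}"

lemma finite_bounded_exponents: "finite (bounded_exponents m)"
  and card_bounded_exponents: "card (bounded_exponents m) \<le> (m + 1) ^ d"
proof -
  have fin: "finite (PiE {..<d} (\<lambda>_. {..m}))" by (intro finite_PiE) auto
  then show "finite (bounded_exponents m)" by (simp add: bounded_exponents_def)
  have "card (bounded_exponents m) \<le> card (PiE {..<d} (\<lambda>_. {..m}))"
    by (intro card_mono fin) (auto simp: bounded_exponents_def)
  then show "card (bounded_exponents m) \<le> (m + 1) ^ d" by (simp add: card_PiE)
qed

lemma restrict_bounded: "exponent_sum \<alpha> \<le> m \<Longrightarrow> restrict \<alpha> {..<d} \<in> bounded_exponents m"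
proof -
  assume t: "exponent_sum \<alpha> \<le> m"
  have "\<alpha> j \<le> m" if "j < d" for j
    using t member_le_sum[of j "{..<d}" \<alpha>] that by (simp add: exponent_sum_def)
  then show ?thesis using t by (auto simp: bounded_exponents_def exponent_sum_restrict)
qed

lemma weight_piece_subset_span:
  "weight_piece w q m \<subseteq> span (monomial ` bounded_exponents m)"
  unfolding weight_piece_def
proof (rule mspan_minimal)
  fix \<alpha> assume "\<alpha> \<in> {\<alpha>. wt w \<alpha> = q \<and> exponent_sum \<alpha> \<le> m}"
  then show "monomial \<alpha> \<in> span (monomial ` bounded_exponents m)"
    using restrict_bounded[of \<alpha> m] by (metis (lifting) imageI mem_Collect_eq monomial_restrict span_base)
qed simp

text \<open>
  A linear combination involves only finitely many monomials, so their lengths are bounded.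
\<close>

lemma weight_piece_exhaust:
  assumes "f \<in> mspan {\<alpha>. wt w \<alpha> = q}"
  shows "\<exists>m. f \<in> weight_piece w q m"
proof -
  have mono: "weight_piece w q m \<subseteq> weight_piece w q m'" if "m \<le> m'" for m m'
    unfolding weight_piece_def by (rule mspan_mono) (use that in auto)
  show ?thesis
    using assms unfolding mspan_def
  proof (induction rule: span_induct_alt)
    case base then show ?case using subspace_0[OF subspace_mspan] unfolding weight_piece_def by blast
  next
    case (step c x y)
    then obtain \<alpha> m where \<alpha>: "x = monomial \<alpha>" "wt w \<alpha> = q" and m: "y \<in> weight_piece w q m" by auto
    have "x \<in> weight_piece w q (max m (exponent_sum \<alpha>))"
      unfolding \<alpha>(1) weight_piece_def by (rule mspan_base) (use \<alpha> in auto)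
    moreover have "y \<in> weight_piece w q (max m (exponent_sum \<alpha>))" using m mono by (meson max.cobounded1 subsetD)
    ultimately show ?case
      unfolding weight_piece_def by (meson subspace_add subspace_mspan subspace_scale)
  qed
qed

lemma weight_filtration_antimono: "p \<le> q \<Longrightarrow> weight_filtration w q \<subseteq> weight_filtration w p"
  unfolding weight_filtration_def by (rule mspan_mono) auto

lemma weight_piece_mono: "m \<le> m' \<Longrightarrow> weight_piece w q m \<subseteq> weight_piece w q m'"
  unfolding weight_piece_def by (rule mspan_mono) auto

lemma weight_piece_subset: "weight_piece w q m \<subseteq> weight_filtration w q"
  unfolding weight_filtration_def weight_piece_def by (rule mspan_mono) auto

lemma subspace_weight_piece [simp]: "subspace (weight_piece w q m)"
  and subspace_weight_filtration [simp]: "subspace (weight_filtration w q)"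
  by (simp_all add: weight_piece_def weight_filtration_def)

lemma weight_piece_mult:
  "f \<in> weight_piece w p m \<Longrightarrow> g \<in> weight_piece w q m' \<Longrightarrow> f * g \<in> weight_piece w (p + q) (m + m')"
  unfolding weight_piece_def by (rule mspan_mult) (auto simp: wt_add exponent_sum_add)

lemma weight_filtration_mult:
  "f \<in> weight_filtration w p \<Longrightarrow> g \<in> weight_filtration w q \<Longrightarrow> f * g \<in> weight_filtration w (p + q)"
  unfolding weight_filtration_def by (rule mspan_mult) (auto simp: wt_add)

lemma one_weight_piece: "1 \<in> weight_piece w 0 m"
  unfolding weight_piece_def by (metis (mono_tags, lifting) le0 mem_Collect_eq monomial_zero mspan_base exponent_sum_zero wt_zero)

end

section \<open>Homogeneous components\<close>

locale graded_algebra = k_algebra scale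
  for scale :: "'k::field \<Rightarrow> 'a::comm_ring_1 \<Rightarrow> 'a" +
  fixes A :: "nat \<Rightarrow> 'a set"
  assumes grading: "positive_grading A"
begin

lemma subspace_A [simp]: "subspace (A m)" using grading by (simp add: positive_grading_def)

definition decomp :: "'a \<Rightarrow> nat \<Rightarrow>\<^sub>0 'a" where
  "decomp f = (THE g. (\<forall>m. lk g m \<in> A m) \<and>
     f = (\<Sum>m\<in>supp g. lk g m))"

definition component :: "nat \<Rightarrow> 'a \<Rightarrow> 'a" where
  "component m f = lk (decomp f) m"

lemma decomp_props:
  "(\<forall>m. lk (decomp f) m \<in> A m) \<and>
     f = (\<Sum>m\<in>supp (decomp f). lk (decomp f) m)"
  unfolding decomp_def by (rule theI') (use grading in \<open>auto simp: positive_grading_def\<close>)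

lemma decomp_eqI:
  assumes "\<And>m. lk g m \<in> A m" "finite S" "supp g \<subseteq> S"
    "f = (\<Sum>m\<in>S. lk g m)"
  shows "decomp f = g"
proof -
  have f: "f = (\<Sum>m\<in>supp g. lk g m)"
    unfolding assms(4) by (rule sum.mono_neutral_right) (use assms in \<open>auto simp: in_keys_iff\<close>)
  have "\<exists>!g. (\<forall>m. lk g m \<in> A m) \<and>
     f = (\<Sum>m\<in>supp g. lk g m)"
    using grading unfolding positive_grading_def by blast
  then show ?thesis using f assms(1) decomp_props[of f] by blast
qed

lemma component_in [simp]: "component m f \<in> A m"
  using decomp_props[of f] by (simp add: component_def)

lemma component_eq_0: "m \<notin> supp (decomp f) \<Longrightarrow> component m f = 0"
  by (simp add: component_def in_keys_iff)

lemma sum_component: "finite S \<Longrightarrow> supp (decomp f) \<subseteq> S \<Longrightarrow> (\<Sum>m\<in>S. component m f) = f"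
proof -
  assume S: "finite S" "supp (decomp f) \<subseteq> S"
  have "(\<Sum>m\<in>S. component m f) = (\<Sum>m\<in>supp (decomp f). component m f)"
    by (rule sum.mono_neutral_right) (use S in \<open>auto simp: component_eq_0\<close>)
  then show ?thesis using decomp_props[of f] by (simp add: component_def)
qed

lemma component_add: "component m (f + g) = component m f + component m g"
proof -
  let ?S = "supp (decomp f) \<union> supp (decomp g)"
  have "decomp (f + g) = decomp f + decomp g"
  proof (rule decomp_eqI[of _ ?S])
    show "f + g = (\<Sum>m\<in>?S. lk (decomp f + decomp g) m)"
      using sum_component[of ?S f] sum_component[of ?S g] by (simp add: lookup_add sum.distrib component_def)
  qed (use component_in[unfolded component_def] in \<open>auto simp: lookup_add intro!: subspace_add Poly_Mapping.keys_add\<close>)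
  then show ?thesis by (simp add: component_def lookup_add)
qed

lemma component_zero [simp]: "component m 0 = 0"
  using component_add[of m 0 0] by simp

lemma component_sum: "component m (\<Sum>i\<in>I. f i) = (\<Sum>i\<in>I. component m (f i))"
  by (induction I rule: infinite_finite_induct) (auto simp: component_add)

lemma component_scale: "component m (scale c f) = scale c (component m f)"
proof -
  define g where "g = Poly_Mapping.map (scale c) (decomp f)"
  have g: "lk g m = scale c (component m f)" for m
    by (simp add: g_def component_def Poly_Mapping.map.rep_eq when_def)
  have "decomp (scale c f) = g"
  proof (rule decomp_eqI[of _ "supp (decomp f)"])
    show "scale c f = (\<Sum>m\<in>supp (decomp f). lk g m)"
      using sum_component[of "supp (decomp f)" f] by (simp add: g scale_sum_right[symmetric])
  qed (auto simp: g in_keys_iff intro: subspace_scale, simp add: component_def)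
  then show ?thesis using g by (simp add: component_def)
qed

lemma component_of_homogeneous: "f \<in> A m \<Longrightarrow> component l f = (if l = m then f else 0)"
proof -
  assume "f \<in> A m"
  have "decomp f = sgl m f"
    by (rule decomp_eqI[of _ "{m}"]) (use \<open>f \<in> A m\<close> in \<open>auto simp: lookup_single when_def subspace_0\<close>)
  then show ?thesis by (simp add: component_def lookup_single when_def)
qed

lemma component_mult:
  "component m (f * g) = (\<Sum>i\<in>supp (decomp f). \<Sum>j\<in>supp (decomp g).
     if m = i + j then component i f * component j g else 0)"
proof -
  have "f * g = (\<Sum>i\<in>supp (decomp f). \<Sum>j\<in>supp (decomp g).
     component i f * component j g)"
    using sum_component[of "supp (decomp f)" f] sum_component[of "supp (decomp g)" g]
    by (simp add: sum_product[symmetric])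
  moreover have "component m (component i f * component j g) = (if m = i + j then component i f * component j g else 0)" for i j
    by (rule component_of_homogeneous) (use grading component_in in \<open>auto simp: positive_grading_def\<close>)
  ultimately show ?thesis by (simp add: component_sum)
qed

text \<open>
  A family of subspaces compatible with products is detected component by component; this is how statements about all
  elements are reduced to statements about the generators.
\<close>

lemma component_mult_mem:
  assumes "\<And>i. component i f \<in> U i" "\<And>j. component j g \<in> V j"
    and "\<And>i j x y. x \<in> U i \<Longrightarrow> y \<in> V j \<Longrightarrow> x * y \<in> W (i + j)" "\<And>m. subspace (W m)"
  shows "component m (f * g) \<in> W m"
  unfolding component_mult
  by (intro subspace_sum assms(4)) (use assms subspace_0[OF assms(4)] in auto)

lemma A_0: "A 0 = constants" using grading by (simp add: positive_grading_def)

lemma component_one: "component m 1 = (if m = 0 then 1 else 0)"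
proof -
  have "1 \<in> A 0" unfolding A_0 constants_def using scale_one[of 1] by (metis (mono_tags, lifting) mem_Collect_eq)
  then show ?thesis using component_of_homogeneous[of 1 0 m] by simp
qed

definition upto_degree :: "nat \<Rightarrow> 'a set" where
  "upto_degree M = {f. \<forall>m>M. component m f = 0}"

lemma subspace_upto_degree [simp]: "subspace (upto_degree M)"
  unfolding subspace_def upto_degree_def by (auto simp: component_add component_scale)

lemma upto_degree_mono: "M \<le> M' \<Longrightarrow> upto_degree M \<subseteq> upto_degree M'"
  by (auto simp: upto_degree_def)

lemma upto_degree_mult:
  "f \<in> upto_degree M \<Longrightarrow> g \<in> upto_degree M' \<Longrightarrow> f * g \<in> upto_degree (M + M')"
proof -
  assume fg: "f \<in> upto_degree M" "g \<in> upto_degree M'"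
  have "component m (f * g) = 0" if "m > M + M'" for m
    unfolding component_mult
  proof (intro sum.neutral ballI)
    fix i j
    show "(if m = i + j then component i f * component j g else 0) = 0"
    proof (cases "i > M \<or> j > M'")
      case True then show ?thesis using fg by (auto simp: upto_degree_def)
    next
      case False then show ?thesis using that by simp
    qed
  qed
  then show ?thesis by (simp add: upto_degree_def)
qed

lemma one_upto_degree: "1 \<in> upto_degree M"
  by (simp add: upto_degree_def component_one)

lemma sum_component_upto: "f \<in> upto_degree M \<Longrightarrow> (\<Sum>m\<le>M. component m f) = f"
  by (rule sum_component) (auto simp: upto_degree_def in_keys_iff component_def[symmetric] not_le[symmetric])

definition truncate :: "nat \<Rightarrow> 'a \<Rightarrow> 'a" where
  "truncate M f = (\<Sum>m\<le>M. component m f)"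

lemma truncate_add: "truncate M (f + g) = truncate M f + truncate M g"
  and truncate_scale: "truncate M (scale c f) = scale c (truncate M f)"
  by (simp_all add: truncate_def component_add component_scale sum.distrib scale_sum_right)

lemma truncate_id: "f \<in> upto_degree M \<Longrightarrow> truncate M f = f"
  by (simp add: truncate_def sum_component_upto)

lemma truncate_in: "truncate M f \<in> upto_degree M"
  by (auto simp: truncate_def upto_degree_def component_sum component_of_homogeneous[OF component_in])

lemma upto_degree_exhaust: "\<exists>M. f \<in> upto_degree M"
proof -
  obtain M where "\<And>m. m \<in> supp (decomp f) \<Longrightarrow> m \<le> M"
    using finite_nat_set_iff_bounded_le[of "supp (decomp f)"] by auto
  then show ?thesis
    by (intro exI[of _ M]) (force simp: upto_degree_def component_def in_keys_iff)
qed

end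

section \<open>Filtered graded algebras whose generators span the associated graded ring\<close>

text \<open>
  One valuation of the theorem, reduced to its filtration \<open>F q = {f. f has value at least q}\<close>.  The assumption
  \<open>khovanskii\<close> says that the classes of the generators generate the graded ring of \<open>F\<close>.
\<close>

locale filtered_generators =
  graded_algebra scale A + generated_algebra scale d b
  for scale :: "'k::field \<Rightarrow> 'a::comm_ring_1 \<Rightarrow> 'a" and A d b +
  fixes w :: "nat \<Rightarrow> int" and F :: "int \<Rightarrow> 'a set"
  assumes subspace_F [simp]: "subspace (F q)"
    and F_Suc: "F (q + 1) \<subseteq> F q"
    and F_mult: "f \<in> F p \<Longrightarrow> g \<in> F q \<Longrightarrow> f * g \<in> F (p + q)"
    and F_separated: "f \<noteq> 0 \<Longrightarrow> \<exists>q. f \<notin> F q"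
    and F_homogeneous: "f \<in> F q \<Longrightarrow> component m f \<in> F q"
    and one_F: "1 \<in> F 0" and one_not_F: "1 \<notin> F 1"
    and b_F: "j < d \<Longrightarrow> b j \<in> F (w j)"
    and khovanskii: "f \<in> F q \<Longrightarrow> \<exists>g \<in> mspan {\<alpha>. wt w \<alpha> = q}. f - g \<in> F (q + 1)"
    and generates: "mspan UNIV = UNIV"
begin

lemma F_antimono: "p \<le> q \<Longrightarrow> F q \<subseteq> F p"
  by (induction q rule: int_ge_induct) (use F_Suc in auto)

lemma monomial_F: "monomial \<alpha> \<in> F (wt w \<alpha>)"
  by (rule closed_under_monomials[where P = "\<lambda>q f. f \<in> F q"]) (use one_F F_mult b_F in auto)

lemma weight_filtration_F: "weight_filtration w q \<subseteq> F q"
  unfolding weight_filtration_def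
  by (rule mspan_minimal) (use F_antimono monomial_F in auto)

lemma weight_piece_F: "weight_piece w q m \<subseteq> F q"
  using weight_piece_subset weight_filtration_F by blast

lemma weight_filtration_exhaust: "\<exists>p\<le>q. f \<in> weight_filtration w p"
proof -
  have "f \<in> span (range monomial)" using generates unfolding mspan_def by auto
  then show ?thesis
  proof (induction rule: span_induct_alt)
    case base then show ?case using subspace_0[OF subspace_weight_filtration] by blast
  next
    case (step c x y)
    then obtain \<alpha> p where \<alpha>: "x = monomial \<alpha>" and p: "p \<le> q" "y \<in> weight_filtration w p" by auto
    have "x \<in> weight_filtration w (min p (wt w \<alpha>))"
      unfolding \<alpha> weight_filtration_def by (rule mspan_base) auto
    moreover have "y \<in> weight_filtration w (min p (wt w \<alpha>))"
      using p weight_filtration_antimono by (meson min.cobounded1 subsetD)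
    ultimately have "scale c x + y \<in> weight_filtration w (min p (wt w \<alpha>))"
      by (meson subspace_add subspace_scale subspace_weight_filtration)
    then show ?case using p by (intro exI[of _ "min p (wt w \<alpha>)"]) auto
  qed
qed

lemma generator_degree_bound: "\<exists>e\<ge>1. \<forall>j<d. b j \<in> upto_degree e"
proof -
  have "\<forall>j. \<exists>M. b j \<in> upto_degree M" using upto_degree_exhaust by blast
  then obtain M where M: "b j \<in> upto_degree (M j)" for j by metis
  have "M j \<le> (\<Sum>j<d. M j) + 1" if "j < d" for j
    using that member_le_sum[of j "{..<d}" M] by simp
  then have "b j \<in> upto_degree ((\<Sum>j<d. M j) + 1)" if "j < d" for j
    using M[of j] upto_degree_mono that by (meson subsetD)
  then show ?thesis by (intro exI[of _ "(\<Sum>j<d. M j) + 1"]) simp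
qed

definition generator_degree :: nat where
  "generator_degree = (SOME e. e \<ge> 1 \<and> (\<forall>j<d. b j \<in> upto_degree e))"

lemma generator_degree: "generator_degree \<ge> 1" "j < d \<Longrightarrow> b j \<in> upto_degree generator_degree"
  using someI_ex[OF generator_degree_bound[unfolded Bex_def]] unfolding generator_degree_def by blast+

lemma monomial_upto_degree: "monomial \<alpha> \<in> upto_degree (generator_degree * exponent_sum \<alpha>)"
proof -
  have pow: "f ^ k \<in> upto_degree (M * k)" if "f \<in> upto_degree M" for f M k
    by (induction k) (use that one_upto_degree in \<open>auto dest: upto_degree_mult[OF that]\<close>)
  have "(\<Prod>j\<in>S. b j ^ \<alpha> j) \<in> upto_degree (generator_degree * (\<Sum>j\<in>S. \<alpha> j))" if "finite S" "S \<subseteq> {..<d}" for S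
    using that
  proof (induction S rule: finite_induct)
    case empty then show ?case using one_upto_degree by simp
  next
    case (insert j S)
    then show ?case using pow[OF generator_degree(2), of j "\<alpha> j"]
      by (auto simp: distrib_left intro!: upto_degree_mult)
  qed
  then show ?thesis by (simp add: monomial_def exponent_sum_def)
qed

lemma weight_piece_upto_degree: "weight_piece w q m \<subseteq> upto_degree (generator_degree * m)"
  unfolding weight_piece_def
proof (rule mspan_minimal)
  fix \<alpha> assume "\<alpha> \<in> {\<alpha>. wt w \<alpha> = q \<and> exponent_sum \<alpha> \<le> m}"
  then have "generator_degree * exponent_sum \<alpha> \<le> generator_degree * m" by simp
  then show "monomial \<alpha> \<in> upto_degree (generator_degree * m)"
    using monomial_upto_degree upto_degree_mono by blast
qed simp

text \<open>
  The components of positive degree of the generators generate the algebra, and a product of more than \<open>M\<close> of them has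
  degree greater than \<open>M\<close>.  Components of degree 0 are scalars and do not count towards the length.
\<close>

lemma upto_degree_finite_span: "\<exists>T. finite T \<and> upto_degree M \<subseteq> span T"
proof -
  define B where "B = (\<lambda>(e, j). component e (b j)) ` ({..generator_degree} \<times> {..<d})"
  define U where "U m = span {prod_list xs | xs. set xs \<subseteq> B \<and> length xs \<le> m}" for m
  have finB: "finite B" by (simp add: B_def)
  have U_mult: "f * g \<in> U (i + j)" if "f \<in> U i" "g \<in> U j" for f g i j
    using that unfolding U_def
  proof (rule mult_mem_of_span)
    fix x y assume "x \<in> {prod_list xs | xs. set xs \<subseteq> B \<and> length xs \<le> i}"
      "y \<in> {prod_list xs | xs. set xs \<subseteq> B \<and> length xs \<le> j}"
    then obtain xs ys where "x = prod_list xs" "y = prod_list ys" "set xs \<subseteq> B" "length xs \<le> i"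
      "set ys \<subseteq> B" "length ys \<le> j" by auto
    then have "x * y = prod_list (xs @ ys)" "set (xs @ ys) \<subseteq> B" "length (xs @ ys) \<le> i + j" by auto
    then show "x * y \<in> span {prod_list xs | xs. set xs \<subseteq> B \<and> length xs \<le> i + j}"
      by (intro span_base) blast
  qed simp
  have one_U: "1 \<in> U m" for m
    unfolding U_def by (rule span_base, rule CollectI, rule exI[of _ "[]"]) simp
  have subU: "subspace (U m)" for m by (simp add: U_def)
  define P where "P = (\<lambda>(q::int) f. \<forall>m. component m f \<in> U m)"
  have "P (wt w \<alpha>) (monomial \<alpha>)" for \<alpha>
  proof (rule closed_under_monomials)
    show "P 0 1" using one_U subspace_0[OF subU] by (auto simp: P_def component_one)
    show "P (p + q) (f * g)" if "P p f" "P q g" for p q f g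
      unfolding P_def
    proof
      fix m
      show "component m (f * g) \<in> U m"
        by (rule component_mult_mem[of f U g U U]) (use that U_mult subU in \<open>auto simp: P_def\<close>)
    qed
    fix j assume j: "j < d"
    show "P (w j) (b j)" unfolding P_def
    proof
      fix m
      consider "m = 0" | "m > generator_degree" | "1 \<le> m" "m \<le> generator_degree" by linarith
      then show "component m (b j) \<in> U m"
      proof cases
        case 1
        then have "component m (b j) \<in> constants" using component_in[of 0 "b j"] A_0 by simp
        then show ?thesis using one_U subspace_scale[OF subU] by (auto simp: constants_def)
      next
        case 2
        then have "component m (b j) = 0" using generator_degree(2)[OF j] by (simp add: upto_degree_def)
        then show ?thesis using subspace_0[OF subU] by simp
      next
        case 3
        then have "component m (b j) \<in> B" using j by (auto simp: B_def intro!: image_eqI[of _ _ "(m, j)"])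
        then show ?thesis unfolding U_def using 3
          by (intro span_base CollectI exI[of _ "[component m (b j)]"]) simp
      qed
    qed
  qed
  moreover have "subspace {f. P 0 f}"
    unfolding P_def subspace_def using subU
    by (auto simp: component_add component_scale intro: subspace_0 subspace_add subspace_scale)
  ultimately have "mspan UNIV \<subseteq> {f. P 0 f}" by (intro mspan_minimal) (auto simp: P_def)
  then have component_U: "component m f \<in> U m" for m f using generates by (auto simp: P_def)
  define T where "T = {prod_list xs | xs. set xs \<subseteq> B \<and> length xs \<le> M}"
  have "finite T" unfolding T_def
    using finite_imageI[OF finite_lists_length_le[OF finB, of M], of prod_list]
    by (simp add: setcompr_eq_image)
  moreover have "upto_degree M \<subseteq> span T"
  proof
    fix f assume "f \<in> upto_degree M"
    then have "f = (\<Sum>m\<le>M. component m f)" by (simp add: sum_component_upto)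
    also have "\<dots> \<in> span T"
    proof (rule span_sum)
      fix m assume "m \<in> {..M}"
      then have "U m \<subseteq> span T" unfolding U_def T_def by (intro span_mono) auto
      then show "component m f \<in> span T" using component_U by blast
    qed
    finally show "f \<in> span T" .
  qed
  ultimately show ?thesis by blast
qed

text \<open>
  Elements of pairwise different values are independent, so only finitely many values occur on a finite-dimensional space,
  and beyond the largest of them only 0 is left.  This is what makes subduction terminate.
\<close>

lemma F_vanishes:
  assumes "finite T" "subspace V" "V \<subseteq> span T"
  shows "\<exists>q. V \<inter> F q \<subseteq> {0}"
proof (rule ccontr)
  assume neg: "\<nexists>q. V \<inter> F q \<subseteq> {0}"
  \<comment> \<open>The values that occur on \<open>V\<close>.\<close>
  define P where "P = {p. \<exists>f\<in>V. f \<in> F p \<and> f \<notin> F (p + 1)}"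
  have unbounded: "\<exists>p\<in>P. q \<le> p" for q
  proof -
    obtain f where f: "f \<in> V" "f \<in> F q" "f \<noteq> 0" using neg by blast
    then obtain r where r: "f \<notin> F r" using F_separated by blast
    have "q \<le> r" using f(2) r F_antimono[of r q] by (cases "q \<le> r") auto
    have "\<exists>p\<in>{q..<r}. f \<in> F p \<and> f \<notin> F (p + 1)"
    proof (rule ccontr)
      assume no: "\<not> (\<exists>p\<in>{q..<r}. f \<in> F p \<and> f \<notin> F (p + 1))"
      have "p \<le> r \<longrightarrow> f \<in> F p" if "q \<le> p" for p
        using that
      proof (induction p rule: int_ge_induct)
        case base then show ?case using f(2) by simp
      next
        case (step i) then show ?case using no by auto
      qed
      then show False using r \<open>q \<le> r\<close> by simp
    qed
    then obtain p where "p \<ge> q" "f \<in> F p" "f \<notin> F (p + 1)" by auto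
    then show ?thesis using f(1) unfolding P_def by blast
  qed
  have "infinite P"
  proof
    assume "finite P"
    moreover have "P \<noteq> {}" using unbounded by blast
    ultimately show False using unbounded[of "Max P + 1"] Max_ge by force
  qed
  then obtain I where I: "finite I" "card I = card T + 1" "I \<subseteq> P"
    using infinite_arbitrarily_large by metis
  have "\<forall>p\<in>I. \<exists>f. f \<in> V \<and> f \<in> F p \<and> f \<notin> F (p + 1)" using I by (auto simp: P_def)
  then obtain a where a: "\<And>p. p \<in> I \<Longrightarrow> a p \<in> V \<and> a p \<in> F p \<and> a p \<notin> F (p + 1)" by metis
  have "graded_independent F I a (\<lambda>p. p)"
    unfolding graded_independent_def
  proof (intro conjI I allI impI ballI)
    fix p c i assume s: "(\<Sum>i | i \<in> I \<and> i = p. scale (c i) (a i)) \<in> F (p + 1)" and i: "i \<in> I" "i = p"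
    have "{i. i \<in> I \<and> i = p} = {i}" using i by auto
    then have "scale (c i) (a i) \<in> F (i + 1)" using s i by simp
    then have "c i \<noteq> 0 \<Longrightarrow> scale (inverse (c i)) (scale (c i) (a i)) \<in> F (i + 1)"
      using subspace_scale[OF subspace_F] by blast
    then show "c i = 0" using a[OF i(1)] by (cases "c i = 0") auto
  qed
  then have "inj_on a I \<and> independent (a ` I)"
    by (rule graded_independent_imp_independent) (use F_Suc a in auto)
  then have "card (a ` I) = card T + 1" "card (a ` I) \<le> card T"
    using I independent_span_bound[OF assms(1), of "a ` I"] a assms(3) by (auto simp: card_image)
  then show False by simp
qed

text \<open>
  Elements whose leading part of weight \<open>q\<close> is a combination of monomials of length at most \<open>c m\<close>.  The bound is linear in
  \<open>m\<close>, which will be the degree, so that it is compatible with products.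
\<close>

definition controlled :: "nat \<Rightarrow> nat \<Rightarrow> int \<Rightarrow> 'a set" where
  "controlled c m q = {p + h | p h. p \<in> weight_piece w q (c * m) \<and> h \<in> F (q + 1)}"

lemma subspace_controlled: "subspace (controlled c m q)"
  unfolding controlled_def by (rule subspace_sums) simp_all

lemma F_Suc_controlled: "F (q + 1) \<subseteq> controlled c m q"
  unfolding controlled_def using subspace_0[OF subspace_weight_piece] by force

lemma weight_piece_controlled: "f \<in> weight_piece w q (c * m) \<Longrightarrow> f \<in> controlled c m q"
  unfolding controlled_def using subspace_0[OF subspace_F] by force

lemma controlled_mult:
  assumes "f \<in> controlled c m p" "g \<in> controlled c m' q"
  shows "f * g \<in> controlled c (m + m') (p + q)"
proof -
  obtain f1 f2 where f: "f = f1 + f2" "f1 \<in> weight_piece w p (c * m)" "f2 \<in> F (p + 1)"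
    using assms(1) by (auto simp: controlled_def)
  obtain g1 g2 where g: "g = g1 + g2" "g1 \<in> weight_piece w q (c * m')" "g2 \<in> F (q + 1)"
    using assms(2) by (auto simp: controlled_def)
  have F1: "f1 \<in> F p" "g1 \<in> F q" "g2 \<in> F q" using f g weight_piece_F F_Suc by blast+
  have "f1 * g2 \<in> F (p + q + 1)" using F_mult[OF F1(1) g(3)] by (simp add: algebra_simps)
  moreover have "f2 * (g1 + g2) \<in> F (p + q + 1)"
    using F_mult[OF f(3) subspace_add[OF subspace_F F1(2,3)]] by (simp add: algebra_simps)
  ultimately have h: "f1 * g2 + f2 * (g1 + g2) \<in> F (p + q + 1)" by (rule subspace_add[OF subspace_F])
  have "f1 * g1 \<in> weight_piece w (p + q) (c * (m + m'))"
    using weight_piece_mult[OF f(2) g(2)] by (simp add: algebra_simps)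
  moreover have "f * g = f1 * g1 + (f1 * g2 + f2 * (g1 + g2))" by (simp add: f g algebra_simps)
  ultimately show ?thesis using h unfolding controlled_def by blast
qed

text \<open>
  Homogeneous elements of degree \<open>m\<close> can be rewritten modulo deeper elements by monomials whose length is linear in \<open>m\<close>.
  The Khovanskii property alone gives no bound on the length, since the generators need not be homogeneous.  It suffices to
  choose rewritings of the finitely many components of the generators: the property that all components of an element are
  controlled is inherited by products, and by the Khovanskii property it passes from monomials to all elements.
\<close>

lemma degree_control: "\<exists>c\<ge>1. \<forall>q m. \<forall>f\<in>F q. component m f \<in> controlled c m q"
proof -
  define bnd where "bnd k e j \<longleftrightarrow>
      component e (b j) \<in> {p + h | p h. p \<in> weight_piece w (w j) k \<and> h \<in> F (w j + 1)}" for k e j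
  have ex: "\<exists>k. bnd k e j"
    if j: "j < d" for e j
  proof -
    obtain g where g: "g \<in> mspan {\<alpha>. wt w \<alpha> = w j}" "component e (b j) - g \<in> F (w j + 1)"
      using khovanskii[OF F_homogeneous[OF b_F[OF j]]] by blast
    obtain k where "g \<in> weight_piece w (w j) k" using weight_piece_exhaust[OF g(1)] by blast
    then show ?thesis using g(2) unfolding bnd_def
      by (intro exI[of _ k] CollectI exI[of _ g] exI[of _ "component e (b j) - g"]) simp
  qed
  define k where "k e j = (SOME n. bnd n e j)" for e j
  have k: "bnd (k e j) e j" if "j < d" for e j
    unfolding k_def by (rule someI_ex[OF ex[OF that]])
  define c where "c = (\<Sum>e\<le>generator_degree. \<Sum>j<d. k e j) + 1"
  have kc: "k e j \<le> c" if "j < d" "e \<le> generator_degree" for e j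
  proof -
    have "k e j \<le> (\<Sum>j<d. k e j)" using that member_le_sum[of j "{..<d}" "k e"] by simp
    also have "\<dots> \<le> (\<Sum>e\<le>generator_degree. \<Sum>j<d. k e j)"
      using that member_le_sum[of e "{..generator_degree}" "\<lambda>e. \<Sum>j<d. k e j"] by simp
    finally show ?thesis by (simp add: c_def)
  qed
  define P where "P = (\<lambda>q f. \<forall>m. component m f \<in> controlled c m q)"
  have mono_P: "P (wt w \<alpha>) (monomial \<alpha>)" for \<alpha>
  proof (rule closed_under_monomials)
    show "P 0 1" unfolding P_def
      using weight_piece_controlled[OF one_weight_piece] subspace_0[OF subspace_controlled]
      by (simp add: component_one)
    show "P (p + q) (f * g)" if "P p f" "P q g" for p q f g
      unfolding P_def
    proof
      fix m
      show "component m (f * g) \<in> controlled c m (p + q)"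
        by (rule component_mult_mem[of f "\<lambda>m. controlled c m p" g "\<lambda>m. controlled c m q"])
          (use that controlled_mult subspace_controlled in \<open>auto simp: P_def\<close>)
    qed
    fix j assume j: "j < d"
    show "P (w j) (b j)" unfolding P_def
    proof
      fix m
      consider "m = 0" | "m > generator_degree" | "1 \<le> m" "m \<le> generator_degree" by linarith
      then show "component m (b j) \<in> controlled c m (w j)"
      proof cases
        case 1
        then have "component m (b j) \<in> constants" using component_in[of 0 "b j"] A_0 by simp
        \<comment> \<open>The degree-0 component is a scalar, so its value is 0 unless it vanishes.  If it is nonzero
          and \<open>w j = 0\<close>, it is its own rewriting, of length 0.\<close>
        then obtain z where z: "component m (b j) = scale z 1" by (auto simp: constants_def)
        have zF: "scale z 1 \<in> F (w j)" using F_homogeneous[OF b_F[OF j]] z by metis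
        consider "z = 0" | "z \<noteq> 0" "w j < 0" | "z \<noteq> 0" "w j = 0" | "z \<noteq> 0" "w j > 0" by linarith
        then show ?thesis
        proof cases
          case 1 then show ?thesis using z subspace_0[OF subspace_controlled] by simp
        next
          case 2
          then have "F 0 \<subseteq> F (w j + 1)" by (intro F_antimono) simp
          then have "1 \<in> controlled c m (w j)" using F_Suc_controlled one_F by blast
          then show ?thesis using z subspace_scale[OF subspace_controlled] by metis
        next
          case 3
          then have "1 \<in> controlled c m (w j)" using weight_piece_controlled one_weight_piece by metis
          then show ?thesis using z subspace_scale[OF subspace_controlled] by metis
        next
          case 4
          then have "scale z 1 \<in> F 1" using zF F_antimono[of 1 "w j"] by auto
          then have "scale (inverse z) (scale z 1) \<in> F 1" by (rule subspace_scale[OF subspace_F])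
          then show ?thesis using 4 one_not_F by simp
        qed
      next
        case 2
        then have "component m (b j) = 0" using generator_degree(2)[OF j] by (simp add: upto_degree_def)
        then show ?thesis using subspace_0[OF subspace_controlled] by simp
      next
        case 3
        have "c \<le> c * m" using 3 by simp
        then have "k m j \<le> c * m" using kc[OF j 3(2)] by linarith
        then have "weight_piece w (w j) (k m j) \<subseteq> weight_piece w (w j) (c * m)"
          by (rule weight_piece_mono)
        moreover obtain p h where "component m (b j) = p + h" "p \<in> weight_piece w (w j) (k m j)" "h \<in> F (w j + 1)"
          using k[OF j, of m] by (auto simp: bnd_def)
        ultimately show ?thesis unfolding controlled_def by blast
      qed
    qed
  qed
  have "component m f \<in> controlled c m q" if f: "f \<in> F q" for q m f
  proof -
    obtain g where g: "g \<in> mspan {\<alpha>. wt w \<alpha> = q}" "f - g \<in> F (q + 1)" using khovanskii[OF f] by blast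
    have "subspace {f. component m f \<in> controlled c m q}"
      unfolding subspace_def using subspace_controlled[of c m q]
      by (auto simp: component_add component_scale intro: subspace_0 subspace_add subspace_scale)
    then have "mspan {\<alpha>. wt w \<alpha> = q} \<subseteq> {f. component m f \<in> controlled c m q}"
      by (intro mspan_minimal) (use mono_P in \<open>auto simp: P_def\<close>)
    then have 1: "component m g \<in> controlled c m q" using g(1) by blast
    have "component m (f - g) \<in> controlled c m q" using F_homogeneous[OF g(2)] F_Suc_controlled by blast
    then have "component m (g + (f - g)) \<in> controlled c m q"
      unfolding component_add using 1 subspace_add[OF subspace_controlled] by blast
    then show ?thesis by simp
  qed
  moreover have "c \<ge> 1" by (simp add: c_def)
  ultimately show ?thesis by blast
qed

end

section \<open>Counting independent families\<close>

text \<open>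
  Think of \<open>R m N\<close> as saying that a space of size parameter \<open>m\<close> has dimension at least \<open>N\<close>.  Each use of \<open>step\<close>
  costs a constant factor in \<open>m\<close> and gains a factor \<open>m\<close> in \<open>N\<close>, so the dimension grows at least like \<open>m\<^sup>k\<close> for every \<open>k\<close>.
\<close>

lemma growth_contradiction:
  fixes R :: "nat \<Rightarrow> nat \<Rightarrow> bool" and K d :: nat
  assumes base: "\<And>m. R m 1"
    and step: "\<And>m N. R m N \<Longrightarrow> \<exists>N'\<ge>(m + 1) * N. R (K * m) N'"
    and bound: "\<And>m N. R m N \<Longrightarrow> N \<le> (m + 1) ^ d"
    and K: "K \<ge> 1"
  shows False
proof -
  have ex: "\<exists>N\<ge>m ^ k. R (K ^ k * m) N" for m k
  proof (induction k)
    case 0 then show ?case using base[of m] by auto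
  next
    case (Suc k)
    then obtain N where N: "N \<ge> m ^ k" "R (K ^ k * m) N" by blast
    obtain N' where N': "N' \<ge> (K ^ k * m + 1) * N" "R (K * (K ^ k * m)) N'" using step[OF N(2)] by blast
    have "1 * m \<le> K ^ k * m" using K by (intro mult_le_mono1) simp
    then have "m \<le> K ^ k * m + 1" by linarith
    then have "m * m ^ k \<le> (K ^ k * m + 1) * N" using N(1) mult_le_mono by blast
    then show ?case using N' by (intro exI[of _ N']) (simp add: mult.assoc)
  qed
  \<comment> \<open>With \<open>k = d + 1\<close> the two bounds give \<open>m \<le> L\<^sup>d\<close>, and \<open>m\<close> is chosen to violate this.\<close>
  define L where "L = K ^ (d + 1) + 1"
  define m where "m = L ^ d + 1"
  obtain N where N: "N \<ge> m ^ (d + 1)" "R (K ^ (d + 1) * m) N" using ex by blast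
  have "m ^ (d + 1) \<le> (K ^ (d + 1) * m + 1) ^ d" using N bound le_trans by blast
  also have "\<dots> \<le> (L * m) ^ d" by (rule power_mono) (simp_all add: L_def m_def)
  also have "\<dots> = L ^ d * m ^ d" by (rule power_mult_distrib)
  finally have "m ^ d * m \<le> m ^ d * L ^ d" by (simp add: mult.commute)
  moreover have "m ^ d > 0" by (simp add: m_def)
  ultimately have "m \<le> L ^ d" by (meson nat_mult_le_cancel1)
  then show False by (simp add: m_def)
qed

context filtered_generators begin

text \<open>
  The part of length at most \<open>m\<close> of the graded ring of \<open>\<Phi>\<close> has dimension at least \<open>N\<close>.
\<close>

definition realizable :: "(int \<Rightarrow> 'a set) \<Rightarrow> nat \<Rightarrow> nat \<Rightarrow> bool" where
  "realizable \<Phi> m N \<longleftrightarrow>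
     (\<exists>a q. (\<forall>i<N. a i \<in> weight_piece w (q i) m) \<and> graded_independent \<Phi> {..<N} a q)"

lemma realizableI:
  assumes "\<And>i. i \<in> I \<Longrightarrow> a i \<in> weight_piece w (q i) m" "graded_independent \<Phi> I a q"
  shows "realizable \<Phi> m (card I)"
proof -
  have "finite I" using assms(2) by (simp add: graded_independent_def)
  then obtain h where h: "bij_betw h {..<card I} I"
    using ex_bij_betw_nat_finite unfolding lessThan_atLeast0 by blast
  have "graded_independent \<Phi> {..<card I} (a \<circ> h) (q \<circ> h)"
    by (rule graded_independent_reindex[OF assms(2) h])
  moreover have "\<forall>i<card I. (a \<circ> h) i \<in> weight_piece w ((q \<circ> h) i) m"
    using assms(1) h by (auto simp: bij_betw_def)
  ultimately show ?thesis unfolding realizable_def by blast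
qed

lemma realizable_independent:
  assumes "realizable (weight_filtration w) m N"
  obtains B where "independent B" "card B = N" "B \<subseteq> span (monomial ` bounded_exponents m)"
    "B \<subseteq> upto_degree (generator_degree * m)"
proof -
  obtain a q where a: "\<And>i. i < N \<Longrightarrow> a i \<in> weight_piece w (q i) m"
    and gi: "graded_independent (weight_filtration w) {..<N} a q"
    using assms unfolding realizable_def by blast
  have "inj_on a {..<N} \<and> independent (a ` {..<N})"
  proof (rule graded_independent_imp_independent[OF gi])
    show "weight_filtration w (p + 1) \<subseteq> weight_filtration w p" for p
      by (rule weight_filtration_antimono) simp
    show "a i \<in> weight_filtration w (q i)" if "i \<in> {..<N}" for i
      using a weight_piece_subset that by blast
  qed simp
  moreover have "a ` {..<N} \<subseteq> span (monomial ` bounded_exponents m)"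
    using a weight_piece_subset_span by blast
  moreover have "a ` {..<N} \<subseteq> upto_degree (generator_degree * m)"
    using a weight_piece_upto_degree by blast
  ultimately show ?thesis using that[of "a ` {..<N}"] by (simp add: card_image)
qed

lemma realizable_bound:
  assumes "realizable (weight_filtration w) m N"
  shows "N \<le> (m + 1) ^ d"
proof -
  obtain B where B: "independent B" "card B = N" "B \<subseteq> span (monomial ` bounded_exponents m)"
    using realizable_independent[OF assms] by blast
  have "card B \<le> card (monomial ` bounded_exponents m)"
    using independent_span_bound[OF _ B(1,3)] finite_bounded_exponents by blast
  also have "\<dots> \<le> card (bounded_exponents m)" by (rule card_image_le[OF finite_bounded_exponents])
  finally show ?thesis using card_bounded_exponents[of m] B(2) by simp
qed

text \<open>
  A maximal graded-independent set \<open>E\<close> among the monomials with exponents in \<open>T\<close> spans all of them in the graded ring: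
  adjoining another monomial creates a relation in its own weight, in which it occurs with a nonzero coefficient.
\<close>

lemma maximal_standard_monomials:
  assumes "finite T"
  obtains E where "E \<subseteq> T" "graded_independent F E monomial (wt w)"
    "\<And>\<alpha>. \<alpha> \<in> T \<Longrightarrow>
       \<exists>g \<in> mspan {\<beta> \<in> E. wt w \<beta> = wt w \<alpha>}. monomial \<alpha> - g \<in> F (wt w \<alpha> + 1)"
proof -
  define G where "G = {E. E \<subseteq> T \<and> graded_independent F E monomial (wt w)}"
  have "finite G" using assms by (auto simp: G_def intro: finite_subset[of _ "Pow T"])
  moreover have "{} \<in> G" by (simp add: G_def graded_independent_def)
  ultimately obtain E where E: "E \<in> G" and max: "\<And>E'. E' \<in> G \<Longrightarrow> E \<subseteq> E' \<Longrightarrow> E = E'"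
    using finite_has_maximal[of G] by blast
  have finE: "finite E" using E by (simp add: G_def graded_independent_def)
  have giE: "graded_independent F E monomial (wt w)" using E by (simp add: G_def)
  have "\<exists>g \<in> mspan {\<beta> \<in> E. wt w \<beta> = wt w \<alpha>}. monomial \<alpha> - g \<in> F (wt w \<alpha> + 1)" if \<alpha>: "\<alpha> \<in> T" for \<alpha>
  proof (cases "\<alpha> \<in> E")
    case True
    then have "monomial \<alpha> \<in> mspan {\<beta> \<in> E. wt w \<beta> = wt w \<alpha>}" by (intro mspan_base) simp
    then show ?thesis using subspace_0[OF subspace_F] by (intro bexI[of _ "monomial \<alpha>"]) auto
  next
    case False
    then have "insert \<alpha> E \<notin> G" using max[of "insert \<alpha> E"] by blast
    then have "\<not> graded_independent F (insert \<alpha> E) monomial (wt w)"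
      using E \<alpha> by (simp add: G_def)
    then obtain p c \<beta> where pc:
      "(\<Sum>i | i \<in> insert \<alpha> E \<and> wt w i = p. scale (c i) (monomial i)) \<in> F (p + 1)"
      "\<beta> \<in> insert \<alpha> E" "wt w \<beta> = p" "c \<beta> \<noteq> 0"
      using finE unfolding graded_independent_def by auto
    define s where "s = (\<Sum>i | i \<in> E \<and> wt w i = p. scale (c i) (monomial i))"
    have "wt w \<alpha> = p \<and> c \<alpha> \<noteq> 0"
    proof (rule ccontr)
      assume neg: "\<not> (wt w \<alpha> = p \<and> c \<alpha> \<noteq> 0)"
      have "(\<Sum>i | i \<in> insert \<alpha> E \<and> wt w i = p. scale (c i) (monomial i)) = s"
        unfolding s_def
        by (rule sum.mono_neutral_right) (use finE neg in auto)
      then have "s \<in> F (p + 1)" using pc(1) by simp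
      moreover have "\<beta> \<in> E" using neg pc by auto
      ultimately have "c \<beta> = 0" using graded_independentD[OF giE] pc(3) by (simp add: s_def)
      then show False using pc by simp
    qed
    then have \<alpha>p: "wt w \<alpha> = p" "c \<alpha> \<noteq> 0" by auto
    have "{i. i \<in> insert \<alpha> E \<and> wt w i = p} = insert \<alpha> {i. i \<in> E \<and> wt w i = p}" using \<alpha>p by auto
    then have "scale (c \<alpha>) (monomial \<alpha>) + s \<in> F (p + 1)"
      using pc(1) False finE by (simp add: s_def)
    then have "scale (inverse (c \<alpha>)) (scale (c \<alpha>) (monomial \<alpha>) + s) \<in> F (p + 1)"
      by (rule subspace_scale[OF subspace_F])
    then have "monomial \<alpha> - scale (- inverse (c \<alpha>)) s \<in> F (p + 1)"
      using \<alpha>p by (simp add: scale_right_distrib)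
    moreover have "s \<in> mspan {\<beta> \<in> E. wt w \<beta> = wt w \<alpha>}"
      unfolding s_def by (intro subspace_sum subspace_scale mspan_base) (use \<alpha>p in auto)
    then have "scale (- inverse (c \<alpha>)) s \<in> mspan {\<beta> \<in> E. wt w \<beta> = wt w \<alpha>}"
      by (intro subspace_scale subspace_mspan)
    ultimately show ?thesis using \<alpha>p by blast
  qed
  then show ?thesis using that[of E] E by (simp add: G_def)
qed

lemma truncate_F: "f \<in> F q \<Longrightarrow> truncate M f \<in> F q"
  unfolding truncate_def by (rule subspace_sum[OF subspace_F]) (rule F_homogeneous)

text \<open>
  Subduction inside the finite-dimensional space of elements of degree at most \<open>M\<close>: subtract a combination of standard
  monomials with the same leading part, truncated to degree at most \<open>M\<close> because monomials need not respect the degree.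
  Truncation does not decrease values since the filtration is homogeneous.  The value grows at every step and is bounded on
  nonzero elements.
\<close>

lemma subduction:
  assumes c: "\<And>q m f. f \<in> F q \<Longrightarrow> component m f \<in> controlled c m q"
  obtains E where "E \<subseteq> bounded_exponents (c * M)" "graded_independent F E monomial (wt w)"
    "upto_degree M \<subseteq> span ((\<lambda>\<alpha>. truncate M (monomial \<alpha>)) ` E)"
proof -
  obtain E where E: "E \<subseteq> bounded_exponents (c * M)" "graded_independent F E monomial (wt w)"
    "\<And>\<alpha>. \<alpha> \<in> bounded_exponents (c * M) \<Longrightarrow>
       \<exists>g \<in> mspan {\<beta> \<in> E. wt w \<beta> = wt w \<alpha>}. monomial \<alpha> - g \<in> F (wt w \<alpha> + 1)"
    by (rule maximal_standard_monomials[OF finite_bounded_exponents[of "c * M"]]) blast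
  define V where "V = span ((\<lambda>\<alpha>. truncate M (monomial \<alpha>)) ` E)"
  define W where "W q = {g + h | g h. g \<in> mspan {\<beta> \<in> E. wt w \<beta> = q} \<and> h \<in> F (q + 1)}" for q
  have subW: "subspace (W q)" for q unfolding W_def by (rule subspace_sums) simp_all
  have piece_W: "weight_piece w q (c * M) \<subseteq> W q" for q
    unfolding weight_piece_def
  proof (rule mspan_minimal)
    fix \<alpha> assume "\<alpha> \<in> {\<alpha>. wt w \<alpha> = q \<and> exponent_sum \<alpha> \<le> c * M}"
    then obtain g where g: "g \<in> mspan {\<beta> \<in> E. wt w \<beta> = q}" "monomial \<alpha> - g \<in> F (q + 1)"
      using E(3)[OF restrict_bounded, of \<alpha>] by (auto simp: monomial_restrict wt_restrict)
    then show "monomial \<alpha> \<in> W q"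
      unfolding W_def by (intro CollectI exI[of _ g] exI[of _ "monomial \<alpha> - g"]) simp
  qed (rule subW)
  have F_W: "F (q + 1) \<subseteq> W q" for q
    unfolding W_def using subspace_0[OF subspace_mspan] by force
  have reduce: "\<exists>f' \<in> upto_degree M \<inter> F (q + 1). f - f' \<in> V" if f: "f \<in> upto_degree M" "f \<in> F q" for f q
  proof -
    have "component m f \<in> W q" if "m \<le> M" for m
    proof -
      obtain p h where ph: "component m f = p + h" "p \<in> weight_piece w q (c * m)" "h \<in> F (q + 1)"
        using c[OF f(2), of m] by (auto simp: controlled_def)
      have "weight_piece w q (c * m) \<subseteq> weight_piece w q (c * M)"
        by (rule weight_piece_mono) (use that in simp)
      then have "p \<in> W q" using ph(2) piece_W by blast
      moreover have "h \<in> W q" using ph(3) F_W by blast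
      ultimately show ?thesis unfolding ph(1) by (rule subspace_add[OF subW])
    qed
    then have "(\<Sum>m\<le>M. component m f) \<in> W q" by (intro subspace_sum subW) simp
    then have "f \<in> W q" using f(1) by (simp add: sum_component_upto)
    then obtain g h where gh: "f = g + h" "g \<in> mspan {\<beta> \<in> E. wt w \<beta> = q}" "h \<in> F (q + 1)"
      by (auto simp: W_def)
    have "subspace {g. truncate M g \<in> V}"
      unfolding subspace_def V_def
      by (auto simp: truncate_add truncate_scale intro: span_add span_scale)
        (simp add: truncate_def span_zero)
    then have "mspan {\<beta> \<in> E. wt w \<beta> = q} \<subseteq> {g. truncate M g \<in> V}"
      by (intro mspan_minimal) (auto simp: V_def intro: span_base)
    then have "truncate M g \<in> V" using gh by blast
    moreover have "f = truncate M g + truncate M h"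
      using gh(1) truncate_add truncate_id[OF f(1)] by metis
    ultimately show ?thesis using truncate_F[OF gh(3)] truncate_in
      by (intro bexI[of _ "truncate M h"]) auto
  qed
  obtain T where T: "finite T" "upto_degree M \<subseteq> span T" using upto_degree_finite_span by blast
  obtain Q where Q: "upto_degree M \<inter> F Q \<subseteq> {0}"
    using F_vanishes[OF T(1) subspace_upto_degree T(2)] by blast
  \<comment> \<open>Downward induction on the value, starting from \<open>Q\<close>, from where on only 0 is left.\<close>
  have desc: "f \<in> V" if "f \<in> upto_degree M" "f \<in> F (Q - int k)" for f k
    using that
  proof (induction k arbitrary: f)
    case 0
    then have "f = 0" using Q by auto
    then show ?case by (simp add: V_def span_zero)
  next
    case (Suc k)
    obtain f' where f': "f' \<in> upto_degree M" "f' \<in> F (Q - int k)" "f - f' \<in> V"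
      using reduce[OF Suc.prems] by auto
    then have "f' + (f - f') \<in> V" using Suc.IH unfolding V_def by (intro span_add) auto
    then show ?case by simp
  qed
  have "upto_degree M \<subseteq> V"
  proof
    fix f assume f: "f \<in> upto_degree M"
    obtain p where p: "p \<le> Q" "f \<in> weight_filtration w p" using weight_filtration_exhaust by blast
    then have "f \<in> F (Q - int (nat (Q - p)))" using weight_filtration_F by auto
    then show "f \<in> V" using desc f by blast
  qed
  then show ?thesis using that E(1,2) unfolding V_def by blast
qed

text \<open>
  A family independent in the graded ring of \<open>weight_filtration w\<close> consists of linearly independent elements, whose degree
  is at most linear in the length.  The space of all elements of that degree is spanned by as many elements as there are
  standard monomials in the graded ring of \<open>F\<close>.
\<close>

lemma realizable_transfer:
  "\<exists>C\<ge>1. \<forall>m N. realizable (weight_filtration w) m N \<longrightarrow> (\<exists>N'\<ge>N. realizable F (C * m) N')"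
proof -
  obtain c where c: "c \<ge> 1" "\<And>q m f. f \<in> F q \<Longrightarrow> component m f \<in> controlled c m q"
    using degree_control by blast
  have "\<exists>N'\<ge>N. realizable F (c * generator_degree * m) N'" if r: "realizable (weight_filtration w) m N" for m N
  proof -
    obtain E where E: "E \<subseteq> bounded_exponents (c * (generator_degree * m))" "graded_independent F E monomial (wt w)"
      "upto_degree (generator_degree * m) \<subseteq> span ((\<lambda>\<alpha>. truncate (generator_degree * m) (monomial \<alpha>)) ` E)"
      using subduction[OF c(2)] by blast
    have finE: "finite E" using E(2) by (simp add: graded_independent_def)
    obtain B where B: "independent B" "card B = N" "B \<subseteq> upto_degree (generator_degree * m)"
      using realizable_independent[OF r] by blast
    have "card B \<le> card ((\<lambda>\<alpha>. truncate (generator_degree * m) (monomial \<alpha>)) ` E)"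
      using independent_span_bound[OF _ B(1), of "(\<lambda>\<alpha>. truncate (generator_degree * m) (monomial \<alpha>)) ` E"] finE B(3) E(3) by blast
    also have "\<dots> \<le> card E" by (rule card_image_le[OF finE])
    finally have "N \<le> card E" using B(2) by simp
    moreover have "realizable F (c * generator_degree * m) (card E)"
    proof (rule realizableI[OF _ E(2)])
      fix \<alpha> assume "\<alpha> \<in> E"
      then show "monomial \<alpha> \<in> weight_piece w (wt w \<alpha>) (c * generator_degree * m)"
        unfolding weight_piece_def using E(1)
        by (intro mspan_base) (auto simp: bounded_exponents_def mult.assoc)
    qed
    ultimately show ?thesis by blast
  qed
  moreover have "c * generator_degree \<ge> 1" using c(1) generator_degree(1) by simp
  ultimately show ?thesis by blast
qed

context
  assumes prime: "\<And>f g p q. f \<in> weight_filtration w p \<Longrightarrow> g \<in> weight_filtration w q \<Longrightarrow>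
      f * g \<in> weight_filtration w (p + q + 1) \<Longrightarrow>
      f \<in> weight_filtration w (p + 1) \<or> g \<in> weight_filtration w (q + 1)"
begin

text \<open>
  Modulo \<open>F (p + 1)\<close> only the term for \<open>j = 0\<close> survives, as \<open>f\<close> has value greater than \<open>q0\<close>.  Thus \<open>g 0 = 0\<close>, and
  primality allows to cancel one factor \<open>f\<close> from the rest.
\<close>

lemma power_combination_zero:
  assumes f: "f \<in> weight_filtration w q0" "f \<in> F (q0 + 1)" "f \<notin> weight_filtration w (q0 + 1)"
    and g: "\<And>j. j \<le> J \<Longrightarrow> g j \<in> weight_filtration w (p - int j * q0)"
    and g0: "\<And>j. j \<le> J \<Longrightarrow> g j \<in> F (p - int j * q0 + 1) \<Longrightarrow> g j = 0"
    and s: "(\<Sum>j\<le>J. f ^ j * g j) \<in> weight_filtration w (p + 1)"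
  shows "\<forall>j\<le>J. g j = 0"
  using g g0 s
proof (induction J arbitrary: p g)
  case 0
  then have "g 0 \<in> F (p + 1)" using weight_filtration_F by auto
  then show ?case using "0.prems"(2)[of 0] by simp
next
  case (Suc J)
  have fpow: "f ^ j \<in> weight_filtration w (int j * q0)" for j
  proof (induction j)
    case 0 then show ?case using subsetD[OF weight_piece_subset one_weight_piece] by simp
  next
    case (Suc j)
    have "int (Suc j) * q0 = q0 + int j * q0" by (simp add: algebra_simps)
    then show ?case using weight_filtration_mult[OF f(1) Suc] by simp
  qed
  define S where "S = (\<Sum>j\<le>J. f ^ j * g (Suc j))"
  have split: "(\<Sum>j\<le>Suc J. f ^ j * g j) = g 0 + f * S"
    unfolding S_def by (subst sum.atMost_Suc_shift) (simp add: sum_distrib_left mult.assoc)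
  have S: "S \<in> weight_filtration w (p - q0)"
    unfolding S_def
  proof (intro subspace_sum subspace_weight_filtration)
    fix j assume j: "j \<in> {..J}"
    have e: "p - q0 = int j * q0 + (p - int (Suc j) * q0)" by (simp add: algebra_simps)
    show "f ^ j * g (Suc j) \<in> weight_filtration w (p - q0)"
      unfolding e by (rule weight_filtration_mult[OF fpow Suc.prems(1)]) (use j in simp)
  qed
  have "f * S \<in> F (p + 1)" using F_mult[OF f(2), of S "p - q0"] S weight_filtration_F by (auto simp: algebra_simps)
  moreover have "g 0 + f * S \<in> F (p + 1)" using Suc.prems(3) split weight_filtration_F by auto
  ultimately have "g 0 + f * S - f * S \<in> F (p + 1)" by (intro subspace_diff subspace_F)
  then have g00: "g 0 = 0" using Suc.prems(2)[of 0] by simp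
  then have "f * S \<in> weight_filtration w (q0 + (p - q0) + 1)" using Suc.prems(3) split by (simp add: add.commute)
  then have S1: "S \<in> weight_filtration w (p - q0 + 1)" using prime[OF f(1) S] f(3) by blast
  have "\<forall>j\<le>J. g (Suc j) = 0"
  proof (rule Suc.IH[of _ "p - q0"])
    fix j assume j: "j \<le> J"
    have e: "p - q0 - int j * q0 = p - int (Suc j) * q0" by (simp add: algebra_simps)
    show "g (Suc j) \<in> weight_filtration w (p - q0 - int j * q0)"
      unfolding e using Suc.prems(1) j by blast
    show "g (Suc j) \<in> F (p - q0 - int j * q0 + 1) \<Longrightarrow> g (Suc j) = 0"
      unfolding e using Suc.prems(2) j by blast
  next
    show "(\<Sum>j\<le>J. f ^ j * g (Suc j)) \<in> weight_filtration w (p - q0 + 1)" using S1 by (simp add: S_def)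
  qed
  then show ?case using g00 by (metis Suc_le_mono not0_implies_Suc)
qed

text \<open>
  The new family consists of the products \<open>f\<^sup>j * a i\<close>.  In a relation between their leading parts the coefficient of each power of
  \<open>f\<close> is a combination of the \<open>a i\<close> of a single weight, to which \<open>power_combination_zero\<close> applies.
\<close>

lemma realizable_multiply:
  assumes f: "f \<in> weight_piece w q0 c0" "f \<in> F (q0 + 1)" "f \<notin> weight_filtration w (q0 + 1)"
    and r: "realizable F M N"
  shows "realizable (weight_filtration w) (M + c0 * J) ((J + 1) * N)"
proof -
  obtain a q where a: "\<And>i. i < N \<Longrightarrow> a i \<in> weight_piece w (q i) M"
    and gi: "graded_independent F {..<N} a q"
    using r unfolding realizable_def by blast
  have fpow: "f ^ j \<in> weight_piece w (int j * q0) (c0 * j)" for j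
  proof (induction j)
    case 0 then show ?case using one_weight_piece by simp
  next
    case (Suc j)
    have "int (Suc j) * q0 = q0 + int j * q0" by (simp add: algebra_simps)
    then show ?case using weight_piece_mult[OF f(1) Suc] by simp
  qed
  let ?I = "{..J} \<times> {..<N}"
  let ?a = "\<lambda>(j, i). f ^ j * a i" and ?q = "\<lambda>(j, i). int j * q0 + q i"
  have "realizable (weight_filtration w) (M + c0 * J) (card ?I)"
  proof (rule realizableI[of _ ?a ?q])
    fix x assume "x \<in> ?I"
    then obtain j i where x: "x = (j, i)" "j \<le> J" "i < N" by auto
    have "f ^ j * a i \<in> weight_piece w (int j * q0 + q i) (c0 * j + M)"
      by (rule weight_piece_mult[OF fpow a[OF x(3)]])
    moreover have "weight_piece w (int j * q0 + q i) (c0 * j + M)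
        \<subseteq> weight_piece w (int j * q0 + q i) (M + c0 * J)"
      by (rule weight_piece_mono) (use x in simp)
    ultimately show "?a x \<in> weight_piece w (?q x) (M + c0 * J)" using x by auto
  next
    show "graded_independent (weight_filtration w) ?I ?a ?q"
      unfolding graded_independent_def
    proof (intro conjI allI impI ballI)
      fix p c x
      assume s: "(\<Sum>x | x \<in> ?I \<and> ?q x = p. scale (c x) (?a x)) \<in> weight_filtration w (p + 1)"
        and x: "x \<in> ?I" "?q x = p"
      define g where "g j = (\<Sum>i | i \<in> {..<N} \<and> q i = p - int j * q0. scale (c (j, i)) (a i))" for j
      have eq: "{x. x \<in> ?I \<and> ?q x = p} = (SIGMA j:{..J}. {i. i \<in> {..<N} \<and> q i = p - int j * q0})"
        by (auto simp: algebra_simps)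
      have "(\<Sum>x | x \<in> ?I \<and> ?q x = p. scale (c x) (?a x)) =
          (\<Sum>j\<le>J. \<Sum>i | i \<in> {..<N} \<and> q i = p - int j * q0. scale (c (j, i)) (f ^ j * a i))"
        unfolding eq by (subst sum.Sigma) (auto intro!: sum.cong)
      also have "\<dots> = (\<Sum>j\<le>J. f ^ j * g j)"
        by (simp add: g_def sum_distrib_left scale_mult_right)
      finally have s': "(\<Sum>j\<le>J. f ^ j * g j) \<in> weight_filtration w (p + 1)" using s by simp
      have c0: "c (j, i) = 0" if "g j \<in> F (p - int j * q0 + 1)" "i < N" "q i = p - int j * q0" for j i
        using graded_independentD[OF gi, of "\<lambda>i. c (j, i)"] that by (simp add: g_def)
      have "\<forall>j\<le>J. g j = 0"
      proof (rule power_combination_zero[OF _ f(2,3) _ _ s'])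
        show "f \<in> weight_filtration w q0" using f(1) weight_piece_subset by blast
        show "g j \<in> weight_filtration w (p - int j * q0)" for j
          unfolding g_def
          by (intro subspace_sum subspace_scale subspace_weight_filtration)
            (use a weight_piece_subset in force)
        show "g j = 0" if "g j \<in> F (p - int j * q0 + 1)" for j
          using c0[OF that] by (simp add: g_def)
      qed
      then have "c (j, i) = 0" if "j \<le> J" "i < N" "q i = p - int j * q0" for j i
        using c0 that subspace_0[OF subspace_F] by metis
      then show "c x = 0" using x by (auto simp: algebra_simps)
    qed simp
  qed
  then show ?thesis by simp
qed

lemma realizable_one: "realizable (weight_filtration w) m 1"
  unfolding realizable_def
proof (intro exI conjI)
  show "graded_independent (weight_filtration w) {..<1::nat} (\<lambda>_. 1) (\<lambda>_. 0)"
    unfolding graded_independent_def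
  proof (intro conjI allI impI ballI)
    fix p :: int and c :: "nat \<Rightarrow> 'k" and i :: nat
    assume s: "(\<Sum>i | i \<in> {..<1} \<and> 0 = p. scale (c i) 1) \<in> weight_filtration w (p + 1)"
      and i: "i \<in> {..<1}" "0 = p"
    have "scale (c 0) 1 \<in> F 1" using s i weight_filtration_F[of 1] by auto
    then have "scale (inverse (c 0)) (scale (c 0) 1) \<in> F 1" by (rule subspace_scale[OF subspace_F])
    then show "c i = 0" using one_not_F i by (cases "c 0 = 0") auto
  qed simp
qed (use one_weight_piece in simp)

text \<open>
  The injectivity of the map from the graded ring of \<open>weight_filtration w\<close> to that of \<open>F\<close>, provided that the former is
  a domain.
\<close>

theorem weight_filtration_saturated:
  assumes "f \<in> weight_filtration w q0" "f \<in> F (q0 + 1)"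
  shows "f \<in> weight_filtration w (q0 + 1)"
proof (rule ccontr)
  assume notin: "f \<notin> weight_filtration w (q0 + 1)"
  \<comment> \<open>Only the part of exact weight \<open>q0\<close> matters: the rest already has the required weight.\<close>
  have "weight_filtration w q0 \<subseteq> mspan ({\<alpha>. wt w \<alpha> = q0} \<union> {\<alpha>. q0 + 1 \<le> wt w \<alpha>})"
    unfolding weight_filtration_def by (rule mspan_mono) auto
  then obtain f1 f2 where f12: "f = f1 + f2" "f1 \<in> mspan {\<alpha>. wt w \<alpha> = q0}"
    "f2 \<in> weight_filtration w (q0 + 1)"
    using assms(1) mspan_Un unfolding weight_filtration_def by blast
  obtain c0 where c0: "f1 \<in> weight_piece w q0 c0" using weight_piece_exhaust[OF f12(2)] by blast
  have f1F: "f1 \<in> F (q0 + 1)"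
    using subspace_diff[OF subspace_F assms(2), of f2] f12 weight_filtration_F by auto
  have f1n: "f1 \<notin> weight_filtration w (q0 + 1)"
    using notin f12 subspace_add[OF subspace_weight_filtration] by blast
  obtain C where C: "C \<ge> 1"
    "\<And>m N. realizable (weight_filtration w) m N \<Longrightarrow> \<exists>N'\<ge>N. realizable F (C * m) N'"
    using realizable_transfer by blast
  show False
  proof (rule growth_contradiction[of "realizable (weight_filtration w)" "C + c0" d])
    fix m N assume "realizable (weight_filtration w) m N"
    then obtain N' where N': "N' \<ge> N" "realizable F (C * m) N'" using C(2) by blast
    have "realizable (weight_filtration w) ((C + c0) * m) ((m + 1) * N')"
      using realizable_multiply[OF c0 f1F f1n N'(2), of m] by (simp add: algebra_simps)
    then show "\<exists>N'\<ge>(m + 1) * N. realizable (weight_filtration w) ((C + c0) * m) N'"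
      using N'(1) mult_le_mono2 by blast
  qed (use C(1) realizable_one realizable_bound in auto)
qed

end
end

section \<open>Subrings and ideals of type-class rings\<close>

lemma subset_ring_simps [simp]:
  "carrier (subset_ring S) = S" "x \<otimes>\<^bsub>subset_ring S\<^esub> y = x * y" "\<one>\<^bsub>subset_ring S\<^esub> = 1"
  "\<zero>\<^bsub>subset_ring S\<^esub> = 0" "x \<oplus>\<^bsub>subset_ring S\<^esub> y = x + y"
  by (simp_all add: subset_ring_def ring_of_type_algebra_def)

definition subring_set :: "'r::comm_ring_1 set \<Rightarrow> bool" where
  "subring_set S \<longleftrightarrow> 1 \<in> S \<and> (\<forall>x\<in>S. - x \<in> S) \<and> (\<forall>x\<in>S. \<forall>y\<in>S. x + y \<in> S \<and> x * y \<in> S)"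

lemma subring_setD:
  assumes "subring_set S"
  shows "1 \<in> S" "0 \<in> S" "x \<in> S \<Longrightarrow> - x \<in> S" "x \<in> S \<Longrightarrow> y \<in> S \<Longrightarrow> x + y \<in> S"
    "x \<in> S \<Longrightarrow> y \<in> S \<Longrightarrow> x * y \<in> S" "x \<in> S \<Longrightarrow> y \<in> S \<Longrightarrow> x - y \<in> S"
proof -
  show 1: "1 \<in> S" and "x \<in> S \<Longrightarrow> - x \<in> S" and "x \<in> S \<Longrightarrow> y \<in> S \<Longrightarrow> x + y \<in> S"
    and "x \<in> S \<Longrightarrow> y \<in> S \<Longrightarrow> x * y \<in> S"
    using assms by (auto simp: subring_set_def)
  have "1 + (- 1) \<in> S" using assms unfolding subring_set_def by blast
  then show "0 \<in> S" by simp
  assume "x \<in> S" "y \<in> S"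
  then have "x + (- y) \<in> S" using assms unfolding subring_set_def by blast
  then show "x - y \<in> S" by simp
qed

lemma subring_set_sum: "subring_set S \<Longrightarrow> (\<And>i. i \<in> I \<Longrightarrow> f i \<in> S) \<Longrightarrow> sum f I \<in> S"
  by (induction I rule: infinite_finite_induct) (auto simp: subring_setD)

lemma cring_subset_ring: "subring_set S \<Longrightarrow> cring (subset_ring S)"
proof -
  assume S: "subring_set S"
  have "abelian_group (subset_ring S)"
    by (rule abelian_groupI) (use subring_setD[OF S] in \<open>auto simp: ac_simps intro: bexI[of _ "- _"]\<close>)
  moreover have "Group.comm_monoid (subset_ring S)"
    by (rule comm_monoidI) (use subring_setD[OF S] in \<open>auto simp: ac_simps\<close>)
  ultimately show ?thesis
    by (rule cringI) (simp add: distrib_right)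
qed

lemma a_inv_subset_ring:
  assumes "subring_set S" "x \<in> S"
  shows "\<ominus>\<^bsub>subset_ring S\<^esub> x = - x"
proof -
  interpret cring "subset_ring S" by (rule cring_subset_ring[OF assms(1)])
  show ?thesis using assms minus_equality[of "- x" x] subring_setD(3)[OF assms(1)] by simp
qed

lemma ideal_subset_ringI:
  assumes S: "subring_set S" and I: "I \<subseteq> S" "0 \<in> I"
    and add: "\<And>x y. x \<in> I \<Longrightarrow> y \<in> I \<Longrightarrow> x + y \<in> I"
    and mult: "\<And>x y. x \<in> I \<Longrightarrow> y \<in> S \<Longrightarrow> y * x \<in> I"
  shows "ideal I (subset_ring S)"
proof -
  interpret cring "subset_ring S" by (rule cring_subset_ring[OF S])
  have neg: "- x \<in> I" if "x \<in> I" for x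
    using mult[OF that, of "- 1"] subring_setD[OF S] by simp
  have "subgroup I (add_monoid (subset_ring S))"
  proof (rule group.subgroupI)
    show "Group.group (add_monoid (subset_ring S))" by (rule a_group)
    fix x assume x: "x \<in> I"
    have "inv\<^bsub>add_monoid (subset_ring S)\<^esub> x = \<ominus>\<^bsub>subset_ring S\<^esub> x" by (simp add: a_inv_def)
    then show "inv\<^bsub>add_monoid (subset_ring S)\<^esub> x \<in> I"
      using a_inv_subset_ring[OF S] x I neg by (metis subsetD)
  qed (use I add in auto)
  then show ?thesis
    by (intro idealI ring_axioms) (use mult in \<open>auto simp: mult.commute\<close>)
qed

lemma ideal_subset_ringD:
  assumes "ideal I (subset_ring S)" "subring_set S"
  shows "I \<subseteq> S" "0 \<in> I" "x \<in> I \<Longrightarrow> y \<in> I \<Longrightarrow> x + y \<in> I"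
    "x \<in> I \<Longrightarrow> y \<in> S \<Longrightarrow> y * x \<in> I" "x \<in> I \<Longrightarrow> - x \<in> I"
    "x \<in> I \<Longrightarrow> y \<in> I \<Longrightarrow> x - y \<in> I"
proof -
  interpret ideal I "subset_ring S" by (rule assms)
  show sub: "I \<subseteq> S" using a_subset by simp
  show "0 \<in> I" using additive_subgroup.zero_closed[OF is_additive_subgroup] by simp
  show add: "x \<in> I \<Longrightarrow> y \<in> I \<Longrightarrow> x + y \<in> I" for x y
    using additive_subgroup.a_closed[OF is_additive_subgroup] by simp
  show mult: "x \<in> I \<Longrightarrow> y \<in> S \<Longrightarrow> y * x \<in> I" for x y using I_l_closed by simp
  show neg: "x \<in> I \<Longrightarrow> - x \<in> I" for x
    using mult[of x "- 1"] subring_setD[OF assms(2)] by simp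
  show "x \<in> I \<Longrightarrow> y \<in> I \<Longrightarrow> x - y \<in> I"
    using add[of x "- y"] neg by simp
qed

lemma ideal_subset_ring_sum:
  assumes "ideal I (subset_ring S)" "subring_set S" "\<And>i. i \<in> J \<Longrightarrow> f i \<in> I"
  shows "sum f J \<in> I"
  using assms(3)
  by (induction J rule: infinite_finite_induct) (auto simp: ideal_subset_ringD[OF assms(1,2)])

lemma subring_set_prod: "subring_set S \<Longrightarrow> (\<And>i. i \<in> I \<Longrightarrow> f i \<in> S) \<Longrightarrow> prod f I \<in> S"
  by (induction I rule: infinite_finite_induct) (auto simp: subring_setD)

lemma subring_set_power: "subring_set S \<Longrightarrow> x \<in> S \<Longrightarrow> x ^ k \<in> S"
  by (induction k) (auto simp: subring_setD)

lemma subring_set_generate: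
  assumes "subring_set S" "H \<subseteq> S"
  shows "subring_set (generate_ring (subset_ring S) H)" "generate_ring (subset_ring S) H \<subseteq> S"
proof -
  interpret cring "subset_ring S" by (rule cring_subset_ring[OF assms(1)])
  show sub: "generate_ring (subset_ring S) H \<subseteq> S" using generate_ring_incl[of H] assms(2) by simp
  show "subring_set (generate_ring (subset_ring S) H)"
    unfolding subring_set_def
  proof (intro conjI ballI)
    show "1 \<in> generate_ring (subset_ring S) H" using generate_ring.one[of "subset_ring S" H] by simp
    fix x assume x: "x \<in> generate_ring (subset_ring S) H"
    show "- x \<in> generate_ring (subset_ring S) H"
      using generate_ring.a_inv[OF x] a_inv_subset_ring[OF assms(1), of x] x sub by auto
    fix y assume y: "y \<in> generate_ring (subset_ring S) H"
    show "x + y \<in> generate_ring (subset_ring S) H" "x * y \<in> generate_ring (subset_ring S) H"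
      using generate_ring.eng_add[OF x y] generate_ring.eng_mult[OF x y] by auto
  qed
qed

lemma generate_subset_ring_minimal:
  assumes "subring_set S" "H \<subseteq> S" "subring_set T" "H \<subseteq> T"
  shows "generate_ring (subset_ring S) H \<subseteq> T"
proof
  fix x assume "x \<in> generate_ring (subset_ring S) H"
  then show "x \<in> T"
  proof (induction rule: generate_ring.induct)
    case (a_inv h)
    then have "h \<in> S" using subring_set_generate(2)[OF assms(1,2)] by blast
    then show ?case using a_inv subring_setD(3)[OF assms(3)] a_inv_subset_ring[OF assms(1)] by metis
  qed (use assms(4) subring_setD[OF assms(3)] in auto)
qed

section \<open>Finitely supported functions and graded prime ideals\<close>

lemma poly_mapping_sum_single: "(\<Sum>m\<in>supp p. sgl m (lk p m)) = p"
proof (rule poly_mapping_eqI)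
  fix k
  have "(\<Sum>m\<in>supp p. lk (sgl m (lk p m)) k)
      = (\<Sum>m\<in>supp p. if m = k then lk p m else 0)"
    by (intro sum.cong) (auto simp: lookup_single when_def)
  then show "lk (\<Sum>m\<in>supp p. sgl m (lk p m)) k
      = lk p k"
    by (simp add: lookup_sum in_keys_iff)
qed

lemma lookup_mult_keys:
  "lk (F * G) g = (\<Sum>a\<in>supp F. \<Sum>b\<in>supp G.
     if a + b = g then lk F a * lk G b else 0)"
proof -
  have "F * G = (\<Sum>a\<in>supp F. sgl a (lk F a)) *
      (\<Sum>b\<in>supp G. sgl b (lk G b))"
    by (simp add: poly_mapping_sum_single)
  also have "\<dots> = (\<Sum>a\<in>supp F. \<Sum>b\<in>supp G.
      sgl (a + b) (lk F a * lk G b))"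
    by (simp add: sum_product mult_single)
  finally show ?thesis by (auto simp: lookup_sum lookup_single when_def intro!: sum.cong)
qed

lemma prod_single:
  "(\<Prod>x\<in>S. sgl (r x) (f x :: 'b::comm_ring_1)) = sgl (\<Sum>x\<in>S. r x) (\<Prod>x\<in>S. f x)"
  by (induction S rule: infinite_finite_induct) (auto simp: mult_single)

lemma power_single:
  "sgl r (f :: 'b::comm_ring_1) ^ k = sgl (\<Sum>i<k. r) (f ^ k)"
  using prod_single[of "\<lambda>_. r" "\<lambda>_. f" "{..<k}"] by simp

lemma lookup_sum_single:
  "finite S \<Longrightarrow> lk (\<Sum>k\<in>S. sgl k (f k)) j = (if j \<in> S then f j else 0)"
  by (simp add: lookup_sum lookup_single when_def)

lemma subring_set_mpoly: "subring_set {p :: ('x, 'k::comm_ring_1) mpoly. \<forall>m\<in>supp p. supp m \<subseteq> V}"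
  (is "subring_set ?S")
  unfolding subring_set_def
proof (intro conjI ballI)
  fix p q :: "('x, 'k) mpoly"
  assume p: "p \<in> ?S"
    and q: "q \<in> ?S"
  show "p + q \<in> ?S"
    using p q Poly_Mapping.keys_add[of p q] by blast
  show "p * q \<in> ?S"
  proof (intro CollectI ballI)
    fix m assume "m \<in> supp (p * q)"
    then obtain a c where "m = a + c" "a \<in> supp p" "c \<in> supp q"
      using keys_mult[of p q] by blast
    then have "supp a \<subseteq> V" "supp c \<subseteq> V" using p q by auto
    then show "supp m \<subseteq> V" using \<open>m = a + c\<close> Poly_Mapping.keys_add[of a c] by blast
  qed
next
  fix p :: "('x, 'k) mpoly"
  assume p: "p \<in> ?S"
  then show "- p \<in> ?S"
    by (simp add: in_keys_iff)
qed simp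

lemma carrier_mpoly_ring: "carrier (mpoly_ring V) = {p. \<forall>m\<in>supp p. supp m \<subseteq> V}"
  by (simp add: mpoly_ring_def)

lemma subring_carrier: "subring_set (carrier (mpoly_ring V))"
  unfolding carrier_mpoly_ring by (rule subring_set_mpoly)

text \<open>
  Not to be used as an unfolding rule, as the left-hand side occurs on the right.
\<close>

lemma mpoly_ring_subset: "mpoly_ring V = subset_ring (carrier (mpoly_ring V))"
  by (simp add: mpoly_ring_def)

lemma subring_set_graded:
  fixes U :: "(nat \<Rightarrow>\<^sub>0 int) \<Rightarrow> 'a::comm_ring_1 set"
  assumes zero: "\<And>r. 0 \<in> U r" and add: "\<And>r f g. f \<in> U r \<Longrightarrow> g \<in> U r \<Longrightarrow> f + g \<in> U r"
    and neg: "\<And>r f. f \<in> U r \<Longrightarrow> - f \<in> U r" and one: "1 \<in> U 0"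
    and mult: "\<And>r s f g. f \<in> U r \<Longrightarrow> g \<in> U s \<Longrightarrow> f * g \<in> U (r + s)"
  shows "subring_set {F. \<forall>r\<in>supp F. supp r \<subseteq> {..<n} \<and> lk F r \<in> U r}"
    (is "subring_set ?S")
proof -
  have lk: "lk F r \<in> U r" if "F \<in> ?S" for F r
    using that zero by (cases "r \<in> supp F") (auto simp: in_keys_iff)
  have sumU: "sum f I \<in> U r" if "\<And>i. i \<in> I \<Longrightarrow> f i \<in> U r" for f r and I :: "(nat \<Rightarrow>\<^sub>0 int) set"
    using that by (induction I rule: infinite_finite_induct) (auto simp: zero add)
  show ?thesis
    unfolding subring_set_def
  proof (intro conjI ballI)
    show "1 \<in> ?S" using one by (auto split: if_splits)
    fix F assume F: "F \<in> ?S"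
    then show "- F \<in> ?S" using neg by (auto simp: in_keys_iff)
    fix G assume G: "G \<in> ?S"
    show "F + G \<in> ?S"
    proof (intro CollectI ballI conjI)
      fix r assume "r \<in> supp (F + G)"
      then show "supp r \<subseteq> {..<n}" using Poly_Mapping.keys_add[of F G] F G by auto
      show "lk (F + G) r \<in> U r" unfolding lookup_add by (rule add[OF lk[OF F] lk[OF G]])
    qed
    show "F * G \<in> ?S"
    proof (intro CollectI ballI conjI)
      fix r assume "r \<in> supp (F * G)"
      then obtain a c where ac: "r = a + c" "a \<in> supp F" "c \<in> supp G"
        using keys_mult[of F G] by blast
      have "supp a \<subseteq> {..<n}" "supp c \<subseteq> {..<n}" using ac F G by auto
      then show "supp r \<subseteq> {..<n}" using Poly_Mapping.keys_add[of a c] ac(1) by blast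
      show "lk (F * G) r \<in> U r"
        unfolding lookup_mult_keys
      proof (rule sumU, rule sumU)
        fix a c
        show "(if a + c = r then lk F a * lk G c else 0) \<in> U r"
          using mult[OF lk[OF F, of a] lk[OF G, of c]] zero by auto
      qed
    qed
  qed
qed

text \<open>
  An ideal graded by a linearly ordered group is prime if it is prime for homogeneous elements.  In the product of two
  elements outside the ideal look at the sum of the lowest degrees in which they are outside: every other contribution to
  that degree has a factor in the ideal.
\<close>

lemma graded_prime:
  fixes F G :: "'g::linordered_ab_group_add \<Rightarrow>\<^sub>0 'a::comm_ring_1"
  assumes zero: "\<And>g. 0 \<in> \<Psi> g" and add: "\<And>g x y. x \<in> \<Psi> g \<Longrightarrow> y \<in> \<Psi> g \<Longrightarrow> x + y \<in> \<Psi> g"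
    and neg: "\<And>g x. x \<in> \<Psi> g \<Longrightarrow> - x \<in> \<Psi> g"
    and mult: "\<And>g h x y. x \<in> \<Psi> g \<Longrightarrow> y \<in> \<Phi> h \<Longrightarrow> x * y \<in> \<Psi> (g + h)"
    and prime: "\<And>g h x y. x \<in> \<Phi> g \<Longrightarrow> y \<in> \<Phi> h \<Longrightarrow> x * y \<in> \<Psi> (g + h) \<Longrightarrow> x \<in> \<Psi> g \<or> y \<in> \<Psi> h"
    and F: "\<And>g. lk F g \<in> \<Phi> g" and G: "\<And>g. lk G g \<in> \<Phi> g"
    and FG: "\<And>g. lk (F * G) g \<in> \<Psi> g"
  shows "(\<forall>g. lk F g \<in> \<Psi> g) \<or> (\<forall>g. lk G g \<in> \<Psi> g)"
proof (rule ccontr)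
  assume neg_thesis: "\<not> ?thesis"
  define BF where "BF = {g. lk F g \<notin> \<Psi> g}"
  define BG where "BG = {g. lk G g \<notin> \<Psi> g}"
  have sub: "BF \<subseteq> supp F" "BG \<subseteq> supp G"
    using zero by (auto simp: BF_def BG_def in_keys_iff)
  have fin: "finite BF" "finite BG"
    by (rule finite_subset[OF sub(1)], simp) (rule finite_subset[OF sub(2)], simp)
  have ne: "BF \<noteq> {}" "BG \<noteq> {}" using neg_thesis by (auto simp: BF_def BG_def)
  define g0 where "g0 = Min BF"
  define h0 where "h0 = Min BG"
  have g0: "g0 \<in> BF" "\<And>g. g < g0 \<Longrightarrow> lk F g \<in> \<Psi> g"
    using fin ne by (auto simp: g0_def) (auto simp: BF_def)
  have h0: "h0 \<in> BG" "\<And>g. g < h0 \<Longrightarrow> lk G g \<in> \<Psi> g"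
    using fin ne by (auto simp: h0_def) (auto simp: BG_def)
  define P where "P = supp F \<times> supp G"
  define t where "t = (\<lambda>(a, b). if a + b = g0 + h0 then lk F a * lk G b else 0)"
  have P: "finite P" "(g0, h0) \<in> P" using g0(1) h0(1) sub by (auto simp: P_def)
  have sum\<Psi>: "(\<Sum>x\<in>S. f x) \<in> \<Psi> k" if "\<And>x. x \<in> S \<Longrightarrow> f x \<in> \<Psi> k" for S k and f :: "'g \<times> 'g \<Rightarrow> 'a"
    using that by (induction S rule: infinite_finite_induct) (auto simp: zero add)
  have "lk (F * G) (g0 + h0) = (\<Sum>x\<in>P. t x)"
    unfolding lookup_mult_keys P_def t_def by (simp add: sum.cartesian_product)
  also have "\<dots> = t (g0, h0) + (\<Sum>x\<in>P - {(g0, h0)}. t x)" by (rule sum.remove[OF P])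
  finally have e: "t (g0, h0) = lk (F * G) (g0 + h0) + - (\<Sum>x\<in>P - {(g0, h0)}. t x)"
    by simp
  have "(\<Sum>x\<in>P - {(g0, h0)}. t x) \<in> \<Psi> (g0 + h0)"
  proof (rule sum\<Psi>)
    fix x assume x: "x \<in> P - {(g0, h0)}"
    obtain a b where ab: "x = (a, b)" by (cases x)
    show "t x \<in> \<Psi> (g0 + h0)"
    proof (cases "a + b = g0 + h0")
      case True
      consider "a < g0" | "b < h0"
      proof (cases "a < g0 \<or> b < h0")
        case False
        then have ge: "g0 \<le> a" "h0 \<le> b" by auto
        have "a = g0"
        proof (rule ccontr)
          assume "a \<noteq> g0"
          then have "g0 + h0 < a + b" using ge by (intro add_less_le_mono) auto
          then show False using True by simp
        qed
        then have "x = (g0, h0)" using True ab by simp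
        then show ?thesis using x by simp
      qed (use that in blast)
      then have "lk F a * lk G b \<in> \<Psi> (a + b)"
      proof cases
        case 1 then show ?thesis using g0(2) mult G by blast
      next
        case 2
        then have "lk G b * lk F a \<in> \<Psi> (b + a)" using h0(2) mult F by blast
        then show ?thesis by (simp add: ac_simps)
      qed
      then show ?thesis using True by (simp add: t_def ab)
    next
      case False then show ?thesis by (simp add: t_def ab zero)
    qed
  qed
  then have "t (g0, h0) \<in> \<Psi> (g0 + h0)" unfolding e using FG neg add by blast
  then have "lk F g0 * lk G h0 \<in> \<Psi> (g0 + h0)" by (simp add: t_def)
  then show False using prime[OF F G] g0(1) h0(1) by (auto simp: BF_def BG_def)
qed

section \<open>The initial ideals of the relation ideal\<close>

locale cox_relations = generated_algebra scale d b
  for scale :: "'k::field \<Rightarrow> 'a::comm_ring_1 \<Rightarrow> 'a" and d b +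
  fixes n :: nat and D :: "nat \<Rightarrow> nat \<Rightarrow> int"
begin

abbreviation "vars \<equiv> XY_vars n d"
abbreviation polys :: "(nat + nat, 'k) mpoly set" where "polys \<equiv> carrier (mpoly_ring vars)"

definition yexp :: "(nat + nat \<Rightarrow>\<^sub>0 nat) \<Rightarrow> nat \<Rightarrow> nat" where
  "yexp m j = lk m (Inr j)"

text \<open>
  The exponent of \<open>t\<close> in the image of the monomial with exponents \<open>m\<close>.
\<close>

definition t_deg :: "(nat + nat \<Rightarrow>\<^sub>0 nat) \<Rightarrow> nat \<Rightarrow>\<^sub>0 int" where
  "t_deg m = (\<Sum>k<n. sgl k (wt (D k) (yexp m) - int (lk m (Inl k))))"

text \<open>
  The \<open>t\<close>-degree refined by the exponent of \<open>X\<^sub>i\<close>, which is recorded in the free coordinate \<open>n\<close>.  In this way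
  the bidegrees form a linearly ordered group of the same kind as the \<open>t\<close>-degrees.
\<close>

definition fine_deg :: "nat \<Rightarrow> (nat + nat \<Rightarrow>\<^sub>0 nat) \<Rightarrow> nat \<Rightarrow>\<^sub>0 int" where
  "fine_deg i m = t_deg m + sgl n (int (lk m (Inl i)))"

lemma lookup_t_deg: "lk (t_deg m) k = (if k < n then wt (D k) (yexp m) - int (lk m (Inl k)) else 0)"
  by (simp add: t_deg_def lookup_sum_single)

lemma lookup_fine_deg: "lk (fine_deg i m) k =
    (if k < n then wt (D k) (yexp m) - int (lk m (Inl k)) else if k = n then int (lk m (Inl i)) else 0)"
  by (simp add: fine_deg_def lookup_add lookup_t_deg lookup_single when_def)

lemma yexp_add: "yexp (m + m') = (\<lambda>j. yexp m j + yexp m' j)"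
  by (simp add: fun_eq_iff yexp_def lookup_add)

lemma fine_deg_add: "fine_deg i (m + m') = fine_deg i m + fine_deg i m'"
  by (rule poly_mapping_eqI) (simp add: lookup_fine_deg lookup_add yexp_add wt_add)

lemma fine_deg_eq_iff: "fine_deg i m = fine_deg i m' \<longleftrightarrow> t_deg m = t_deg m' \<and> lk m (Inl i) = lk m' (Inl i)"
proof
  assume "fine_deg i m = fine_deg i m'"
  then have e: "lk (fine_deg i m) k = lk (fine_deg i m') k" for k by simp
  have "t_deg m = t_deg m'"
  proof (rule poly_mapping_eqI)
    fix k show "lk (t_deg m) k = lk (t_deg m') k" using e[of k] by (auto simp: lookup_t_deg lookup_fine_deg split: if_splits)
  qed
  then show "t_deg m = t_deg m' \<and> lk m (Inl i) = lk m' (Inl i)" using e[of n] by (simp add: lookup_fine_deg)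
qed (simp add: fine_deg_def)

text \<open>
  Evaluation at \<open>X = 1\<close>, \<open>Y = b\<close>, keeping track of a grading \<open>\<delta>\<close>.  For the \<open>t\<close>-degree it is the given map to
  \<open>A \<otimes> k[t\<^sup>\<plusminus>\<^sup>1]\<close>; for the finer degree it separates the powers of \<open>X\<^sub>i\<close> as well.
\<close>

definition graded_eval ::
    "((nat + nat \<Rightarrow>\<^sub>0 nat) \<Rightarrow> nat \<Rightarrow>\<^sub>0 int) \<Rightarrow> (nat + nat, 'k) mpoly \<Rightarrow> (nat \<Rightarrow>\<^sub>0 int) \<Rightarrow>\<^sub>0 'a" where
  "graded_eval \<delta> p = (\<Sum>m\<in>supp p. sgl (\<delta> m) (scale (lk p m) (monomial (yexp m))))"

lemma graded_eval_superset:
  assumes "finite S" "supp p \<subseteq> S"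
  shows "graded_eval \<delta> p = (\<Sum>m\<in>S. sgl (\<delta> m) (scale (lk p m) (monomial (yexp m))))"
  unfolding graded_eval_def
  by (rule sum.mono_neutral_left) (use assms in \<open>auto simp: in_keys_iff\<close>)

lemma graded_eval_add: "graded_eval \<delta> (p + q) = graded_eval \<delta> p + graded_eval \<delta> q"
proof -
  let ?S = "supp p \<union> supp q"
  have "supp (p + q) \<subseteq> ?S" by (rule Poly_Mapping.keys_add)
  then show ?thesis
    by (simp add: graded_eval_superset[of ?S] lookup_add scale_left_distrib single_add sum.distrib)
qed

lemma graded_eval_zero [simp]: "graded_eval \<delta> 0 = 0" by (simp add: graded_eval_def)

lemma graded_eval_uminus: "graded_eval \<delta> (- p) = - graded_eval \<delta> p"
  using graded_eval_add[of \<delta> p "- p"] by (simp add: eq_neg_iff_add_eq_0 add.commute)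

lemma graded_eval_diff: "graded_eval \<delta> (p - q) = graded_eval \<delta> p - graded_eval \<delta> q"
  using graded_eval_add[of \<delta> p "- q"] by (simp add: graded_eval_uminus)

lemma graded_eval_sum: "graded_eval \<delta> (sum f I) = (\<Sum>i\<in>I. graded_eval \<delta> (f i))"
  by (induction I rule: infinite_finite_induct) (auto simp: graded_eval_add)

lemma graded_eval_single:
  "graded_eval \<delta> (sgl m c) = sgl (\<delta> m) (scale c (monomial (yexp m)))"
  by (simp add: graded_eval_def)

lemma graded_eval_mult:
  assumes \<delta>: "\<And>m m'. \<delta> (m + m') = \<delta> m + \<delta> m'"
  shows "graded_eval \<delta> (p * q) = graded_eval \<delta> p * graded_eval \<delta> q"
proof -
  have "p * q = (\<Sum>m\<in>supp p. sgl m (lk p m)) *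
      (\<Sum>m\<in>supp q. sgl m (lk q m))"
    by (simp add: poly_mapping_sum_single)
  also have "\<dots> = (\<Sum>m\<in>supp p. \<Sum>m'\<in>supp q.
      sgl (m + m') (lk p m * lk q m'))"
    by (simp add: sum_product mult_single)
  also have "graded_eval \<delta> \<dots> = (\<Sum>m\<in>supp p. \<Sum>m'\<in>supp q.
      sgl (\<delta> m) (scale (lk p m) (monomial (yexp m))) *
      sgl (\<delta> m') (scale (lk q m') (monomial (yexp m'))))"
    by (simp add: graded_eval_sum graded_eval_single \<delta> mult_single yexp_add monomial_add
      scale_mult[symmetric] scale_mult_right[symmetric] mult.commute)
  finally show ?thesis by (simp add: graded_eval_def sum_product)
qed

lemma lookup_graded_eval:
  assumes "finite S" "supp p \<subseteq> S"
  shows "lk (graded_eval \<delta> p) g = (\<Sum>m | m \<in> S \<and> \<delta> m = g. scale (lk p m) (monomial (yexp m)))"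
proof -
  have "lk (graded_eval \<delta> p) g = (\<Sum>m\<in>S. if \<delta> m = g then scale (lk p m) (monomial (yexp m)) else 0)"
    unfolding graded_eval_superset[OF assms] by (auto simp: lookup_sum lookup_single when_def intro!: sum.cong)
  also have "\<dots> = (\<Sum>m | m \<in> S \<and> \<delta> m = g. scale (lk p m) (monomial (yexp m)))"
    using assms(1) by (subst sum.inter_filter[symmetric]) auto
  finally show ?thesis .
qed

lemma polys_iff: "p \<in> polys \<longleftrightarrow> (\<forall>m\<in>supp p. supp m \<subseteq> vars)"
  by (simp add: carrier_mpoly_ring)

lemma finite_vars: "finite vars" by (simp add: XY_vars_def)

lemma XY_monomial:
  assumes "supp m \<subseteq> vars"
  shows "(\<Prod>x\<in>supp m. XY_image n b D x ^ lk m x) = sgl (t_deg m) (monomial (yexp m))"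
proof -
  have "(\<Prod>x\<in>supp m. XY_image n b D x ^ lk m x) = (\<Prod>x\<in>vars. XY_image n b D x ^ lk m x)"
    by (rule prod.mono_neutral_left) (use assms finite_vars in \<open>auto simp: in_keys_iff\<close>)
  also have "\<dots> = (\<Prod>k<n. XY_image n b D (Inl k) ^ lk m (Inl k)) * (\<Prod>j<d. XY_image n b D (Inr j) ^ lk m (Inr j))"
    unfolding XY_vars_def by (subst prod.Plus) auto
  also have "\<dots> = sgl
      ((\<Sum>k<n. \<Sum>i<lk m (Inl k). sgl k (- 1)) +
       (\<Sum>j<d. \<Sum>i<lk m (Inr j). \<Sum>k<n. sgl k (D k j))) (monomial (yexp m))"
    by (simp add: XY_image_def power_single prod_single mult_single monomial_def yexp_def)
  also have "(\<Sum>k<n. \<Sum>i<lk m (Inl k). sgl k (- 1)) +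
       (\<Sum>j<d. \<Sum>i<lk m (Inr j). \<Sum>k<n. sgl k (D k j)) = t_deg m" (is "?l = _")
  proof (rule poly_mapping_eqI)
    fix k
    have "lk (\<Sum>k'<n. \<Sum>i<lk m (Inl k'). sgl k' (- 1 :: int)) k =
        (\<Sum>k'<n. if k' = k then - int (lk m (Inl k')) else 0)"
      unfolding lookup_sum[of "\<lambda>k'. \<Sum>i<lk m (Inl k'). sgl k' (- 1 :: int)"]
        lookup_sum[of "\<lambda>_. sgl _ (- 1 :: int)"]
      by (intro sum.cong) (auto simp: lookup_single when_def)
    also have "\<dots> = (if k < n then - int (lk m (Inl k)) else 0)" by simp
    finally have 1: "lk (\<Sum>k'<n. \<Sum>i<lk m (Inl k'). sgl k' (- 1 :: int)) k =
        (if k < n then - int (lk m (Inl k)) else 0)" .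
    have 2: "lk (\<Sum>j<d. \<Sum>i<lk m (Inr j). \<Sum>k<n. sgl k (D k j)) k =
        (if k < n then wt (D k) (yexp m) else 0)"
      unfolding lookup_sum[of "\<lambda>j. \<Sum>i<lk m (Inr j). \<Sum>k<n. sgl k (D k j)"]
        lookup_sum[of "\<lambda>i. \<Sum>k<n. sgl k (D k _)"]
      by (simp add: lookup_sum_single wt_def yexp_def mult.commute)
    show "lk ?l k = lk (t_deg m) k"
      unfolding lookup_add 1 2 lookup_t_deg by simp
  qed
  finally show ?thesis .
qed

lemma XY_eval_graded_eval: "p \<in> polys \<Longrightarrow> XY_eval n b D p = graded_eval t_deg p"
  unfolding XY_eval_def graded_eval_def
proof (rule sum.cong)
  fix m assume p: "p \<in> polys" and m: "m \<in> supp p"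
  then have "supp m \<subseteq> vars" by (simp add: polys_iff)
  then show "sgl 0 (scale (lk p m) 1) * (\<Prod>x\<in>supp m. XY_image n b D x ^ lk m x) =
      sgl (t_deg m) (scale (lk p m) (monomial (yexp m)))"
    by (simp add: XY_monomial mult_single scale_mult[symmetric])
qed simp

lemma relation_ideal_iff: "p \<in> relation_ideal n d b D \<longleftrightarrow> p \<in> polys \<and> graded_eval t_deg p = 0"
  unfolding relation_ideal_def using XY_eval_graded_eval by auto

lemma weight_lifted_row:
  assumes "supp m \<subseteq> vars" "i < n"
  shows "weight (lifted_row D i) m = of_int (wt (D i) (yexp m))"
proof -
  have "weight (lifted_row D i) m = (\<Sum>x\<in>vars. lifted_row D i x * of_nat (lk m x))"
    unfolding weight_def
    by (rule sum.mono_neutral_left) (use assms finite_vars in \<open>auto simp: in_keys_iff\<close>)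
  also have "\<dots> = (\<Sum>j<d. lifted_row D i (Inr j) * of_nat (lk m (Inr j)))"
    unfolding XY_vars_def by (subst sum.Plus) (auto simp: lifted_row_def)
  finally show ?thesis by (simp add: lifted_row_def wt_def yexp_def)
qed

text \<open>
  The part of \<open>t\<close>-degree \<open>r\<close> of the algebra generated by the \<open>t\<^sub>i\<^bsup>-1\<^esup>\<close> and the \<open>b\<^sub>j t\<^bsup>v(b\<^sub>j)\<^esup>\<close>.
\<close>

definition gen_sections :: "(nat \<Rightarrow> int) \<Rightarrow> 'a set" where
  "gen_sections r = mspan {\<alpha>. \<forall>k<n. r k \<le> wt (D k) \<alpha>}"

lemma subspace_gen_sections [simp]: "subspace (gen_sections r)" by (simp add: gen_sections_def)

lemma gen_sections_antimono: "(\<And>k. k < n \<Longrightarrow> r k \<le> s k) \<Longrightarrow> gen_sections s \<subseteq> gen_sections r"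
  unfolding gen_sections_def by (intro mspan_mono) (auto intro: order_trans)

lemma gen_sections_cong: "(\<And>k. k < n \<Longrightarrow> r k = s k) \<Longrightarrow> gen_sections r = gen_sections s"
  using gen_sections_antimono[of r s] gen_sections_antimono[of s r] by auto

lemma gen_sections_mult:
  assumes "f \<in> gen_sections r" "g \<in> gen_sections s" "\<And>k. k < n \<Longrightarrow> t k \<le> r k + s k"
  shows "f * g \<in> gen_sections t"
  using assms(1,2) unfolding gen_sections_def
proof (rule mspan_mult)
  fix \<alpha> \<beta> assume "\<alpha> \<in> {\<alpha>. \<forall>k<n. r k \<le> wt (D k) \<alpha>}" "\<beta> \<in> {\<alpha>. \<forall>k<n. s k \<le> wt (D k) \<alpha>}"
  then show "(\<lambda>j. \<alpha> j + \<beta> j) \<in> {\<alpha>. \<forall>k<n. t k \<le> wt (D k) \<alpha>}"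
    using assms(3) by (fastforce simp: wt_add)
qed

definition raise_at :: "nat \<Rightarrow> (nat \<Rightarrow> int) \<Rightarrow> nat \<Rightarrow> int" where
  "raise_at i r = r(i := r i + 1)"

text \<open>
  For bihomogeneous elements this is the primality of the ideal generated by \<open>t\<^sub>i\<^bsup>-1\<^esup>\<close> in the algebra generated by the
  \<open>t\<^sub>k\<^bsup>-1\<^esup>\<close> and the \<open>b\<^sub>j t\<^bsup>v(b\<^sub>j)\<^esup>\<close>.
\<close>

definition prime_section :: "nat \<Rightarrow> bool" where
  "prime_section i \<longleftrightarrow> (\<forall>r s f g. f \<in> gen_sections r \<longrightarrow> g \<in> gen_sections s \<longrightarrow> f * g \<in> gen_sections (raise_at i (\<lambda>k. r k + s k)) \<longrightarrow>
     f \<in> gen_sections (raise_at i r) \<or> g \<in> gen_sections (raise_at i s))"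

text \<open>
  A monomial of \<open>t\<close>-degree \<open>r\<close> with exponent \<open>e\<close> of \<open>X\<^sub>i\<close> becomes, after division by \<open>X\<^sub>i\<^sup>e\<close>, one whose \<open>t\<close>-degree has \<open>i\<close>-th
  coordinate \<open>r\<^sub>i + e\<close>.  So \<open>fine_base i g\<close> bounds the weights of all monomials of fine degree \<open>g\<close> from below.
\<close>

definition fine_base :: "nat \<Rightarrow> (nat \<Rightarrow>\<^sub>0 int) \<Rightarrow> nat \<Rightarrow> int" where
  "fine_base i g k = lk g k + (if k = i then lk g n else 0)"

lemma fine_base_add: "fine_base i (g + h) = (\<lambda>k. fine_base i g k + fine_base i h k)"
  by (auto simp: fun_eq_iff fine_base_def lookup_add)

text \<open>
  Explicit description of the initial ideal, see \<open>initial_ideal_eq\<close>.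
\<close>

definition section_ideal :: "nat \<Rightarrow> (nat + nat, 'k) mpoly set" where
  "section_ideal i = {p \<in> polys. \<forall>g. lk (graded_eval (fine_deg i) p) g \<in> gen_sections (raise_at i (fine_base i g))}"

lemma monomial_gen_sections_fine_deg: "monomial (yexp m) \<in> gen_sections (fine_base i (fine_deg i m))"
  unfolding gen_sections_def by (rule mspan_base) (auto simp: fine_base_def lookup_fine_deg)

lemma graded_eval_fine_deg_gen_sections: "lk (graded_eval (fine_deg i) p) g \<in> gen_sections (fine_base i g)"
  unfolding lookup_graded_eval[OF finite_keys subset_refl]
  by (intro subspace_sum subspace_scale subspace_gen_sections) (use monomial_gen_sections_fine_deg in auto)

lemma gen_sections_raise_at_mult:
  assumes "f \<in> gen_sections (raise_at i r)" "g \<in> gen_sections s"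
  shows "f * g \<in> gen_sections (raise_at i (\<lambda>k. r k + s k))"
  using assms by (rule gen_sections_mult) (simp add: raise_at_def)

lemma lookup_mult_gen_sections:
  assumes "\<And>g. lk F g \<in> gen_sections (raise_at i (fine_base i g))" "\<And>g. lk G g \<in> gen_sections (fine_base i g)"
  shows "lk (F * G) g \<in> gen_sections (raise_at i (fine_base i g))"
  unfolding lookup_mult_keys
proof (rule subspace_sum[OF subspace_gen_sections], rule subspace_sum[OF subspace_gen_sections])
  fix a c
  show "(if a + c = g then lk F a * lk G c else 0) \<in> gen_sections (raise_at i (fine_base i g))"
  proof (cases "a + c = g")
    case True
    have "lk F a * lk G c \<in> gen_sections (raise_at i (\<lambda>k. fine_base i a k + fine_base i c k))"
      by (rule gen_sections_raise_at_mult[OF assms])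
    then show ?thesis using True by (simp add: fine_base_add[symmetric])
  next
    case False then show ?thesis using subspace_0[OF subspace_gen_sections] by simp
  qed
qed

lemma ideal_section_ideal: "ideal (section_ideal i) (mpoly_ring vars)"
proof (rule ideal_subset_ringI[OF subring_carrier, folded mpoly_ring_subset])
  show "section_ideal i \<subseteq> polys" by (auto simp: section_ideal_def)
  show "0 \<in> section_ideal i"
    using subring_setD(2)[OF subring_carrier] subspace_0[OF subspace_gen_sections] by (simp add: section_ideal_def)
next
  fix p q assume p: "p \<in> section_ideal i" and q: "q \<in> section_ideal i"
  have "p + q \<in> polys" using p q by (intro subring_setD(4)[OF subring_carrier]) (auto simp: section_ideal_def)
  moreover have "lk (graded_eval (fine_deg i) (p + q)) g \<in> gen_sections (raise_at i (fine_base i g))" for g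
    unfolding graded_eval_add lookup_add
    by (rule subspace_add[OF subspace_gen_sections]) (use p q in \<open>auto simp: section_ideal_def\<close>)
  ultimately show "p + q \<in> section_ideal i" by (simp add: section_ideal_def)
next
  fix p q assume p: "p \<in> section_ideal i" and q: "q \<in> polys"
  have "q * p \<in> polys" using p q by (intro subring_setD(5)[OF subring_carrier]) (auto simp: section_ideal_def)
  moreover have "lk (graded_eval (fine_deg i) (p * q)) g \<in> gen_sections (raise_at i (fine_base i g))" for g
    unfolding graded_eval_mult[OF fine_deg_add]
    by (rule lookup_mult_gen_sections[OF _ graded_eval_fine_deg_gen_sections]) (use p in \<open>simp add: section_ideal_def\<close>)
  ultimately show "q * p \<in> section_ideal i" by (simp add: section_ideal_def mult.commute)
qed

lemma lookup_initial_form: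
  "lk (initial_form w p) m =
     (if m \<in> supp p \<and> (\<forall>m'\<in>supp p. weight w m \<le> weight w m') then lk p m else 0)"
proof -
  let ?S = "{m. m \<in> supp p \<and> (\<forall>m'\<in>supp p. weight w m \<le> weight w m')}"
  have "finite ?S" by (rule finite_subset[of _ "supp p"]) auto
  then show ?thesis
    unfolding initial_form_def by (simp add: lookup_sum lookup_single when_def)
qed

lemma keys_initial_form: "supp (initial_form w p) \<subseteq> supp p"
  by (auto simp: in_keys_iff lookup_initial_form split: if_splits)

text \<open>
  In a fixed \<open>t\<close>-degree the values of the terms of a relation add up to 0.  Hence the sum of those with the lowest power of
  \<open>X\<^sub>i\<close>, which are the terms of the initial form, is minus the sum of the others, and these have a higher power of \<open>X\<^sub>i\<close>.
\<close>

lemma initial_form_in_section_ideal: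
  assumes i: "i < n" and p: "p \<in> relation_ideal n d b D"
  shows "initial_form (lifted_row D i) p \<in> section_ideal i"
proof -
  let ?in = "initial_form (lifted_row D i) p"
  have pp: "p \<in> polys" "graded_eval t_deg p = 0" using p by (auto simp: relation_ideal_iff)
  have w: "weight (lifted_row D i) m = of_int (wt (D i) (yexp m))" if "m \<in> supp p" for m
    using that pp(1) i by (intro weight_lifted_row) (auto simp: polys_iff)
  have "?in \<in> polys" using keys_initial_form pp(1) by (fastforce simp: polys_iff)
  moreover have "lk (graded_eval (fine_deg i) ?in) g \<in> gen_sections (raise_at i (fine_base i g))" for g
  \<comment> \<open>Either the degree \<open>g\<close> contains no term of the initial form, or all terms of \<open>p\<close> in that degree belong to it.\<close>
  proof (cases "\<exists>m0\<in>supp p. fine_deg i m0 = g \<and> (\<forall>m\<in>supp p. wt (D i) (yexp m0) \<le> wt (D i) (yexp m))")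
    case False
    have "lk (graded_eval (fine_deg i) ?in) g = 0"
      unfolding lookup_graded_eval[OF finite_keys keys_initial_form]
    proof (rule sum.neutral, rule ballI)
      fix m assume "m \<in> {m. m \<in> supp p \<and> fine_deg i m = g}"
      then have "lk ?in m = 0" using False w by (auto simp: lookup_initial_form)
      then show "scale (lk ?in m) (monomial (yexp m)) = 0" by simp
    qed
    then show ?thesis using subspace_0[OF subspace_gen_sections] by simp
  next
    case True
    then obtain m0 where m0: "m0 \<in> supp p" "fine_deg i m0 = g"
      "\<And>m. m \<in> supp p \<Longrightarrow> wt (D i) (yexp m0) \<le> wt (D i) (yexp m)" by blast
    have split: "fine_deg i m = g \<longleftrightarrow> t_deg m = t_deg m0 \<and> lk m (Inl i) = lk m0 (Inl i)" for m
      using fine_deg_eq_iff[of i m m0] m0(2) by simp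
    have wti: "wt (D i) (yexp m) = wt (D i) (yexp m0) + int (lk m (Inl i)) - int (lk m0 (Inl i))"
      if "t_deg m = t_deg m0" for m
      using arg_cong[OF that, of "\<lambda>t. lk t i"] i by (simp add: lookup_t_deg)
    let ?t = "\<lambda>m. scale (lk p m) (monomial (yexp m))"
    let ?K = "{m. m \<in> supp p \<and> t_deg m = t_deg m0}"
    let ?A = "{m. m \<in> supp p \<and> fine_deg i m = g}"
    have finK: "finite ?K" by (rule finite_subset[of _ "supp p"]) auto
    have sub: "?A \<subseteq> ?K" using split by auto
    have "lk (graded_eval (fine_deg i) ?in) g = (\<Sum>m\<in>?A. ?t m)"
      unfolding lookup_graded_eval[OF finite_keys keys_initial_form]
    proof (rule sum.cong)
      fix m assume m: "m \<in> ?A"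
      then have "wt (D i) (yexp m) = wt (D i) (yexp m0)" using wti[of m] split[of m] by auto
      then have "lk ?in m = lk p m" using m m0(3) w by (auto simp: lookup_initial_form)
      then show "scale (lk ?in m) (monomial (yexp m)) = ?t m" by simp
    qed simp
    moreover have "(\<Sum>m\<in>?K. ?t m) = 0"
      using lookup_graded_eval[OF finite_keys subset_refl, of t_deg p "t_deg m0"] pp(2) by simp
    ultimately have "lk (graded_eval (fine_deg i) ?in) g = - (\<Sum>m\<in>?K - ?A. ?t m)"
      using sum.subset_diff[OF sub finK, of ?t] by (simp add: eq_neg_iff_add_eq_0 add.commute)
    also have "\<dots> \<in> gen_sections (raise_at i (fine_base i g))"
    proof (intro subspace_neg subspace_sum subspace_scale subspace_gen_sections)
      fix m assume m: "m \<in> ?K - ?A"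
      then have t: "t_deg m = t_deg m0" and ne: "lk m (Inl i) \<noteq> lk m0 (Inl i)" using split by auto
      have "int (lk m0 (Inl i)) \<le> int (lk m (Inl i))" using wti[OF t] m0(3)[of m] m by simp
      then have gt: "lk m0 (Inl i) + 1 \<le> lk m (Inl i)" using ne by simp
      have "raise_at i (fine_base i g) k \<le> wt (D k) (yexp m)" if k: "k < n" for k
      proof -
        have "lk (t_deg m) k = lk (t_deg m0) k" using t by simp
        then have "wt (D k) (yexp m) = lk g k + int (lk m (Inl k))"
          using k m0(2) by (auto simp: lookup_t_deg lookup_fine_deg)
        moreover have "lk g n = int (lk m0 (Inl i))" using m0(2) by (auto simp: lookup_fine_deg)
        ultimately show ?thesis using gt by (auto simp: raise_at_def fine_base_def)
      qed
      then show "monomial (yexp m) \<in> gen_sections (raise_at i (fine_base i g))"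
        unfolding gen_sections_def by (intro mspan_base) simp
    qed
    finally show ?thesis .
  qed
  ultimately show ?thesis by (simp add: section_ideal_def)
qed

text \<open>
  A monomial of sufficient weight is lifted to a polynomial of prescribed \<open>t\<close>-degree by multiplying it with powers of the
  \<open>X\<^sub>k\<close>; the exponents of these are forced to be the excess of the weights over the degree.
\<close>

lemma lift_to_polynomial:
  assumes f: "f \<in> mspan M" and M: "\<And>\<alpha> k. \<alpha> \<in> M \<Longrightarrow> k < n \<Longrightarrow> lk r k \<le> wt (D k) \<alpha>"
    and r: "supp r \<subseteq> {..<n}"
  shows "\<exists>s\<in>polys. graded_eval t_deg s = sgl r f \<and>
     (\<forall>m\<in>supp s. t_deg m = r \<and> (\<exists>\<alpha>\<in>M. \<forall>k<n. int (lk m (Inl k)) = wt (D k) \<alpha> - lk r k))"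
  using f unfolding mspan_def
proof (induction rule: span_induct_alt)
  case base
  show ?case using subring_setD(2)[OF subring_carrier] by (intro bexI[of _ 0]) auto
next
  case (step c x y)
  then obtain s where s: "s \<in> polys" "graded_eval t_deg s = sgl r y"
    "\<And>m. m \<in> supp s \<Longrightarrow> t_deg m = r \<and> (\<exists>\<alpha>\<in>M. \<forall>k<n. int (lk m (Inl k)) = wt (D k) \<alpha> - lk r k)"
    by blast
  obtain \<alpha> where \<alpha>: "\<alpha> \<in> M" "x = monomial \<alpha>" using step by auto
  define \<mu> where "\<mu> = (\<Sum>j<d. sgl (Inr j :: nat + nat) (\<alpha> j)) +
      (\<Sum>k<n. sgl (Inl k) (nat (wt (D k) \<alpha> - lk r k)))"
  have \<mu>r: "lk \<mu> (Inr j) = (if j < d then \<alpha> j else 0)" for j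
    by (simp add: \<mu>_def lookup_add lookup_sum lookup_single when_def)
  have \<mu>l: "lk \<mu> (Inl k) = (if k < n then nat (wt (D k) \<alpha> - lk r k) else 0)" for k
    by (simp add: \<mu>_def lookup_add lookup_sum lookup_single when_def)
  have y\<mu>: "monomial (yexp \<mu>) = monomial \<alpha>" "wt w (yexp \<mu>) = wt w \<alpha>" for w
    unfolding monomial_def wt_def yexp_def by (auto simp: \<mu>r intro!: prod.cong sum.cong)
  have int\<mu>: "int (lk \<mu> (Inl k)) = wt (D k) \<alpha> - lk r k" if "k < n" for k
    using M[OF \<alpha>(1) that] that by (simp add: \<mu>l)
  have t\<mu>: "t_deg \<mu> = r"
  proof (rule poly_mapping_eqI)
    fix k
    show "lk (t_deg \<mu>) k = lk r k"
      using int\<mu>[of k] r by (auto simp: lookup_t_deg y\<mu> in_keys_iff)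
  qed
  have "supp \<mu> \<subseteq> vars"
  proof
    fix x assume "x \<in> supp \<mu>"
    then show "x \<in> vars"
      by (cases x) (auto simp: XY_vars_def in_keys_iff \<mu>r \<mu>l split: if_splits)
  qed
  then have "sgl \<mu> c \<in> polys" by (auto simp: polys_iff)
  then have "sgl \<mu> c + s \<in> polys" using s(1) subring_setD(4)[OF subring_carrier] by blast
  moreover have "graded_eval t_deg (sgl \<mu> c + s) = sgl r (scale c x + y)"
    by (simp add: graded_eval_add graded_eval_single t\<mu> y\<mu> s(2) \<alpha>(2) single_add)
  moreover have "t_deg m = r \<and> (\<exists>\<alpha>\<in>M. \<forall>k<n. int (lk m (Inl k)) = wt (D k) \<alpha> - lk r k)"
    if "m \<in> supp (sgl \<mu> c + s)" for m
  proof -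
    have "m = \<mu> \<or> m \<in> supp s"
      using that Poly_Mapping.keys_add[of "sgl \<mu> c" s] by (auto split: if_splits)
    then show ?thesis using s(3) t\<mu> int\<mu> \<alpha>(1) by blast
  qed
  ultimately show ?case by blast
qed

lemma keys_t_deg: "supp (t_deg m) \<subseteq> {..<n}"
  by (auto simp: in_keys_iff lookup_t_deg split: if_splits)

text \<open>
  A bihomogeneous piece whose value lies one step deeper agrees in value with a polynomial \<open>s\<close> of the same \<open>t\<close>-degree all
  of whose terms have a higher power of \<open>X\<^sub>i\<close>.  The piece is then the initial form of the relation \<open>part g - s\<close>.
\<close>

lemma section_ideal_subset:
  assumes i: "i < n" and J: "ideal J (mpoly_ring vars)" "initial_form (lifted_row D i) ` relation_ideal n d b D \<subseteq> J"
  shows "section_ideal i \<subseteq> J"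
proof
  fix p assume p: "p \<in> section_ideal i"
  have J': "ideal J (subset_ring polys)" using J(1) mpoly_ring_subset by metis
  have pp: "p \<in> polys" using p by (simp add: section_ideal_def)
  define part where "part g = (\<Sum>m | m \<in> supp p \<and> fine_deg i m = g. sgl m (lk p m))" for g
  have lkpart: "lk (part g) m = (if fine_deg i m = g then lk p m else 0)" for g m
  proof -
    have "finite {m. m \<in> supp p \<and> fine_deg i m = g}"
      by (rule finite_subset[of _ "supp p"]) auto
    then show ?thesis by (auto simp: part_def lookup_sum lookup_single when_def in_keys_iff)
  qed
  have "p = (\<Sum>m\<in>supp p. sgl m (lk p m))" by (simp add: poly_mapping_sum_single)
  also have "\<dots> = (\<Sum>g\<in>fine_deg i ` supp p. part g)"
    unfolding part_def by (rule sum.image_gen) simp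
  also have "\<dots> \<in> J"
  proof (rule ideal_subset_ring_sum[OF J' subring_carrier])
    fix g assume "g \<in> fine_deg i ` supp p"
    then obtain m0 where m0: "m0 \<in> supp p" "fine_deg i m0 = g" by auto
    have kp: "supp (part g) = {m. m \<in> supp p \<and> fine_deg i m = g}"
      by (auto simp: in_keys_iff lkpart split: if_splits)
    have td: "t_deg m = t_deg m0" "lk m (Inl i) = lk m0 (Inl i)" if "m \<in> supp (part g)" for m
      using that kp m0 fine_deg_eq_iff[of i m m0] by auto
    define f where "f = lk (graded_eval (fine_deg i) p) g"
    have part_polys: "part g \<in> polys" using pp kp by (auto simp: polys_iff)
    have rp: "graded_eval t_deg (part g) = sgl (t_deg m0) f"
    proof -
      have "graded_eval t_deg (part g) = (\<Sum>m\<in>supp (part g).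
          sgl (t_deg m0) (scale (lk p m) (monomial (yexp m))))"
        unfolding graded_eval_def by (rule sum.cong) (use td kp in \<open>auto simp: lkpart\<close>)
      also have "\<dots> = sgl (t_deg m0) (\<Sum>m\<in>supp (part g). scale (lk p m) (monomial (yexp m)))"
        by (rule poly_mapping_eqI) (simp add: lookup_sum lookup_single when_def)
      finally show ?thesis unfolding f_def kp lookup_graded_eval[OF finite_keys subset_refl] .
    qed
    have "f \<in> gen_sections (raise_at i (fine_base i g))" using p by (simp add: section_ideal_def f_def)
    then have fM: "f \<in> mspan {\<alpha>. \<forall>k<n. raise_at i (fine_base i g) k \<le> wt (D k) \<alpha>}" by (simp add: gen_sections_def)
    have gk: "lk g k = lk (t_deg m0) k" if "k < n" for k
      using m0(2) that by (auto simp: lookup_t_deg lookup_fine_deg)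
    have gn: "lk g n = int (lk m0 (Inl i))" using m0(2) by (auto simp: lookup_fine_deg)
    have sh: "lk (t_deg m0) k + (if k = i then int (lk m0 (Inl i)) + 1 else 0) = raise_at i (fine_base i g) k" if "k < n" for k
      using gk[OF that] gn by (auto simp: raise_at_def fine_base_def)
    have le: "lk (t_deg m0) k \<le> wt (D k) \<alpha>" if "\<alpha> \<in> {\<alpha>. \<forall>k<n. raise_at i (fine_base i g) k \<le> wt (D k) \<alpha>}" "k < n" for \<alpha> k
    proof -
      have "raise_at i (fine_base i g) k \<le> wt (D k) \<alpha>" using that by simp
      then show ?thesis using sh[OF that(2)] by (cases "k = i") auto
    qed
    have "\<exists>s\<in>polys. graded_eval t_deg s = sgl (t_deg m0) f \<and>
      (\<forall>m\<in>supp s. t_deg m = t_deg m0 \<and>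
        (\<exists>\<alpha>\<in>{\<alpha>. \<forall>k<n. raise_at i (fine_base i g) k \<le> wt (D k) \<alpha>}.
          \<forall>k<n. int (lk m (Inl k)) = wt (D k) \<alpha> - lk (t_deg m0) k))"
      by (rule lift_to_polynomial[OF fM le keys_t_deg])
    then obtain s where s: "s \<in> polys" "graded_eval t_deg s = sgl (t_deg m0) f"
      and s3: "\<forall>m\<in>supp s. t_deg m = t_deg m0 \<and>
        (\<exists>\<alpha>\<in>{\<alpha>. \<forall>k<n. raise_at i (fine_base i g) k \<le> wt (D k) \<alpha>}.
          \<forall>k<n. int (lk m (Inl k)) = wt (D k) \<alpha> - lk (t_deg m0) k)"
      by (elim bexE conjE)
    have s_gt: "lk m0 (Inl i) < lk m (Inl i)" if m: "m \<in> supp s" for m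
    proof -
      obtain \<alpha> where "\<alpha> \<in> {\<alpha>. \<forall>k<n. raise_at i (fine_base i g) k \<le> wt (D k) \<alpha>}"
        "\<forall>k<n. int (lk m (Inl k)) = wt (D k) \<alpha> - lk (t_deg m0) k"
        using bspec[OF s3 m] by (elim conjE bexE)
      then have "raise_at i (fine_base i g) i \<le> wt (D i) \<alpha>"
        "int (lk m (Inl i)) = wt (D i) \<alpha> - lk (t_deg m0) i" using i by auto
      then show ?thesis using sh[OF i] by simp
    qed
    have s_deg: "t_deg m = t_deg m0" if "m \<in> supp s" for m
      using bspec[OF s3 that] by (rule conjunct1)
    define P where "P = part g - s"
    have P_rel: "P \<in> relation_ideal n d b D"
      using subring_setD(6)[OF subring_carrier part_polys s(1)] rp s(2)
      by (simp add: relation_ideal_iff P_def graded_eval_diff)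
    then have P_polys: "P \<in> polys" by (simp add: relation_ideal_iff)
    have disj: "m \<notin> supp s" if "m \<in> supp (part g)" for m
      using td(2)[OF that] s_gt[of m] by auto
    have wtdeg: "wt (D i) (yexp m) = lk (t_deg m0) i + int (lk m (Inl i))" if "t_deg m = t_deg m0" for m
      using arg_cong[OF that, of "\<lambda>t. lk t i"] i by (simp add: lookup_t_deg)
    have keysP: "supp P = supp (part g) \<union> supp s"
    proof (rule Set.set_eqI)
      fix m show "m \<in> supp P \<longleftrightarrow> m \<in> supp (part g) \<union> supp s"
        using disj[of m] by (auto simp: P_def in_keys_iff lookup_minus)
    qed
    have wP: "weight (lifted_row D i) m = of_int (wt (D i) (yexp m))" if "m \<in> supp P" for m
      using that P_polys i by (intro weight_lifted_row) (auto simp: polys_iff)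
    have wpart: "wt (D i) (yexp m) = lk (t_deg m0) i + int (lk m0 (Inl i))" if "m \<in> supp (part g)" for m
      using wtdeg[OF td(1)[OF that]] td(2)[OF that] by simp
    have ws: "wt (D i) (yexp m) > lk (t_deg m0) i + int (lk m0 (Inl i))" if "m \<in> supp s" for m
      using wtdeg[OF s_deg[OF that]] s_gt[OF that] by simp
    have m0p: "m0 \<in> supp (part g)" using m0 kp by simp
    have "initial_form (lifted_row D i) P = part g"
    proof (rule poly_mapping_eqI)
      fix m
      consider "m \<in> supp (part g)" | "m \<in> supp s" | "m \<notin> supp P"
        using keysP by auto
      then show "lk (initial_form (lifted_row D i) P) m = lk (part g) m"
      proof cases
        case 1
        have "weight (lifted_row D i) m \<le> weight (lifted_row D i) m'" if "m' \<in> supp P" for m'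
          using that 1 keysP wP[of m] wP[of m'] wpart[OF 1] wpart[of m'] ws[of m'] by auto
        moreover have "lk P m = lk (part g) m" using disj[OF 1] by (simp add: P_def lookup_minus in_keys_iff)
        ultimately show ?thesis using 1 keysP by (simp add: lookup_initial_form)
      next
        case 2
        have "\<not> weight (lifted_row D i) m \<le> weight (lifted_row D i) m0"
          using 2 keysP m0p wP[of m] wP[of m0] wpart[OF m0p] ws[OF 2] by simp
        then have "lk (initial_form (lifted_row D i) P) m = 0" using m0p keysP by (auto simp: lookup_initial_form)
        moreover have "lk (part g) m = 0" using 2 disj by (auto simp: in_keys_iff)
        ultimately show ?thesis by simp
      next
        case 3 then show ?thesis using keysP by (auto simp: lookup_initial_form in_keys_iff)
      qed
    qed
    then show "part g \<in> J" using P_rel J(2) by (metis image_subset_iff)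
  qed
  finally show "p \<in> J" .
qed

theorem initial_ideal_eq:
  assumes "i < n"
  shows "initial_ideal vars (lifted_row D i) (relation_ideal n d b D) = section_ideal i"
proof
  show "initial_ideal vars (lifted_row D i) (relation_ideal n d b D) \<subseteq> section_ideal i"
    unfolding initial_ideal_def genideal_def
    using ideal_section_ideal initial_form_in_section_ideal[OF assms] by blast
  show "section_ideal i \<subseteq> initial_ideal vars (lifted_row D i) (relation_ideal n d b D)"
    unfolding initial_ideal_def genideal_def using section_ideal_subset[OF assms] by blast
qed

section \<open>Primality and saturation\<close>

definition ray_exponent :: "(nat \<Rightarrow> int) \<Rightarrow> nat \<Rightarrow>\<^sub>0 int" where
  "ray_exponent r = (\<Sum>k<n. sgl k (r k))"

lemma lookup_ray_exponent: "lk (ray_exponent r) k = (if k < n then r k else 0)"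
  by (simp add: ray_exponent_def lookup_sum_single)

lemma keys_ray_exponent: "supp (ray_exponent r) \<subseteq> {..<n}"
  by (auto simp: in_keys_iff lookup_ray_exponent split: if_splits)

lemma ray_exponent_add: "ray_exponent r + ray_exponent s = ray_exponent (\<lambda>k. r k + s k)"
  by (rule poly_mapping_eqI) (simp add: lookup_add lookup_ray_exponent)

lemma gen_sections_raise_at_ray_exponent: "gen_sections (raise_at i (fine_base i (ray_exponent r))) = gen_sections (raise_at i r)"
  by (rule gen_sections_cong) (simp add: raise_at_def fine_base_def lookup_ray_exponent)

lemma section_ideal_single_iff:
  assumes "p \<in> polys" "graded_eval (fine_deg i) p = sgl (ray_exponent r) f"
  shows "p \<in> section_ideal i \<longleftrightarrow> f \<in> gen_sections (raise_at i r)"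
proof
  assume "p \<in> section_ideal i"
  then have "lk (graded_eval (fine_deg i) p) (ray_exponent r) \<in> gen_sections (raise_at i (fine_base i (ray_exponent r)))"
    unfolding section_ideal_def by blast
  then show "f \<in> gen_sections (raise_at i r)" unfolding assms(2) gen_sections_raise_at_ray_exponent by simp
next
  assume f: "f \<in> gen_sections (raise_at i r)"
  have "lk (graded_eval (fine_deg i) p) g \<in> gen_sections (raise_at i (fine_base i g))" for g
  proof (cases "g = ray_exponent r")
    case True then show ?thesis using f unfolding assms(2) by (simp add: gen_sections_raise_at_ray_exponent)
  next
    case False
    then show ?thesis unfolding assms(2) using subspace_0[OF subspace_gen_sections] by (simp add: lookup_single_not_eq)
  qed
  then show "p \<in> section_ideal i" using assms(1) by (simp add: section_ideal_def)
qed

text \<open>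
  Only the monomials of exact weight in the \<open>i\<close>-th direction matter modulo \<open>gen_sections (raise_at i r)\<close>.  Their lift
  involves no \<open>X\<^sub>i\<close> and hence is concentrated in a single fine degree.
\<close>

lemma gen_sections_split:
  assumes "i < n" "f \<in> gen_sections r"
  obtains f1 f2 p where "f = f1 + f2" "f1 \<in> gen_sections r" "f2 \<in> gen_sections (raise_at i r)"
    "p \<in> polys" "graded_eval (fine_deg i) p = sgl (ray_exponent r) f1"
proof -
  let ?M = "{\<alpha>. (\<forall>k<n. r k \<le> wt (D k) \<alpha>) \<and> wt (D i) \<alpha> = r i}"
  have "gen_sections r \<subseteq> mspan (?M \<union> {\<alpha>. \<forall>k<n. raise_at i r k \<le> wt (D k) \<alpha>})"
    unfolding gen_sections_def
  proof (intro mspan_mono subsetI)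
    fix \<alpha> assume \<alpha>: "\<alpha> \<in> {\<alpha>. \<forall>k<n. r k \<le> wt (D k) \<alpha>}"
    show "\<alpha> \<in> ?M \<union> {\<alpha>. \<forall>k<n. raise_at i r k \<le> wt (D k) \<alpha>}"
    proof (cases "wt (D i) \<alpha> = r i")
      case True then show ?thesis using \<alpha> by simp
    next
      case False
      then have "r i + 1 \<le> wt (D i) \<alpha>" using \<alpha> assms(1) by force
      then show ?thesis using \<alpha> by (simp add: raise_at_def)
    qed
  qed
  then have "f \<in> {f + g | f g. f \<in> mspan ?M \<and> g \<in> mspan {\<alpha>. \<forall>k<n. raise_at i r k \<le> wt (D k) \<alpha>}}"
    using assms(2) mspan_Un by blast
  then obtain f1 f2 where f: "f = f1 + f2" "f1 \<in> mspan ?M" "f2 \<in> gen_sections (raise_at i r)"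
    unfolding gen_sections_def by blast
  have "\<exists>p\<in>polys. graded_eval t_deg p = sgl (ray_exponent r) f1 \<and>
     (\<forall>m\<in>supp p. t_deg m = ray_exponent r \<and>
        (\<exists>\<alpha>\<in>?M. \<forall>k<n. int (lk m (Inl k)) = wt (D k) \<alpha> - lk (ray_exponent r) k))"
    by (rule lift_to_polynomial[OF f(2) _ keys_ray_exponent]) (simp add: lookup_ray_exponent)
  then obtain p where p: "p \<in> polys" "graded_eval t_deg p = sgl (ray_exponent r) f1"
    "\<forall>m\<in>supp p. t_deg m = ray_exponent r \<and>
        (\<exists>\<alpha>\<in>?M. \<forall>k<n. int (lk m (Inl k)) = wt (D k) \<alpha> - lk (ray_exponent r) k)"
    by (elim bexE conjE)
  have "fine_deg i m = t_deg m" if m: "m \<in> supp p" for m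
  proof -
    obtain \<alpha> where \<alpha>: "\<alpha> \<in> ?M" "\<forall>k<n. int (lk m (Inl k)) = wt (D k) \<alpha> - lk (ray_exponent r) k"
      using bspec[OF p(3) m] by (elim bexE conjE)
    then have "int (lk m (Inl i)) = 0" using assms(1) by (auto simp: lookup_ray_exponent)
    then have "lk m (Inl i) = 0" by simp
    then show ?thesis by (simp add: fine_deg_def)
  qed
  then have "graded_eval (fine_deg i) p = graded_eval t_deg p" unfolding graded_eval_def by (intro sum.cong) auto
  then have r: "graded_eval (fine_deg i) p = sgl (ray_exponent r) f1" using p(2) by simp
  have "f1 \<in> gen_sections r" using f(2) mspan_mono[of ?M "{\<alpha>. \<forall>k<n. r k \<le> wt (D k) \<alpha>}"] unfolding gen_sections_def by auto
  then show ?thesis using that f(1,3) p(1) r by blast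
qed

lemma prime_section_imp_primeideal:
  assumes one: "1 \<notin> gen_sections (raise_at i (\<lambda>_. 0))" and ps: "prime_section i"
  shows "primeideal (section_ideal i) (mpoly_ring vars)"
proof (rule primeidealI[OF ideal_section_ideal])
  show "cring (mpoly_ring vars)" using cring_subset_ring[OF subring_carrier] mpoly_ring_subset by metis
  have "graded_eval (fine_deg i) 1 = sgl 0 1"
    using graded_eval_single[of "fine_deg i" 0 1]
    by (simp add: fine_deg_def t_deg_def yexp_def wt_def monomial_def)
  moreover have "ray_exponent (\<lambda>_. 0) = 0" by (rule poly_mapping_eqI) (simp add: lookup_ray_exponent)
  moreover have one_polys: "1 \<in> polys" by (rule subring_setD(1)[OF subring_carrier])
  ultimately have "1 \<notin> section_ideal i"
    using section_ideal_single_iff[OF one_polys, of i "\<lambda>_. 0" 1] one by simp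
  then show "polys \<noteq> section_ideal i" using one_polys by blast
  fix p q assume p: "p \<in> polys" and q: "q \<in> polys" and pq: "p \<otimes>\<^bsub>mpoly_ring vars\<^esub> q \<in> section_ideal i"
  have "(\<forall>g. lk (graded_eval (fine_deg i) p) g \<in> gen_sections (raise_at i (fine_base i g))) \<or>
        (\<forall>g. lk (graded_eval (fine_deg i) q) g \<in> gen_sections (raise_at i (fine_base i g)))"
  proof (rule graded_prime[where \<Phi> = "\<lambda>g. gen_sections (fine_base i g)"])
    show "0 \<in> gen_sections (raise_at i (fine_base i g))" for g by (rule subspace_0[OF subspace_gen_sections])
    show "x + y \<in> gen_sections (raise_at i (fine_base i g))"
      if "x \<in> gen_sections (raise_at i (fine_base i g))" "y \<in> gen_sections (raise_at i (fine_base i g))" for x y g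
      using that by (rule subspace_add[OF subspace_gen_sections])
    show "- x \<in> gen_sections (raise_at i (fine_base i g))" if "x \<in> gen_sections (raise_at i (fine_base i g))" for x g
      using that by (rule subspace_neg[OF subspace_gen_sections])
    show "x * y \<in> gen_sections (raise_at i (fine_base i (g + h)))"
      if "x \<in> gen_sections (raise_at i (fine_base i g))" "y \<in> gen_sections (fine_base i h)" for x y g h
      using gen_sections_raise_at_mult[OF that] by (simp add: fine_base_add)
    show "x \<in> gen_sections (raise_at i (fine_base i g)) \<or> y \<in> gen_sections (raise_at i (fine_base i h))"
      if "x \<in> gen_sections (fine_base i g)" "y \<in> gen_sections (fine_base i h)" "x * y \<in> gen_sections (raise_at i (fine_base i (g + h)))" for x y g h
      using ps that unfolding prime_section_def fine_base_add by blast
    show "lk (graded_eval (fine_deg i) p) g \<in> gen_sections (fine_base i g)" "lk (graded_eval (fine_deg i) q) g \<in> gen_sections (fine_base i g)" for g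
      by (rule graded_eval_fine_deg_gen_sections)+
    show "lk (graded_eval (fine_deg i) p * graded_eval (fine_deg i) q) g \<in> gen_sections (raise_at i (fine_base i g))" for g
    proof -
      have "p * q \<in> section_ideal i" using pq by (simp add: mpoly_ring_def)
      then show ?thesis unfolding graded_eval_mult[OF fine_deg_add, symmetric] by (simp add: section_ideal_def)
    qed
  qed
  then show "p \<in> section_ideal i \<or> q \<in> section_ideal i" using p q by (auto simp: section_ideal_def)
qed

lemma primeideal_imp_prime_section:
  assumes i: "i < n" and pr: "primeideal (section_ideal i) (mpoly_ring vars)"
  shows "prime_section i"
  unfolding prime_section_def
proof (intro allI impI)
  fix r s f g
  assume f: "f \<in> gen_sections r" and g: "g \<in> gen_sections s" and fg: "f * g \<in> gen_sections (raise_at i (\<lambda>k. r k + s k))"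
  obtain f1 f2 p where p: "f = f1 + f2" "f1 \<in> gen_sections r" "f2 \<in> gen_sections (raise_at i r)"
    "p \<in> polys" "graded_eval (fine_deg i) p = sgl (ray_exponent r) f1" by (rule gen_sections_split[OF i f])
  obtain g1 g2 q where q: "g = g1 + g2" "g1 \<in> gen_sections s" "g2 \<in> gen_sections (raise_at i s)"
    "q \<in> polys" "graded_eval (fine_deg i) q = sgl (ray_exponent s) g1" by (rule gen_sections_split[OF i g])
  have "g2 * f1 \<in> gen_sections (raise_at i (\<lambda>k. s k + r k))" by (rule gen_sections_raise_at_mult[OF q(3) p(2)])
  then have 1: "f1 * g2 \<in> gen_sections (raise_at i (\<lambda>k. r k + s k))" by (simp add: ac_simps)
  have 2: "f2 * g \<in> gen_sections (raise_at i (\<lambda>k. r k + s k))" by (rule gen_sections_raise_at_mult[OF p(3) g])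
  have "f1 * g1 = f * g - f2 * g - f1 * g2" by (simp add: p(1) q(1) algebra_simps)
  also have "\<dots> \<in> gen_sections (raise_at i (\<lambda>k. r k + s k))"
    by (rule subspace_diff[OF subspace_gen_sections subspace_diff[OF subspace_gen_sections fg 2] 1])
  finally have fg1: "f1 * g1 \<in> gen_sections (raise_at i (\<lambda>k. r k + s k))" .
  have pq: "p * q \<in> polys" by (rule subring_setD(5)[OF subring_carrier p(4) q(4)])
  have "graded_eval (fine_deg i) (p * q) = sgl (ray_exponent (\<lambda>k. r k + s k)) (f1 * g1)"
    unfolding graded_eval_mult[OF fine_deg_add] p(5) q(5) mult_single ray_exponent_add ..
  then have "p * q \<in> section_ideal i" using section_ideal_single_iff[OF pq] fg1 by blast
  then have "p \<in> section_ideal i \<or> q \<in> section_ideal i"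
    using primeideal.I_prime[OF pr p(4) q(4)] by (simp add: mpoly_ring_def)
  then have "f1 \<in> gen_sections (raise_at i r) \<or> g1 \<in> gen_sections (raise_at i s)"
    using section_ideal_single_iff[OF p(4,5)] section_ideal_single_iff[OF q(4,5)] by blast
  then show "f \<in> gen_sections (raise_at i r) \<or> g \<in> gen_sections (raise_at i s)"
    unfolding p(1) q(1) using subspace_add[OF subspace_gen_sections] p(3) q(3) by blast
qed

lemma gen_sections_subset_weight_filtration: "i < n \<Longrightarrow> gen_sections r \<subseteq> weight_filtration (D i) (r i)"
  unfolding gen_sections_def weight_filtration_def by (rule mspan_mono) auto

text \<open>
  In directions in which nothing is known about the weights it suffices that the degree is very negative, as \<open>f\<close> involves
  only finitely many monomials.
\<close>

lemma mspan_bounded_gen_sections: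
  assumes "f \<in> mspan M"
  shows "\<exists>K. \<forall>r. (\<forall>\<alpha>\<in>M. \<forall>k<n. r k \<le> wt (D k) \<alpha> \<or> r k \<le> K) \<longrightarrow> f \<in> gen_sections r"
  using assms unfolding mspan_def
proof (induction rule: span_induct_alt)
  case base then show ?case using subspace_0[OF subspace_gen_sections] by blast
next
  case (step c x y)
  then obtain K where K: "\<And>r. \<forall>\<alpha>\<in>M. \<forall>k<n. r k \<le> wt (D k) \<alpha> \<or> r k \<le> K \<Longrightarrow> y \<in> gen_sections r" by blast
  obtain \<alpha> where \<alpha>: "\<alpha> \<in> M" "x = monomial \<alpha>" using step by auto
  define K' where "K' = Min (insert K ((\<lambda>k. wt (D k) \<alpha>) ` {..<n}))"
  have K': "K' \<le> K" "\<And>k. k < n \<Longrightarrow> K' \<le> wt (D k) \<alpha>" by (auto simp: K'_def)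
  have "scale c x + y \<in> gen_sections r" if r: "\<forall>\<alpha>\<in>M. \<forall>k<n. r k \<le> wt (D k) \<alpha> \<or> r k \<le> K'" for r
  proof -
    have "r k \<le> wt (D k) \<alpha>" if "k < n" for k using r \<alpha>(1) that K'(2)[OF that] by force
    then have "monomial \<alpha> \<in> gen_sections r" unfolding gen_sections_def by (intro mspan_base) simp
    moreover have "y \<in> gen_sections r" by (rule K) (use r K'(1) in force)
    ultimately show ?thesis using \<alpha>(2) subspace_add[OF subspace_gen_sections] subspace_scale[OF subspace_gen_sections] by blast
  qed
  then show ?case by blast
qed

lemma weight_filtration_gen_sections:
  assumes "f \<in> weight_filtration (D i) p"
  obtains K where "\<And>r. r i \<le> p \<Longrightarrow> (\<And>k. k < n \<Longrightarrow> k \<noteq> i \<Longrightarrow> r k \<le> K) \<Longrightarrow> f \<in> gen_sections r"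
proof -
  obtain K where K: "\<And>r. (\<forall>\<alpha>\<in>{\<alpha>. p \<le> wt (D i) \<alpha>}. \<forall>k<n. r k \<le> wt (D k) \<alpha> \<or> r k \<le> K) \<Longrightarrow> f \<in> gen_sections r"
    using mspan_bounded_gen_sections[OF assms[unfolded weight_filtration_def]] by blast
  show ?thesis
  proof (rule that[of K], rule K, intro ballI allI impI)
    fix r \<alpha> k assume r: "r i \<le> p" "\<And>k. k < n \<Longrightarrow> k \<noteq> i \<Longrightarrow> r k \<le> K"
      and \<alpha>: "\<alpha> \<in> {\<alpha>. p \<le> wt (D i) \<alpha>}" and k: "k < n"
    show "r k \<le> wt (D k) \<alpha> \<or> r k \<le> K"
      using r \<alpha> k by (cases "k = i") auto
  qed
qed

text \<open>
  Primality in the \<open>i\<close>-th direction passes from the family of all degrees \<open>r\<close> to the single weight \<open>D i\<close>: choose the degree in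
  the other directions very negative.
\<close>

lemma weight_filtration_prime:
  assumes ps: "prime_section i" and i: "i < n"
    and f: "f \<in> weight_filtration (D i) p" and g: "g \<in> weight_filtration (D i) q"
    and fg: "f * g \<in> weight_filtration (D i) (p + q + 1)"
  shows "f \<in> weight_filtration (D i) (p + 1) \<or> g \<in> weight_filtration (D i) (q + 1)"
proof -
  obtain K1 where K1: "\<And>r. r i \<le> p \<Longrightarrow> (\<And>k. k < n \<Longrightarrow> k \<noteq> i \<Longrightarrow> r k \<le> K1) \<Longrightarrow> f \<in> gen_sections r"
    using weight_filtration_gen_sections[OF f] by blast
  obtain K2 where K2: "\<And>r. r i \<le> q \<Longrightarrow> (\<And>k. k < n \<Longrightarrow> k \<noteq> i \<Longrightarrow> r k \<le> K2) \<Longrightarrow> g \<in> gen_sections r"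
    using weight_filtration_gen_sections[OF g] by blast
  obtain K3 where K3: "\<And>r. r i \<le> p + q + 1 \<Longrightarrow> (\<And>k. k < n \<Longrightarrow> k \<noteq> i \<Longrightarrow> r k \<le> K3) \<Longrightarrow> f * g \<in> gen_sections r"
    using weight_filtration_gen_sections[OF fg] by blast
  \<comment> \<open>Small enough for both factors, and such that twice \<open>L\<close> is small enough for the product.\<close>
  define L where "L = min (min K1 K2) (- \<bar>K3\<bar>)"
  define r where "r = (\<lambda>k. if k = i then p else L)"
  define s where "s = (\<lambda>k. if k = i then q else L)"
  have "f \<in> gen_sections r" by (rule K1) (auto simp: r_def L_def)
  moreover have "g \<in> gen_sections s" by (rule K2) (auto simp: s_def L_def)
  moreover have "f * g \<in> gen_sections (raise_at i (\<lambda>k. r k + s k))"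
    by (rule K3) (auto simp: r_def s_def L_def raise_at_def)
  ultimately have "f \<in> gen_sections (raise_at i r) \<or> g \<in> gen_sections (raise_at i s)"
    using ps unfolding prime_section_def by blast
  moreover have "raise_at i r i = p + 1" "raise_at i s i = q + 1" by (simp_all add: raise_at_def r_def s_def)
  ultimately show ?thesis using gen_sections_subset_weight_filtration[OF i] by (metis subsetD)
qed

text \<open>
  In the algebra generated by the \<open>t\<^sub>k\<^bsup>-1\<^esup>\<close> and the \<open>b\<^sub>j t\<^bsup>v(b\<^sub>j)\<^esup>\<close>, a product of \<open>f t\<^sup>r\<close> with a monomial in the \<open>t\<^sub>k\<^bsup>-1\<^esup>\<close>,
  \<open>k \<noteq> i\<close>, lies in the prime ideal generated by \<open>t\<^sub>i\<^bsup>-1\<^esup>\<close>, and that monomial does not.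
\<close>

lemma gen_sections_raise:
  assumes ps: "prime_section i" and i: "i < n" and one: "1 \<notin> weight_filtration (D i) 1"
    and f: "f \<in> gen_sections r" "f \<in> weight_filtration (D i) (r i + 1)"
  shows "f \<in> gen_sections (raise_at i r)"
proof -
  obtain K where K: "\<And>s. s i \<le> r i + 1 \<Longrightarrow> (\<And>k. k < n \<Longrightarrow> k \<noteq> i \<Longrightarrow> s k \<le> K) \<Longrightarrow> f \<in> gen_sections s"
    using weight_filtration_gen_sections[OF f(2)] by blast
  define s where "s = (\<lambda>k. if k = i then 0 else min 0 (K - r k))"
  have "monomial (\<lambda>_. 0) \<in> gen_sections s" unfolding gen_sections_def by (rule mspan_base) (simp add: wt_zero s_def)
  then have 1: "1 \<in> gen_sections s" by (simp add: monomial_zero)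
  have "f * 1 \<in> gen_sections (raise_at i (\<lambda>k. r k + s k))"
    unfolding mult_1_right by (rule K) (auto simp: raise_at_def s_def)
  then have "f \<in> gen_sections (raise_at i r) \<or> 1 \<in> gen_sections (raise_at i s)"
    using ps f(1) 1 unfolding prime_section_def by blast
  moreover have "1 \<notin> gen_sections (raise_at i s)"
    using one gen_sections_subset_weight_filtration[OF i, of "raise_at i s"] by (auto simp: raise_at_def s_def)
  ultimately show ?thesis by blast
qed

text \<open>
  Induction on the total distance that the degree \<open>s\<close>, at which \<open>f\<close> is known to be generated, has to climb to reach \<open>r\<close>.
\<close>

lemma saturation:
  assumes ps: "\<And>i. i < n \<Longrightarrow> prime_section i"
    and one: "\<And>i. i < n \<Longrightarrow> 1 \<notin> weight_filtration (D i) 1"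
    and sat: "\<And>i q f. i < n \<Longrightarrow> f \<in> weight_filtration (D i) q \<Longrightarrow> f \<in> F i (q + 1) \<Longrightarrow>
        f \<in> weight_filtration (D i) (q + 1)"
    and anti: "\<And>i p q. i < n \<Longrightarrow> p \<le> q \<Longrightarrow> F i q \<subseteq> F i p"
    and gen: "mspan UNIV = UNIV"
    and f: "\<And>i. i < n \<Longrightarrow> f \<in> F i (r i)"
  shows "f \<in> gen_sections r"
proof -
  have "f \<in> gen_sections r" if "f \<in> gen_sections s" "N = (\<Sum>k<n. nat (r k - s k))" for s N
    using that
  proof (induction N arbitrary: s rule: less_induct)
    case (less N)
    show ?case
    proof (cases "\<forall>k<n. r k \<le> s k")
      case True
      then show ?thesis using gen_sections_antimono[of r s] less.prems(1) by blast
    next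
      case False
      then obtain i where i: "i < n" "s i < r i" by auto
      have "f \<in> weight_filtration (D i) (s i)" using less.prems(1) gen_sections_subset_weight_filtration[OF i(1)] by blast
      moreover have "f \<in> F i (s i + 1)" using f[OF i(1)] anti[OF i(1), of "s i + 1" "r i"] i(2) by auto
      ultimately have "f \<in> weight_filtration (D i) (s i + 1)" by (rule sat[OF i(1)])
      then have *: "f \<in> gen_sections (raise_at i s)" by (rule gen_sections_raise[OF ps[OF i(1)] i(1) one[OF i(1)] less.prems(1)])
      have "(\<Sum>k<n. nat (r k - raise_at i s k)) < (\<Sum>k<n. nat (r k - s k))"
        by (rule sum_strict_mono_ex1) (use i in \<open>auto simp: raise_at_def\<close>)
      then show ?thesis using less.IH * less.prems(2) by blast
    qed
  qed
  moreover have "f \<in> mspan UNIV" using gen by simp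
  then obtain K where K: "\<And>s. (\<forall>\<alpha>\<in>UNIV. \<forall>k<n. s k \<le> wt (D k) \<alpha> \<or> s k \<le> K) \<Longrightarrow> f \<in> gen_sections s"
    using mspan_bounded_gen_sections by blast
  have "f \<in> gen_sections (\<lambda>k. min K (r k))" by (rule K) simp
  ultimately show ?thesis by blast
qed

end

section \<open>Valuations and their associated graded rings\<close>

lemma Fin_add_le: "Fin (p::rat) \<le> a \<Longrightarrow> Fin q \<le> c \<Longrightarrow> Fin (p + q) \<le> a + c"
  by (cases a; cases c) auto

lemma Fin_add_less: "Fin (p::rat) < a \<Longrightarrow> Fin q \<le> c \<Longrightarrow> Fin (p + q) < a + c"
  by (cases a; cases c) auto

context valued_algebra begin

context
  fixes x :: 'v
  assumes PL: PL_valuation and x: "x \<in> \<Union>\<Sigma>"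
begin

lemma v_mult: "v (f * g) x = v f x + v g x" using PL x unfolding PL_valuation_def by blast
lemma v_add: "min (v f x) (v g x) \<le> v (f + g) x" using PL x unfolding PL_valuation_def by blast
lemma v_const: "c \<noteq> 0 \<Longrightarrow> v (scale c 1) x = 0" using PL x unfolding PL_valuation_def by blast
lemma v_zero: "v 0 x = \<infinity>" using PL x unfolding PL_valuation_def by blast

lemma v_scale: "c \<noteq> 0 \<Longrightarrow> v (scale c f) x = v f x"
  using v_mult[of "scale c 1" f] v_const[of c] alg.scale_eq_mult[of c f] by simp

lemma v_one: "v 1 x = 0" using v_const[of 1] by simp

lemma subspace_ge: "alg.subspace {f. Fin q \<le> v f x}"
  unfolding alg.subspace_def
proof (intro conjI ballI allI)
  show "0 \<in> {f. Fin q \<le> v f x}" by (simp add: v_zero)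
  fix f g assume "f \<in> {f. Fin q \<le> v f x}" "g \<in> {f. Fin q \<le> v f x}"
  then have "Fin q \<le> min (v f x) (v g x)" by simp
  then show "f + g \<in> {f. Fin q \<le> v f x}" using v_add[of f g] order_trans by blast
next
  fix c f assume "f \<in> {f. Fin q \<le> v f x}"
  then show "scale c f \<in> {f. Fin q \<le> v f x}"
    by (cases "c = 0") (auto simp: v_scale v_zero)
qed

lemma subspace_gt: "alg.subspace {f. Fin q < v f x}"
  unfolding alg.subspace_def
proof (intro conjI ballI allI)
  show "0 \<in> {f. Fin q < v f x}" by (simp add: v_zero)
  fix f g assume "f \<in> {f. Fin q < v f x}" "g \<in> {f. Fin q < v f x}"
  then have "Fin q < min (v f x) (v g x)" by simp
  then show "f + g \<in> {f. Fin q < v f x}" using v_add[of f g] less_le_trans by blast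
next
  fix c f assume "f \<in> {f. Fin q < v f x}"
  then show "scale c f \<in> {f. Fin q < v f x}"
    by (cases "c = 0") (auto simp: v_scale v_zero)
qed

lemma carrier_rees: "carrier (rees x) = {F. \<forall>q. Fin q \<le> v (lk F q) x}"
  by (simp add: rees_def)

lemma rees_subset_ring: "rees x = subset_ring (carrier (rees x))"
  by (simp add: rees_def)

lemma subring_rees: "subring_set (carrier (rees x))"
proof -
  let ?S = "{F. \<forall>q. Fin q \<le> v (lk F q) x}"
  show ?thesis
  unfolding carrier_rees subring_set_def
proof (intro conjI ballI)
  show "1 \<in> ?S"
    by (auto simp: lookup_one when_def v_one v_zero zero_extended_def)
  fix F assume F: "F \<in> ?S"
  show "- F \<in> ?S"
    using F alg.subspace_neg[OF subspace_ge] by auto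
  fix G assume G: "G \<in> ?S"
  show "F + G \<in> ?S"
    using F G alg.subspace_add[OF subspace_ge] by (auto simp: lookup_add)
  have "lk (F * G) q \<in> {f. Fin q \<le> v f x}" for q
    unfolding lookup_mult_keys
  proof (rule alg.subspace_sum[OF subspace_ge], rule alg.subspace_sum[OF subspace_ge])
    fix a c
    have "Fin (a + c) \<le> v (lk F a * lk G c) x"
      unfolding v_mult by (rule Fin_add_le) (use F G in auto)
    then show "(if a + c = q then lk F a * lk G c else 0) \<in> {f. Fin q \<le> v f x}"
      by (auto simp: v_zero)
  qed
  then show "F * G \<in> ?S" by simp
qed
qed

lemma ideal_rees: "ideal (rees_ideal x) (rees x)"
proof (rule ideal_subset_ringI[OF subring_rees, folded rees_subset_ring])
  show "rees_ideal x \<subseteq> carrier (rees x)"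
    unfolding carrier_rees rees_ideal_def using less_imp_le by blast
  show "0 \<in> rees_ideal x" by (simp add: rees_ideal_def v_zero)
  fix F G assume F: "F \<in> rees_ideal x"
  show "F + G \<in> rees_ideal x" if "G \<in> rees_ideal x"
    using F that alg.subspace_add[OF subspace_gt] by (auto simp: rees_ideal_def lookup_add)
  show "G * F \<in> rees_ideal x" if G: "G \<in> carrier (rees x)"
  proof -
    have "lk (F * G) q \<in> {f. Fin q < v f x}" for q
      unfolding lookup_mult_keys
    proof (rule alg.subspace_sum[OF subspace_gt], rule alg.subspace_sum[OF subspace_gt])
      fix a c
      have "Fin (a + c) < v (lk F a * lk G c) x"
        unfolding v_mult by (rule Fin_add_less) (use F G in \<open>auto simp: rees_ideal_def carrier_rees\<close>)
      then show "(if a + c = q then lk F a * lk G c else 0) \<in> {f. Fin q < v f x}"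
        by (auto simp: v_zero)
    qed
    then show ?thesis by (simp add: rees_ideal_def mult.commute)
  qed
qed

text \<open>
  Elements of the associated graded ring that are generated by the given classes have representatives whose coefficients lie
  in the subspaces \<open>M q\<close>, as such representatives are closed under the ring operations.  Comparing coefficients for the class
  of \<open>f\<close> yields an approximation of \<open>f\<close>.
\<close>

lemma khovanskii_lift:
  assumes kh: "khovanskii_basis B"
    and M: "\<And>q. alg.subspace (M q)" "1 \<in> M 0" "\<And>p q f g. f \<in> M p \<Longrightarrow> g \<in> M q \<Longrightarrow> f * g \<in> M (p + q)"
      "\<And>f q. f \<in> B \<Longrightarrow> v f x = Fin q \<Longrightarrow> f \<in> M q"
    and f: "Fin q \<le> v f x"
  shows "\<exists>g\<in>M q. Fin q < v (f - g) x"
proof -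
  let ?cl = "\<lambda>G. rees_ideal x +>\<^bsub>rees x\<^esub> G"
  interpret I: ideal "rees_ideal x" "rees x" by (rule ideal_rees)
  interpret cl: ring_hom_ring "rees x" "assoc_graded x" ?cl
    unfolding assoc_graded_def by (rule I.rcos_ring_hom_ring)
  have ops: "\<one>\<^bsub>rees x\<^esub> = 1" "F \<oplus>\<^bsub>rees x\<^esub> G = F + G" "F \<otimes>\<^bsub>rees x\<^esub> G = F * G" for F G
    by (simp_all add: rees_def)
  have single_rees: "sgl p h \<in> carrier (rees x)" if "Fin p \<le> v h x" for p h
    using that by (auto simp: carrier_rees lookup_single when_def v_zero)
  have lift: "\<exists>G\<in>carrier (rees x). c = ?cl G \<and> (\<forall>q. lk G q \<in> M q)"
    if "c \<in> generate_ring (assoc_graded x) (graded_class x 0 ` alg.constants \<union>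
           {graded_class x q b | b q. b \<in> B \<and> v b x = Fin q})" for c
    using that
  proof (induction rule: generate_ring.induct)
    case one
    have "lk 1 q \<in> M q" for q
      using M(2) alg.subspace_0[OF M(1)] by (auto simp: lookup_one when_def)
    moreover have "\<one>\<^bsub>assoc_graded x\<^esub> = ?cl 1" using cl.hom_one ops(1) by simp
    ultimately show ?case using subring_setD(1)[OF subring_rees] by blast
  next
    case (incl h)
    then obtain p g where g: "h = ?cl (sgl p g)" "g \<in> M p" "Fin p \<le> v g x"
    proof (elim UnE)
      assume "h \<in> graded_class x 0 ` alg.constants"
      then obtain z where z: "h = ?cl (sgl 0 (scale z 1))"
        by (auto simp: alg.constants_def graded_class_def)
      have "scale z 1 \<in> M 0" by (rule alg.subspace_scale[OF M(1,2)])
      moreover have "1 \<in> {f. Fin 0 \<le> v f x}" by (simp add: v_one zero_extended_def)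
      then have "Fin 0 \<le> v (scale z 1) x" using alg.subspace_scale[OF subspace_ge] by blast
      ultimately show thesis using that z by blast
    next
      assume "h \<in> {graded_class x q b | b q. b \<in> B \<and> v b x = Fin q}"
      then obtain g p where "h = ?cl (sgl p g)" "g \<in> B" "v g x = Fin p"
        by (auto simp: graded_class_def)
      then show thesis using that M(4) by simp
    qed
    have "lk (sgl p g) q \<in> M q" for q
      using g(2) alg.subspace_0[OF M(1)] by (auto simp: lookup_single when_def)
    then show ?case using g(1) single_rees[OF g(3)] by blast
  next
    case (a_inv h)
    then obtain G where G: "G \<in> carrier (rees x)" "h = ?cl G" "\<And>q. lk G q \<in> M q" by blast
    have "\<ominus>\<^bsub>rees x\<^esub> G = - G"
      using a_inv_subset_ring[OF subring_rees G(1)] rees_subset_ring by metis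
    then have "\<ominus>\<^bsub>assoc_graded x\<^esub> h = ?cl (- G)" using cl.hom_a_inv[OF G(1)] G(2) by simp
    moreover have "lk (- G) q \<in> M q" for q
      using alg.subspace_neg[OF M(1) G(3)] by simp
    ultimately show ?case using subring_setD(3)[OF subring_rees G(1)] by blast
  next
    case (eng_add h1 h2)
    then obtain G1 G2 where G1: "G1 \<in> carrier (rees x)" "h1 = ?cl G1" "\<And>q. lk G1 q \<in> M q"
      and G2: "G2 \<in> carrier (rees x)" "h2 = ?cl G2" "\<And>q. lk G2 q \<in> M q" by blast
    have "h1 \<oplus>\<^bsub>assoc_graded x\<^esub> h2 = ?cl (G1 + G2)" using cl.hom_add[OF G1(1) G2(1)] G1(2) G2(2) ops by simp
    moreover have "lk (G1 + G2) q \<in> M q" for q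
      unfolding lookup_add by (rule alg.subspace_add[OF M(1) G1(3) G2(3)])
    ultimately show ?case using subring_setD(4)[OF subring_rees G1(1) G2(1)] by blast
  next
    case (eng_mult h1 h2)
    then obtain G1 G2 where G1: "G1 \<in> carrier (rees x)" "h1 = ?cl G1" "\<And>q. lk G1 q \<in> M q"
      and G2: "G2 \<in> carrier (rees x)" "h2 = ?cl G2" "\<And>q. lk G2 q \<in> M q" by blast
    have "h1 \<otimes>\<^bsub>assoc_graded x\<^esub> h2 = ?cl (G1 * G2)" using cl.hom_mult[OF G1(1) G2(1)] G1(2) G2(2) ops by simp
    moreover have "lk (G1 * G2) q \<in> M q" for q
      unfolding lookup_mult_keys
    proof (rule alg.subspace_sum[OF M(1)], rule alg.subspace_sum[OF M(1)])
      fix a c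
      have "lk G1 a * lk G2 c \<in> M (a + c)" by (rule M(3)[OF G1(3) G2(3)])
      then show "(if a + c = q then lk G1 a * lk G2 c else 0) \<in> M q"
        using alg.subspace_0[OF M(1)] by auto
    qed
    ultimately show ?case using subring_setD(5)[OF subring_rees G1(1) G2(1)] by blast
  qed
  have fr: "sgl q f \<in> carrier (rees x)" by (rule single_rees[OF f])
  have "?cl (sgl q f) \<in> carrier (assoc_graded x)" by (rule cl.hom_closed[OF fr])
  then obtain G where G: "G \<in> carrier (rees x)" "?cl (sgl q f) = ?cl G"
    "\<And>q. lk G q \<in> M q"
    using lift kh x unfolding khovanskii_basis_def by blast
  have "sgl q f \<in> ?cl (sgl q f)" by (rule I.a_rcos_self[OF fr])
  then have "sgl q f \<in> ?cl G" using G(2) by simp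
  then obtain H where H: "H \<in> rees_ideal x" "sgl q f = H + G"
    unfolding a_r_coset_def' by (auto simp: ops)
  have "f = lk H q + lk G q"
    using arg_cong[OF H(2), of "\<lambda>F. lk F q"] by (simp add: lookup_add)
  then have "f - lk G q = lk H q" by simp
  then have "Fin q < v (f - lk G q) x" using H(1) by (simp add: rees_ideal_def)
  then show ?thesis using G(3) by blast
qed

end

text \<open>
  The value of a combination of adapted basis elements is attained at one of them, and those are linear on the cone.
\<close>

lemma v_finite:
  assumes "\<sigma> \<in> \<Sigma>" "x \<in> \<sigma>" "adapted_basis \<sigma> \<BB>" "f \<noteq> 0"
  shows "\<exists>m\<in>lat.dual_lattice. v f x = Fin (m x)"
proof -
  have "f \<in> alg.span \<BB>" using assms(3) by (simp add: adapted_basis_def)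
  then obtain t r where t: "f = (\<Sum>a\<in>t. scale (r a) a)" "finite t" "t \<subseteq> \<BB>"
    unfolding alg.span_explicit by blast
  define S where "S = {a \<in> t. r a \<noteq> 0}"
  have f: "f = (\<Sum>a\<in>S. scale (r a) a)"
    unfolding t(1) S_def by (rule sum.mono_neutral_right) (use t(2) in auto)
  have "S \<noteq> {}"
  proof
    assume "S = {}"
    then show False using f assms(4) by simp
  qed
  then have S: "finite S" "S \<noteq> {}" "S \<subseteq> \<BB>" "\<forall>a\<in>S. r a \<noteq> 0"
    using t by (auto simp: S_def)
  have "v f x = (MIN a\<in>S. v a x)" using S assms(2,3) unfolding f adapted_basis_def by blast
  also have "\<dots> \<in> (\<lambda>a. v a x) ` S" using S by (intro Min_in) auto
  finally obtain a where "a \<in> S" "v f x = v a x" by auto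
  moreover have "\<forall>b\<in>\<BB>. \<exists>m\<in>lat.dual_lattice. \<forall>x\<in>\<sigma>. v b x = Fin (m x)"
    using assms(3) by (simp add: adapted_basis_def)
  then obtain m where "m \<in> lat.dual_lattice" "\<forall>x\<in>\<sigma>. v a x = Fin (m x)"
    using S(3) \<open>a \<in> S\<close> by blast
  ultimately show ?thesis using assms(2) by auto
qed

end

section \<open>The criterion\<close>

locale toric_family =
  graded_algebra scale A + cox_relations scale d b n D + valued_algebra scl N scale \<Sigma> v
  for scl :: "rat \<Rightarrow> 'v::ab_group_add \<Rightarrow> 'v" and N
    and scale :: "'k::field \<Rightarrow> 'a::comm_ring_1 \<Rightarrow> 'a"
    and \<Sigma> v A d b n D +
  fixes \<rho> :: "nat \<Rightarrow> 'v"
  assumes fan: "lat.fan \<Sigma>"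
    and rays: "\<rho> ` {..<n} \<subseteq> lat.ray_generators \<Sigma>"
    and flat: "toric_flat A"
    and khovanskii: "khovanskii_basis (b ` {..<d})"
    and diagram: "is_diagram n \<rho> d b D"
begin

lemma PL: PL_valuation using flat by (simp add: toric_flat_def)

lemma cone_gen_in: "u \<in> lat.cone_gen {u}"
  unfolding lat.cone_gen_def by (rule CollectI, rule exI[of _ "\<lambda>_. 1"]) simp

lemma ray: "i < n \<Longrightarrow> \<rho> i \<in> N \<and> \<rho> i \<in> \<Union>\<Sigma>"
  using rays cone_gen_in by (auto simp: lat.ray_generators_def)

lemma origin: "0 \<in> \<Union>\<Sigma>"
proof -
  obtain \<sigma> where \<sigma>: "\<sigma> \<in> \<Sigma>" using fan by (auto simp: lat.fan_def)
  then obtain G where G: "\<sigma> = lat.cone_gen G"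
    using fan unfolding lat.fan_def lat.rational_cone_def by blast
  have "0 \<in> lat.cone_gen G"
    unfolding lat.cone_gen_def by (rule CollectI, rule exI[of _ "\<lambda>_. 0"]) simp
  then show ?thesis using \<sigma> G by blast
qed

lemma v_dual:
  assumes "x \<in> \<Union>\<Sigma>" "f \<noteq> 0"
  shows "\<exists>m\<in>lat.dual_lattice. v f x = Fin (m x)"
  using assms v_finite flat unfolding toric_flat_def by blast

lemma v_ray: "i < n \<Longrightarrow> f \<noteq> 0 \<Longrightarrow> \<exists>z. v f (\<rho> i) = Fin (of_int z)"
  using v_dual[of "\<rho> i" f] ray[of i] unfolding lat.dual_lattice_def Ints_def by auto

text \<open>
  At the origin of the fan the valuation is trivial, since linear functions vanish there.
\<close>

lemma v_origin:
  assumes "f \<noteq> 0"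
  shows "v f 0 = Fin 0"
proof -
  obtain m where m: "m \<in> lat.dual_lattice" "v f 0 = Fin (m 0)" using v_dual[OF origin assms] by blast
  interpret m: Vector_Spaces.linear scl "(*)" m using m(1) by (simp add: lat.dual_lattice_def)
  show ?thesis using m(2) m.zero by simp
qed

definition ray_filtration :: "nat \<Rightarrow> int \<Rightarrow> 'a set" where
  "ray_filtration i q = {f. Fin (of_int q) \<le> v f (\<rho> i)}"

lemma subspace_ray_filtration: "i < n \<Longrightarrow> subspace (ray_filtration i q)"
  unfolding ray_filtration_def using subspace_ge[OF PL] ray by blast

lemma ray_filtration_antimono: "p \<le> q \<Longrightarrow> ray_filtration i q \<subseteq> ray_filtration i p"
proof -
  assume "p \<le> q"
  then have "Fin (of_int p :: rat) \<le> Fin (of_int q)" by simp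
  then show ?thesis unfolding ray_filtration_def using order_trans by blast
qed

lemma ray_filtration_mult: "i < n \<Longrightarrow> f \<in> ray_filtration i p \<Longrightarrow> g \<in> ray_filtration i q \<Longrightarrow> f * g \<in> ray_filtration i (p + q)"
  unfolding ray_filtration_def using v_mult[OF PL, of "\<rho> i"] ray by (auto simp: Fin_add_le)

lemma ray_filtration_iff: "v f (\<rho> i) = Fin (of_int z) \<Longrightarrow> f \<in> ray_filtration i q \<longleftrightarrow> q \<le> z"
  by (simp add: ray_filtration_def)

lemma ray_filtration_zero: "i < n \<Longrightarrow> 0 \<in> ray_filtration i q"
  using subspace_0[OF subspace_ray_filtration] .

lemma ray_filtration_prime:
  assumes i: "i < n" and f: "f \<in> ray_filtration i p" and g: "g \<in> ray_filtration i q" and fg: "f * g \<in> ray_filtration i (p + q + 1)"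
  shows "f \<in> ray_filtration i (p + 1) \<or> g \<in> ray_filtration i (q + 1)"
proof (cases "f = 0 \<or> g = 0")
  case True then show ?thesis using ray_filtration_zero[OF i] by auto
next
  case False
  then obtain y z where yz: "v f (\<rho> i) = Fin (of_int y)" "v g (\<rho> i) = Fin (of_int z)"
    using v_ray[OF i] by metis
  have "v (f * g) (\<rho> i) = Fin (of_int (y + z))"
    using v_mult[OF PL, of "\<rho> i"] ray[OF i] yz by simp
  then have "p + q + 1 \<le> y + z" using fg ray_filtration_iff by blast
  then show ?thesis unfolding ray_filtration_iff[OF yz(1)] ray_filtration_iff[OF yz(2)] by linarith
qed

lemma v_monomial:
  assumes i: "i < n"
  shows "v (monomial \<alpha>) (\<rho> i) = Fin (of_int (wt (D i) \<alpha>))"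
proof -
  have x: "\<rho> i \<in> \<Union>\<Sigma>" using ray[OF i] by blast
  show ?thesis
  proof (rule closed_under_monomials[where P = "\<lambda>q f. v f (\<rho> i) = Fin (of_int q)"])
    show "v 1 (\<rho> i) = Fin (of_int 0)" by (simp add: v_one[OF PL x] zero_extended_def)
    show "v (f * g) (\<rho> i) = Fin (of_int (p + q))"
      if "v f (\<rho> i) = Fin (of_int p)" "v g (\<rho> i) = Fin (of_int q)" for f g p q
      using that by (simp add: v_mult[OF PL x])
    show "v (b j) (\<rho> i) = Fin (of_int (D i j))" if "j < d" for j
      using diagram i that by (simp add: is_diagram_def)
  qed
qed

text \<open>
  The filtration at the origin is trivial, so the associated graded ring is \<open>A\<close> itself and the Khovanskii property says that
  the generators generate \<open>A\<close>.
\<close>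

lemma generates: "mspan UNIV = UNIV"
proof -
  have "f \<in> mspan UNIV" for f
  proof -
    have "Fin 0 \<le> v f 0"
      using v_zero[OF PL origin] v_origin[of f] by (cases "f = 0") auto
    then have "\<exists>g\<in>mspan UNIV. Fin 0 < v (f - g) 0"
    proof (rule khovanskii_lift[OF PL origin khovanskii, where M = "\<lambda>_. mspan UNIV", rotated 4])
      show "1 \<in> mspan UNIV" using mspan_base[of "\<lambda>_. 0" UNIV] monomial_zero by simp
      show "f * g \<in> mspan UNIV" if "f \<in> mspan UNIV" "g \<in> mspan UNIV" for f g
        using that by (rule mspan_mult) simp
      show "f \<in> mspan UNIV" if "f \<in> b ` {..<d}" for f
        using that mspan_base[OF UNIV_I] monomial_unit by (metis imageE lessThan_iff)
    qed simp
    then obtain g where g: "g \<in> mspan UNIV" "Fin 0 < v (f - g) 0" by blast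
    have "f - g = 0" using g(2) v_origin[of "f - g"] by (cases "f - g = 0") auto
    then show ?thesis using g(1) by simp
  qed
  then show ?thesis by blast
qed

lemma filtered:
  assumes i: "i < n"
  shows "filtered_generators scale A d b (D i) (ray_filtration i)"
proof
  have x: "\<rho> i \<in> \<Union>\<Sigma>" using ray[OF i] by blast
  show "subspace (ray_filtration i q)" for q by (rule subspace_ray_filtration[OF i])
  show "ray_filtration i (q + 1) \<subseteq> ray_filtration i q" for q by (rule ray_filtration_antimono) simp
  show "f * g \<in> ray_filtration i (p + q)" if "f \<in> ray_filtration i p" "g \<in> ray_filtration i q" for f g p q by (rule ray_filtration_mult[OF i that])
  show "\<exists>q. f \<notin> ray_filtration i q" if f: "f \<noteq> 0" for f
  proof -
    obtain z where "v f (\<rho> i) = Fin (of_int z)" using v_ray[OF i f] by blast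
    then have "f \<notin> ray_filtration i (z + 1)" using ray_filtration_iff by simp
    then show ?thesis by blast
  qed
  show "component m f \<in> ray_filtration i q" if f: "f \<in> ray_filtration i q" for m f q
  proof -
    let ?S = "insert m (supp (decomp f))"
    have "v (\<Sum>l\<in>?S. component l f) (\<rho> i) = (MIN l\<in>?S. v (component l f) (\<rho> i))"
      using flat x unfolding toric_flat_def homogeneous_valuation_def by (auto simp del: sum.insert_if)
    moreover have "(\<Sum>l\<in>?S. component l f) = f" by (rule sum_component) auto
    moreover have "(MIN l\<in>?S. v (component l f) (\<rho> i)) \<le> v (component m f) (\<rho> i)" by (rule Min_le) auto
    ultimately have "v f (\<rho> i) \<le> v (component m f) (\<rho> i)" by simp
    then show ?thesis using f unfolding ray_filtration_def by auto
  qed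
  show "1 \<in> ray_filtration i 0" "1 \<notin> ray_filtration i 1" using v_one[OF PL x] by (auto simp: ray_filtration_def zero_extended_def)
  show "b j \<in> ray_filtration i (D i j)" if "j < d" for j using diagram i that by (simp add: is_diagram_def ray_filtration_def)
  show "\<exists>g\<in>mspan {\<alpha>. wt (D i) \<alpha> = q}. f - g \<in> ray_filtration i (q + 1)" if f: "f \<in> ray_filtration i q" for f q
  proof -
    let ?M = "\<lambda>p::rat. mspan {\<alpha>. of_int (wt (D i) \<alpha>) = p}"
    have "\<exists>g\<in>?M (of_int q). Fin (of_int q) < v (f - g) (\<rho> i)"
    proof (rule khovanskii_lift[OF PL x khovanskii])
      show "subspace (?M p)" for p by simp
      show "1 \<in> ?M 0" using mspan_base[of "\<lambda>_. 0" "{\<alpha>. of_int (wt (D i) \<alpha>) = (0::rat)}"] monomial_zero wt_zero by simp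
      show "f * g \<in> ?M (p + q)" if "f \<in> ?M p" "g \<in> ?M q" for f g p q
        using that by (rule mspan_mult) (simp add: wt_add)
      show "f \<in> ?M p" if f: "f \<in> b ` {..<d}" "v f (\<rho> i) = Fin p" for f p
      proof -
        obtain j where j: "j < d" "f = b j" using f(1) by auto
        then have "p = of_int (D i j)" using f(2) diagram i by (simp add: is_diagram_def)
        then have "(\<lambda>k. if k = j then 1 else 0) \<in> {\<alpha>. of_int (wt (D i) \<alpha>) = p}" using wt_unit[OF j(1)] by simp
        then show ?thesis using mspan_base monomial_unit[OF j(1)] j(2) by metis
      qed
      show "Fin (of_int q) \<le> v f (\<rho> i)" using f by (simp add: ray_filtration_def)
    qed
    then obtain g where g: "g \<in> ?M (of_int q)" "Fin (of_int q) < v (f - g) (\<rho> i)" by blast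
    have "f - g \<in> ray_filtration i (q + 1)"
    proof (cases "f - g = 0")
      case True then show ?thesis using ray_filtration_zero[OF i] by simp
    next
      case False
      then obtain z where z: "v (f - g) (\<rho> i) = Fin (of_int z)" using v_ray[OF i] by blast
      then show ?thesis using g(2) ray_filtration_iff[OF z] by simp
    qed
    then show ?thesis using g(1) by auto
  qed
  show "mspan UNIV = UNIV" by (rule generates)
qed

lemma weight_filtration_ray_filtration: "i < n \<Longrightarrow> weight_filtration (D i) q \<subseteq> ray_filtration i q"
  by (rule filtered_generators.weight_filtration_F[OF filtered])

lemma gen_sections_ray_filtration: "i < n \<Longrightarrow> gen_sections r \<subseteq> ray_filtration i (r i)"
  using gen_sections_subset_weight_filtration weight_filtration_ray_filtration by blast

lemma one_not_filtration: "i < n \<Longrightarrow> 1 \<notin> weight_filtration (D i) 1"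
  using weight_filtration_ray_filtration filtered_generators.one_not_F[OF filtered] by blast

definition saturated :: bool where
  "saturated \<longleftrightarrow> (\<forall>r f. (\<forall>i<n. f \<in> ray_filtration i (r i)) \<longrightarrow> f \<in> gen_sections r)"

lemma saturated_iff_prime: "saturated \<longleftrightarrow> (\<forall>i<n. prime_section i)"
proof
  assume sat: saturated
  show "\<forall>i<n. prime_section i"
    unfolding prime_section_def
  proof (intro allI impI)
    fix i r s f g
    assume i: "i < n" and f: "f \<in> gen_sections r" and g: "g \<in> gen_sections s" and fg: "f * g \<in> gen_sections (raise_at i (\<lambda>k. r k + s k))"
    have "f * g \<in> ray_filtration i (r i + s i + 1)" using gen_sections_ray_filtration[OF i] fg by (force simp: raise_at_def)
    moreover have fV: "f \<in> ray_filtration k (r k)" and gV: "g \<in> ray_filtration k (s k)" if "k < n" for k using gen_sections_ray_filtration[OF that] f g by blast+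
    ultimately have "f \<in> ray_filtration i (r i + 1) \<or> g \<in> ray_filtration i (s i + 1)" using ray_filtration_prime[OF i] i by blast
    then have "(\<forall>k<n. f \<in> ray_filtration k (raise_at i r k)) \<or> (\<forall>k<n. g \<in> ray_filtration k (raise_at i s k))"
      using fV gV by (auto simp: raise_at_def)
    then show "f \<in> gen_sections (raise_at i r) \<or> g \<in> gen_sections (raise_at i s)" using sat unfolding saturated_def by blast
  qed
next
  assume ps: "\<forall>i<n. prime_section i"
  show saturated
    unfolding saturated_def
  proof (intro allI impI)
    fix r f assume f: "\<forall>i<n. f \<in> ray_filtration i (r i)"
    show "f \<in> gen_sections r"
    proof (rule saturation[where F = ray_filtration])
      show "prime_section i" if "i < n" for i using ps that by blast
      show "1 \<notin> weight_filtration (D i) 1" if "i < n" for i by (rule one_not_filtration[OF that])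
      show "ray_filtration i q \<subseteq> ray_filtration i p" if "p \<le> q" for i p q by (rule ray_filtration_antimono[OF that])
      show "mspan UNIV = UNIV" by (rule generates)
      show "f \<in> ray_filtration i (r i)" if "i < n" for i using f that by blast
      fix i q g assume i: "i < n" and g: "g \<in> weight_filtration (D i) q" "g \<in> ray_filtration i (q + 1)"
      interpret fg: filtered_generators scale A d b "D i" "ray_filtration i" by (rule filtered[OF i])
      show "g \<in> weight_filtration (D i) (q + 1)"
        by (rule fg.weight_filtration_saturated[OF _ g])
          (use weight_filtration_prime ps i in blast)
    qed
  qed
qed

lemma total_section_ring_eq:
  "total_section_ring n \<rho> = {F. \<forall>r\<in>supp F. supp r \<subseteq> {..<n} \<and> lk F r \<in> (\<Inter>i<n. ray_filtration i (lk r i))}"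
  by (auto simp: total_section_ring_def ray_filtration_def)

lemma subring_total: "subring_set (total_section_ring n \<rho>)"
  unfolding total_section_ring_eq
proof (rule subring_set_graded)
  show "0 \<in> (\<Inter>i<n. ray_filtration i (lk r i))" for r :: "nat \<Rightarrow>\<^sub>0 int" using ray_filtration_zero by auto
  show "f + g \<in> (\<Inter>i<n. ray_filtration i (lk r i))" if "f \<in> (\<Inter>i<n. ray_filtration i (lk r i))" "g \<in> (\<Inter>i<n. ray_filtration i (lk r i))"
    for f g and r :: "nat \<Rightarrow>\<^sub>0 int" using that subspace_add[OF subspace_ray_filtration] by auto
  show "- f \<in> (\<Inter>i<n. ray_filtration i (lk r i))" if "f \<in> (\<Inter>i<n. ray_filtration i (lk r i))" for f and r :: "nat \<Rightarrow>\<^sub>0 int"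
    using that subspace_neg[OF subspace_ray_filtration] by auto
  show "1 \<in> (\<Inter>i<n. ray_filtration i (lk 0 i))" using filtered_generators.one_F[OF filtered] by auto
  show "f * g \<in> (\<Inter>i<n. ray_filtration i (lk (r + s) i))" if "f \<in> (\<Inter>i<n. ray_filtration i (lk r i))" "g \<in> (\<Inter>i<n. ray_filtration i (lk s i))"
    for f g and r s :: "nat \<Rightarrow>\<^sub>0 int" using that ray_filtration_mult by (auto simp: lookup_add)
qed

text \<open>
  The algebra generated by the \<open>t\<^sub>i\<^bsup>-1\<^esup>\<close> and the \<open>b\<^sub>j t\<^bsup>v(b\<^sub>j)\<^esup>\<close>, described degree by degree.
\<close>

definition section_subring :: "((nat \<Rightarrow>\<^sub>0 int) \<Rightarrow>\<^sub>0 'a) set" where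
  "section_subring = {F. \<forall>r\<in>supp F. supp r \<subseteq> {..<n} \<and> lk F r \<in> gen_sections (lk r)}"

lemma one_gen_sections: "(\<And>k. k < n \<Longrightarrow> r k \<le> 0) \<Longrightarrow> 1 \<in> gen_sections r"
  using mspan_base[of "\<lambda>_. 0" "{\<alpha>. \<forall>k<n. r k \<le> wt (D k) \<alpha>}"]
  by (simp add: gen_sections_def monomial_zero wt_zero)

lemma subring_section: "subring_set section_subring"
  unfolding section_subring_def
proof (rule subring_set_graded)
  show "1 \<in> gen_sections (lk 0)" by (rule one_gen_sections) simp
  show "f * g \<in> gen_sections (lk (r + s))" if "f \<in> gen_sections (lk r)" "g \<in> gen_sections (lk s)" for f g r s
    using that by (rule gen_sections_mult) (simp add: lookup_add)
qed (auto intro: subspace_0 subspace_add subspace_neg)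

lemma constants_total: "sgl 0 ` constants \<union> t_inv ` {..<n} \<subseteq> total_section_ring n \<rho> \<inter> section_subring"
proof -
  have "f \<in> ray_filtration i 0" if "f \<in> constants" "i < n" for f i
    using that subspace_scale[OF subspace_ray_filtration filtered_generators.one_F[OF filtered]] by (auto simp: constants_def)
  moreover have "f \<in> gen_sections (lk 0)" if "f \<in> constants" for f
    using that subspace_scale[OF subspace_gen_sections one_gen_sections] by (auto simp: constants_def)
  moreover have "1 \<in> gen_sections (lk (sgl k (- 1)))" for k
    by (rule one_gen_sections) (simp add: lookup_single when_def)
  moreover have "1 \<in> ray_filtration i (lk (sgl k (- 1)) i)" if "i < n" for i k
    using filtered_generators.one_F[OF filtered[OF that]] ray_filtration_antimono[of "lk (sgl k (- 1)) i" 0 i]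
    by (auto simp: lookup_single when_def)
  ultimately show ?thesis
    by (auto simp: total_section_ring_eq section_subring_def t_inv_def split: if_splits)
qed

text \<open>
  Any homogeneous generator over the Cox ring is \<open>b\<^sub>j t\<^sup>r\<close> with \<open>r\<^sub>i \<le> v\<^sub>i(b\<^sub>j)\<close>, hence is in \<open>section_subring\<close>, which then is the
  whole total section ring.
\<close>

lemma strong_imp_saturated:
  assumes "strong_khovanskii_basis n \<rho> (b ` {..<d})"
  shows saturated
proof -
  obtain G where G: "G \<subseteq> total_section_ring n \<rho>" "\<forall>g\<in>G. \<exists>r f. g = sgl r f"
    "generates_over_cox n \<rho> G" "b ` {..<d} = set_t_to_1 ` G"
    using assms unfolding strong_khovanskii_basis_def by blast
  have "G \<subseteq> section_subring"
  proof
    fix g assume g: "g \<in> G"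
    then obtain r f where rf: "g = sgl r f" using G(2) by blast
    show "g \<in> section_subring"
    proof (cases "f = 0")
      case True then show ?thesis by (simp add: rf section_subring_def)
    next
      case False
      have "set_t_to_1 g = f" using False by (simp add: set_t_to_1_def rf)
      then have "f \<in> b ` {..<d}" using g G(4) by blast
      then obtain j where j: "j < d" "f = b j" by auto
      have r: "supp r \<subseteq> {..<n}" "\<And>i. i < n \<Longrightarrow> f \<in> ray_filtration i (lk r i)"
        using subsetD[OF G(1) g] False by (auto simp: rf total_section_ring_eq)
      have "lk r i \<le> D i j" if "i < n" for i
        using r(2)[OF that] j that diagram by (simp add: is_diagram_def ray_filtration_def)
      then have "monomial (\<lambda>k. if k = j then 1 else 0) \<in> gen_sections (lk r)"
        unfolding gen_sections_def by (intro mspan_base) (simp add: wt_unit[OF j(1)])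
      then have "f \<in> gen_sections (lk r)" using monomial_unit[OF j(1)] j(2) by simp
      then show ?thesis using r(1) False by (simp add: rf section_subring_def)
    qed
  qed
  then have "generate_ring (subset_ring (total_section_ring n \<rho>))
      (sgl 0 ` constants \<union> t_inv ` {..<n} \<union> G) \<subseteq> section_subring"
    using constants_total G(1) by (intro generate_subset_ring_minimal subring_total subring_section) auto
  then have sub: "total_section_ring n \<rho> \<subseteq> section_subring"
    using G(3) unfolding generates_over_cox_def by simp
  show saturated
    unfolding saturated_def
  proof (intro allI impI)
    fix r f assume f: "\<forall>i<n. f \<in> ray_filtration i (r i)"
    show "f \<in> gen_sections r"
    proof (cases "f = 0")
      case True then show ?thesis using subspace_0[OF subspace_gen_sections] by simp
    next
      case False
      have "sgl (ray_exponent r) f \<in> total_section_ring n \<rho>"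
        using f keys_ray_exponent by (auto simp: total_section_ring_eq lookup_ray_exponent)
      then have "sgl (ray_exponent r) f \<in> section_subring" using sub by blast
      then have "f \<in> gen_sections (lk (ray_exponent r))" using False by (simp add: section_subring_def)
      moreover have "gen_sections (lk (ray_exponent r)) = gen_sections r" by (rule gen_sections_cong) (simp add: lookup_ray_exponent)
      ultimately show ?thesis by simp
    qed
  qed
qed

text \<open>
  The elements \<open>b\<^sub>j t\<^bsup>v(b\<^sub>j)\<^esup>\<close> generate: a homogeneous section is the value of a polynomial in the \<open>X\<^sub>i\<close> and \<open>Y\<^sub>j\<close>.
\<close>

lemma saturated_imp_strong:
  assumes sat: saturated
  shows "strong_khovanskii_basis n \<rho> (b ` {..<d})"
proof -
  define g where "g j = sgl (ray_exponent (\<lambda>i. D i j)) (b j)" for j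
  define H where "H = sgl 0 ` constants \<union> t_inv ` {..<n} \<union> g ` {..<d}"
  define Gen where "Gen = generate_ring (subset_ring (total_section_ring n \<rho>)) H"
  have g_total: "g ` {..<d} \<subseteq> total_section_ring n \<rho>"
    using subsetD[OF keys_ray_exponent] diagram
    by (auto simp: g_def total_section_ring_eq lookup_ray_exponent ray_filtration_def is_diagram_def split: if_splits)
  then have H_total: "H \<subseteq> total_section_ring n \<rho>" using constants_total by (auto simp: H_def)
  have Gen: "subring_set Gen" "Gen \<subseteq> total_section_ring n \<rho>"
    unfolding Gen_def by (rule subring_set_generate[OF subring_total H_total])+
  have H_Gen: "H \<subseteq> Gen" unfolding Gen_def by (auto intro: generate_ring.incl)
  have image_Gen: "XY_image n b D x \<in> Gen" if "x \<in> vars" for x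
  proof -
    have "XY_image n b D x \<in> H"
      using that by (auto simp: XY_vars_def XY_image_def H_def g_def t_inv_def ray_exponent_def)
    then show ?thesis using H_Gen by blast
  qed
  have eval_Gen: "XY_eval n b D s \<in> Gen" if s: "s \<in> polys" for s
    unfolding XY_eval_def
  proof (intro subring_set_sum[OF Gen(1)] subring_setD(5)[OF Gen(1)] subring_set_prod[OF Gen(1)]
      subring_set_power[OF Gen(1)] image_Gen)
    fix m assume m: "m \<in> supp s"
    have "scale (lk s m) 1 \<in> constants" by (auto simp: constants_def)
    then show "sgl 0 (scale (lk s m) 1) \<in> Gen" using H_Gen by (auto simp: H_def)
    fix x assume "x \<in> supp m"
    then show "x \<in> vars" using s m by (auto simp: polys_iff)
  qed
  have "total_section_ring n \<rho> \<subseteq> Gen"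
  proof
    fix F assume F: "F \<in> total_section_ring n \<rho>"
    have "(\<Sum>r\<in>supp F. sgl r (lk F r)) \<in> Gen"
    proof (rule subring_set_sum[OF Gen(1)])
      fix r assume r: "r \<in> supp F"
      have kr: "supp r \<subseteq> {..<n}" and ray_filtration: "\<forall>i<n. lk F r \<in> ray_filtration i (lk r i)"
        using F r by (auto simp: total_section_ring_eq)
      have "lk F r \<in> mspan {\<alpha>. \<forall>k<n. lk r k \<le> wt (D k) \<alpha>}"
        using sat ray_filtration unfolding saturated_def gen_sections_def by blast
      then obtain s where s: "s \<in> polys" "graded_eval t_deg s = sgl r (lk F r)"
        using lift_to_polynomial[OF _ _ kr] by blast
      then show "sgl r (lk F r) \<in> Gen" using eval_Gen XY_eval_graded_eval by metis
    qed
    then show "F \<in> Gen" by (simp add: poly_mapping_sum_single)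
  qed
  then have "generates_over_cox n \<rho> (g ` {..<d})"
    using Gen(2) unfolding generates_over_cox_def Gen_def H_def by blast
  moreover have "set_t_to_1 (g j) = b j" for j by (simp add: set_t_to_1_def g_def)
  then have "b ` {..<d} = set_t_to_1 ` g ` {..<d}" by (simp add: image_image)
  ultimately show ?thesis
    unfolding strong_khovanskii_basis_def using g_total by (intro exI[of _ "g ` {..<d}"]) (auto simp: g_def)
qed

text \<open>
  The value of a monomial in the generators equals its weight, so it never lies one step deeper than its degree forces.
\<close>

lemma lifted_row_Trop:
  assumes i: "i < n"
  shows "lifted_row D i \<in> Trop vars (relation_ideal n d b D)"
  unfolding Trop_def
proof (intro CollectI allI notI)
  fix m assume "sgl m 1 \<in> initial_ideal vars (lifted_row D i) (relation_ideal n d b D)"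
  then have m: "sgl m 1 \<in> section_ideal i" by (simp add: initial_ideal_eq[OF i])
  have "lk (graded_eval (fine_deg i) (sgl m 1)) (fine_deg i m) \<in> gen_sections (raise_at i (fine_base i (fine_deg i m)))"
    using m unfolding section_ideal_def by blast
  then have "monomial (yexp m) \<in> gen_sections (raise_at i (fine_base i (fine_deg i m)))" by (simp add: graded_eval_single)
  then have "monomial (yexp m) \<in> ray_filtration i (raise_at i (fine_base i (fine_deg i m)) i)" using gen_sections_ray_filtration[OF i] by blast
  moreover have "raise_at i (fine_base i (fine_deg i m)) i = wt (D i) (yexp m) + 1"
    using i by (simp add: raise_at_def fine_base_def lookup_fine_deg)
  ultimately show False using ray_filtration_iff[OF v_monomial[OF i]] by simp
qed

theorem strong_iff_prime:
  "strong_khovanskii_basis n \<rho> (b ` {..<d}) \<longleftrightarrow>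
     (\<forall>i<n. primeideal (initial_ideal vars (lifted_row D i) (relation_ideal n d b D)) (mpoly_ring vars))"
proof -
  have "primeideal (section_ideal i) (mpoly_ring vars) \<longleftrightarrow> prime_section i" if i: "i < n" for i
  proof
    have "gen_sections (raise_at i (\<lambda>_. 0)) \<subseteq> weight_filtration (D i) 1"
      using gen_sections_subset_weight_filtration[OF i, of "raise_at i (\<lambda>_. 0)"] by (simp add: raise_at_def)
    then have "1 \<notin> gen_sections (raise_at i (\<lambda>_. 0))" using one_not_filtration[OF i] by blast
    then show "prime_section i \<Longrightarrow> primeideal (section_ideal i) (mpoly_ring vars)"
      by (rule prime_section_imp_primeideal)
    show "primeideal (section_ideal i) (mpoly_ring vars) \<Longrightarrow> prime_section i"
      by (rule primeideal_imp_prime_section[OF i])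
  qed
  then show ?thesis
    using strong_imp_saturated saturated_imp_strong saturated_iff_prime by (auto simp: initial_ideal_eq)
qed

end

theorem theorem1p5:
  fixes scl :: "rat \<Rightarrow> 'v::ab_group_add \<Rightarrow> 'v"
    and N :: "'v set"
    and \<Sigma> :: "'v set set"
    and n d :: nat
    and \<rho> :: "nat \<Rightarrow> 'v"
    and scale :: "'k::alg_closed_field \<Rightarrow> 'a::idom \<Rightarrow> 'a"
    and A :: "nat \<Rightarrow> 'a set"
    and v :: "'a \<Rightarrow> 'v \<Rightarrow> rat extended"
    and b :: "nat \<Rightarrow> 'a"
    and D :: "nat \<Rightarrow> nat \<Rightarrow> int"
  assumes "rational_lattice scl N"
    and "rational_lattice.smooth_fan scl N \<Sigma>"
    and "bij_betw \<rho> {..<n} (rational_lattice.ray_generators scl N \<Sigma>)"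
    and "k_algebra scale"
    and "k_algebra.finitely_generated scale"
    and "k_algebra.positive_grading scale A"
    and "valued_algebra.toric_flat scl N scale \<Sigma> v A"
    and "valued_algebra.khovanskii_basis scale \<Sigma> v (b ` {..<d})"
    and "valued_algebra.is_diagram v n \<rho> d b D"
  shows "(\<forall>i<n. lifted_row D i \<in> Trop (XY_vars n d) (k_algebra.relation_ideal scale n d b D)) \<and>
    (valued_algebra.strong_khovanskii_basis scale v n \<rho> (b ` {..<d}) \<longleftrightarrow>
      (\<forall>i<n. primeideal
         (initial_ideal (XY_vars n d) (lifted_row D i) (k_algebra.relation_ideal scale n d b D))
         (mpoly_ring (XY_vars n d))))"
proof -
  interpret lat: rational_lattice scl N by (rule assms(1))
  interpret alg: k_algebra scale by (rule assms(4))
  have va: "valued_algebra scl N scale" by (intro valued_algebra.intro assms(1,4))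
  interpret toric_family scl N scale \<Sigma> v A d b n D \<rho>
  proof (intro toric_family.intro toric_family_axioms.intro)
    show "graded_algebra scale A" by (intro graded_algebra.intro graded_algebra_axioms.intro assms(4,6))
    show "cox_relations scale" by (intro cox_relations.intro generated_algebra.intro assms(4))
    show "rational_lattice.fan scl N \<Sigma>" using assms(2) by (simp add: lat.smooth_fan_def)
    show "\<rho> ` {..<n} \<subseteq> rational_lattice.ray_generators scl N \<Sigma>" using assms(3) by (simp add: bij_betw_def)
  qed (use va assms(7-9) in auto)
  show ?thesis using lifted_row_Trop strong_iff_prime by blast
qed

end
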